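(* Let $\mathcal C$ be a category of orthogonal or symplectic type with vector object $X$, and let $t=\gamma c_{X,X}$ be the normalized braiding morphism, with eigenvalues $q$, $-q^{-1}$, $r^{-1}$ on the summands $X_{[2]}$, $X_{[1^2]}$, $\mathbf 1$ of $X\otimes X$ respectively. If $t$ has less than three distinct eigenvalues, then necessarily its eigenvalues are $\pm1$.
   Context: All categories are rigid, strictly monoidal, semisimple, braided $\mathbb C$-linear tensor categories: they are abelian, morphism spaces are finite dimensional complex vector spaces, composition and $\otimes$ are bilinear, endomorphism algebras are semisimple; an object $Y$ is simple if $\mathrm{End}(Y)=\mathbb C$. Young diagrams: $[n]$ is one row of $n$ boxes, $[1^n]$ one column of $n$ boxes. Such a category $\mathcal C$ is of orthogonal or symplectic type if its Grothendieck semiring is that of $\mathrm{Rep}(O(N))$ (including formally $O(\infty)$), of $\mathrm{Rep}(Sp(N))$, or of one of the associated fusion categories. Concretely, the isomorphism classes of simple objects $X_\lambda$ are labeled by the diagrams $\lambda$ in one of the label sets below, $X_\emptyset=\mathbf 1$, and, with $X=X_{[1]}$ (the "vector representation"), $X_\lambda\otimes X\cong\bigoplus_\mu X_\mu$, summed over all $\mu$ in the label set obtained from $\lambda$ by adding or removing one box. Label sets, for fixed $N,M\in\mathbb N$: (i) type $O(\infty)$: all Young diagrams; (ii) type $O(N)$: diagrams with at most $N$ boxes in the first two columns (together); (iii) type $Sp(N)$: diagrams with at most $N$ rows; (iv) orthogonal fusion: $\le N$ boxes in the first two columns and $\le M$ boxes in the first two rows; (v) ortho-symplectic fusion: $\le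 N$ boxes in the first two columns and $\le M$ boxes in the first row; (vi) symplectic fusion: $\le N$ boxes in the first column and $\le M$ boxes in the first row. Throughout, $X\otimes X\cong X_{[2]}\oplus X_{[1^2]}\oplus\mathbf 1$. Parameters: $c_{X,X}$ is the braiding morphism of $X$ with itself, and $q,r\in\mathbb C^*$ and a fourth root of unity $\gamma$ are chosen (this is always possible) such that $t=\gamma c_{X,X}$ acts on the summands $X_{[2]},X_{[1^2]},\mathbf 1$ of $X\otimes X$ by $q,-q^{-1},r^{-1}$ respectively.
   Formalization: For type O(2) the case q = -1/q is excluded: there q = ±i, so the claim always fails, and the case occurs, e.g. representations of the normalizer of a maximal torus in SL(2,C) with the usual flip, where t has eigenvalues i and -i. *)

theory Defs
  imports "HOL-Analysis.Analysis"
begin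

section \<open>Complex-linear strict braided tensor categories\<close>

text \<open>
  The objects are the elements of the type \<open>'o\<close>. The morphism spaces are subspaces of one
  ambient complex vector space with underlying additive group \<open>'m\<close>. Every (small) linear
  category has this form: take for \<open>'m\<close> the direct sum of its morphism spaces. In particular
  zero morphisms with different source or target are the same element of \<open>'m\<close>, and the source
  and target of a morphism are always specified through a statement \<open>f \<in> Hom C a b\<close>.
\<close>

record ('o, 'm) tensor_cat =
  Hom :: "'o \<Rightarrow> 'o \<Rightarrow> 'm set"
  idn :: "'o \<Rightarrow> 'm"
  comp :: "'m \<Rightarrow> 'm \<Rightarrow> 'm"  (infixl "\<cdot>\<index>" 70)
  smult :: "complex \<Rightarrow> 'm \<Rightarrow> 'm"  (infixr "\<odot>\<index>" 75)
  tobj :: "'o \<Rightarrow> 'o \<Rightarrow> 'o"  (infixl "\<otimes>\<index>" 72)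
  tmor :: "'m \<Rightarrow> 'm \<Rightarrow> 'm"  (infixl "\<boxtimes>\<index>" 72)
  tunit :: "'o"
  braid :: "'o \<Rightarrow> 'o \<Rightarrow> 'm"

text \<open>\<open>g \<cdot>\<^bsub>C\<^esub> f\<close> is \<open>g\<close> after \<open>f\<close>.\<close>

locale linear_category = vector_space "smult C"
  for C :: "('o, 'm::ab_group_add) tensor_cat" (structure) +
  assumes Hom_subspace: "subspace (Hom C a b)"
    and Hom_finite_dim: "\<exists>B. finite B \<and> Hom C a b \<subseteq> span B"
    and idn_in_Hom: "idn C a \<in> Hom C a a"
    and comp_in_Hom: "f \<in> Hom C a b \<Longrightarrow> g \<in> Hom C b c \<Longrightarrow> g \<cdot> f \<in> Hom C a c"
    and comp_idn: "f \<in> Hom C a b \<Longrightarrow> f \<cdot> idn C a = f"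
    and idn_comp: "f \<in> Hom C a b \<Longrightarrow> idn C b \<cdot> f = f"
    and comp_assoc: "f \<in> Hom C a b \<Longrightarrow> g \<in> Hom C b c \<Longrightarrow> h \<in> Hom C c d \<Longrightarrow>
           (h \<cdot> g) \<cdot> f = h \<cdot> (g \<cdot> f)"
    and comp_add_left: "f \<in> Hom C a b \<Longrightarrow> g \<in> Hom C b c \<Longrightarrow> g' \<in> Hom C b c \<Longrightarrow>
           (g + g') \<cdot> f = (g \<cdot> f) + (g' \<cdot> f)"
    and comp_add_right: "f \<in> Hom C a b \<Longrightarrow> f' \<in> Hom C a b \<Longrightarrow> g \<in> Hom C b c \<Longrightarrow>
           g \<cdot> (f + f') = (g \<cdot> f) + (g \<cdot> f')"
    and comp_smult_left: "f \<in> Hom C a b \<Longrightarrow> g \<in> Hom C b c \<Longrightarrow> (z \<odot> g) \<cdot> f = z \<odot> (g \<cdot> f)"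
    and comp_smult_right: "f \<in> Hom C a b \<Longrightarrow> g \<in> Hom C b c \<Longrightarrow> g \<cdot> (z \<odot> f) = z \<odot> (g \<cdot> f)"

definition iso_mor :: "('o, 'm) tensor_cat \<Rightarrow> 'o \<Rightarrow> 'o \<Rightarrow> 'm \<Rightarrow> bool" where
  "iso_mor C a b f \<longleftrightarrow> f \<in> Hom C a b \<and>
     (\<exists>g \<in> Hom C b a. g \<cdot>\<^bsub>C\<^esub> f = idn C a \<and> f \<cdot>\<^bsub>C\<^esub> g = idn C b)"

definition iso_obj :: "('o, 'm) tensor_cat \<Rightarrow> 'o \<Rightarrow> 'o \<Rightarrow> bool" where
  "iso_obj C a b \<longleftrightarrow> (\<exists>f. iso_mor C a b f)"

text \<open>\<open>s\<close> is isomorphic to the direct sum of the finite family \<open>F i\<close>, \<open>i \<in> I\<close>.\<close>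

definition is_direct_sum ::
  "('o, 'm::ab_group_add) tensor_cat \<Rightarrow> 'o \<Rightarrow> 'i set \<Rightarrow> ('i \<Rightarrow> 'o) \<Rightarrow> bool" where
  "is_direct_sum C s I F \<longleftrightarrow> finite I \<and>
     (\<exists>\<iota> \<pi>. (\<forall>i\<in>I. \<iota> i \<in> Hom C (F i) s \<and> \<pi> i \<in> Hom C s (F i)) \<and>
            (\<forall>i\<in>I. \<forall>j\<in>I. \<pi> i \<cdot>\<^bsub>C\<^esub> \<iota> j = (if i = j then idn C (F i) else 0)) \<and>
            (\<Sum>i\<in>I. \<iota> i \<cdot>\<^bsub>C\<^esub> \<pi> i) = idn C s)"

definition mono_mor :: "('o, 'm) tensor_cat \<Rightarrow> 'o \<Rightarrow> 'o \<Rightarrow> 'm \<Rightarrow> bool" where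
  "mono_mor C a b f \<longleftrightarrow> f \<in> Hom C a b \<and>
     (\<forall>x. \<forall>g \<in> Hom C x a. \<forall>h \<in> Hom C x a. f \<cdot>\<^bsub>C\<^esub> g = f \<cdot>\<^bsub>C\<^esub> h \<longrightarrow> g = h)"

definition epi_mor :: "('o, 'm) tensor_cat \<Rightarrow> 'o \<Rightarrow> 'o \<Rightarrow> 'm \<Rightarrow> bool" where
  "epi_mor C a b f \<longleftrightarrow> f \<in> Hom C a b \<and>
     (\<forall>x. \<forall>g \<in> Hom C b x. \<forall>h \<in> Hom C b x. g \<cdot>\<^bsub>C\<^esub> f = h \<cdot>\<^bsub>C\<^esub> f \<longrightarrow> g = h)"

text \<open>\<open>k\<close> from \<open>x\<close> to \<open>a\<close> is a kernel of \<open>f\<close> from \<open>a\<close> to \<open>b\<close>; dually for cokernels.\<close>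

definition is_kernel ::
  "('o, 'm::ab_group_add) tensor_cat \<Rightarrow> 'o \<Rightarrow> 'o \<Rightarrow> 'o \<Rightarrow> 'm \<Rightarrow> 'm \<Rightarrow> bool" where
  "is_kernel C x a b k f \<longleftrightarrow> k \<in> Hom C x a \<and> f \<in> Hom C a b \<and> f \<cdot>\<^bsub>C\<^esub> k = 0 \<and>
     (\<forall>y. \<forall>g \<in> Hom C y a. f \<cdot>\<^bsub>C\<^esub> g = 0 \<longrightarrow> (\<exists>!h. h \<in> Hom C y x \<and> k \<cdot>\<^bsub>C\<^esub> h = g))"

definition is_cokernel ::
  "('o, 'm::ab_group_add) tensor_cat \<Rightarrow> 'o \<Rightarrow> 'o \<Rightarrow> 'o \<Rightarrow> 'm \<Rightarrow> 'm \<Rightarrow> bool" where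
  "is_cokernel C a b x k f \<longleftrightarrow> k \<in> Hom C b x \<and> f \<in> Hom C a b \<and> k \<cdot>\<^bsub>C\<^esub> f = 0 \<and>
     (\<forall>y. \<forall>g \<in> Hom C b y. g \<cdot>\<^bsub>C\<^esub> f = 0 \<longrightarrow> (\<exists>!h. h \<in> Hom C x y \<and> h \<cdot>\<^bsub>C\<^esub> k = g))"

locale abelian_linear_category = linear_category C
  for C :: "('o, 'm::ab_group_add) tensor_cat" (structure) +
  assumes zero_object: "\<exists>z. \<forall>a. Hom C z a = {0} \<and> Hom C a z = {0}"
    and biproduct: "\<exists>s. is_direct_sum C s UNIV (\<lambda>i::bool. if i then a else b)"
    and has_kernel: "f \<in> Hom C a b \<Longrightarrow> \<exists>x k. is_kernel C x a b k f"
    and has_cokernel: "f \<in> Hom C a b \<Longrightarrow> \<exists>x k. is_cokernel C a b x k f"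
    and mono_is_kernel: "mono_mor C a b f \<Longrightarrow> \<exists>c g. is_kernel C a b c f g"
    and epi_is_cokernel: "epi_mor C a b f \<Longrightarrow> \<exists>c g. is_cokernel C c a b f g"

definition left_ideal :: "('o, 'm::ab_group_add) tensor_cat \<Rightarrow> 'o \<Rightarrow> 'm set \<Rightarrow> bool" where
  "left_ideal C a I \<longleftrightarrow> I \<subseteq> Hom C a a \<and> module.subspace (smult C) I \<and>
     (\<forall>g \<in> Hom C a a. \<forall>f \<in> I. g \<cdot>\<^bsub>C\<^esub> f \<in> I)"

text \<open>The algebra \<open>End(a)\<close> is semisimple: every left ideal is a direct summand.\<close>

definition semisimple_End :: "('o, 'm::ab_group_add) tensor_cat \<Rightarrow> 'o \<Rightarrow> bool" where
  "semisimple_End C a \<longleftrightarrow> (\<forall>I. left_ideal C a I \<longrightarrow>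
     (\<exists>J. left_ideal C a J \<and> I \<inter> J = {0} \<and> {f + g | f g. f \<in> I \<and> g \<in> J} = Hom C a a))"

locale semisimple_category = abelian_linear_category C
  for C :: "('o, 'm::ab_group_add) tensor_cat" (structure) +
  assumes semisimple: "semisimple_End C a"

text \<open>\<open>End(a) = \<complex>\<close>, which includes \<open>End(a) \<noteq> 0\<close>.\<close>

definition simple_obj :: "('o, 'm::zero) tensor_cat \<Rightarrow> 'o \<Rightarrow> bool" where
  "simple_obj C a \<longleftrightarrow> idn C a \<noteq> 0 \<and> Hom C a a = range (\<lambda>z. z \<odot>\<^bsub>C\<^esub> idn C a)"

locale strict_tensor_category = linear_category C
  for C :: "('o, 'm::ab_group_add) tensor_cat" (structure) +
  assumes tobj_assoc: "(a \<otimes> b) \<otimes> c = a \<otimes> (b \<otimes> c)"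
    and tunit_tobj: "tunit C \<otimes> a = a"
    and tobj_tunit: "a \<otimes> tunit C = a"
    and tmor_in_Hom: "f \<in> Hom C a b \<Longrightarrow> g \<in> Hom C c d \<Longrightarrow> f \<boxtimes> g \<in> Hom C (a \<otimes> c) (b \<otimes> d)"
    and tmor_idn: "idn C a \<boxtimes> idn C b = idn C (a \<otimes> b)"
    and tmor_comp: "f \<in> Hom C a b \<Longrightarrow> g \<in> Hom C b c \<Longrightarrow> f' \<in> Hom C a' b' \<Longrightarrow> g' \<in> Hom C b' c' \<Longrightarrow>
           (g \<cdot> f) \<boxtimes> (g' \<cdot> f') = (g \<boxtimes> g') \<cdot> (f \<boxtimes> f')"
    and tmor_assoc: "f \<in> Hom C a a' \<Longrightarrow> g \<in> Hom C b b' \<Longrightarrow> h \<in> Hom C c c' \<Longrightarrow>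
           (f \<boxtimes> g) \<boxtimes> h = f \<boxtimes> (g \<boxtimes> h)"
    and tunit_tmor: "f \<in> Hom C a b \<Longrightarrow> idn C (tunit C) \<boxtimes> f = f"
    and tmor_tunit: "f \<in> Hom C a b \<Longrightarrow> f \<boxtimes> idn C (tunit C) = f"
    and tmor_add_left: "f \<in> Hom C a b \<Longrightarrow> f' \<in> Hom C a b \<Longrightarrow> g \<in> Hom C c d \<Longrightarrow>
           (f + f') \<boxtimes> g = (f \<boxtimes> g) + (f' \<boxtimes> g)"
    and tmor_add_right: "f \<in> Hom C a b \<Longrightarrow> g \<in> Hom C c d \<Longrightarrow> g' \<in> Hom C c d \<Longrightarrow>
           f \<boxtimes> (g + g') = (f \<boxtimes> g) + (f \<boxtimes> g')"
    and tmor_smult_left: "f \<in> Hom C a b \<Longrightarrow> g \<in> Hom C c d \<Longrightarrow> (z \<odot> f) \<boxtimes> g = z \<odot> (f \<boxtimes> g)"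
    and tmor_smult_right: "f \<in> Hom C a b \<Longrightarrow> g \<in> Hom C c d \<Longrightarrow> f \<boxtimes> (z \<odot> g) = z \<odot> (f \<boxtimes> g)"

text \<open>\<open>b\<close> is a left dual of \<open>a\<close> (equivalently, \<open>a\<close> is a right dual of \<open>b\<close>).\<close>

definition dual_pair :: "('o, 'm) tensor_cat \<Rightarrow> 'o \<Rightarrow> 'o \<Rightarrow> bool" where
  "dual_pair C b a \<longleftrightarrow>
     (\<exists>ev \<in> Hom C (b \<otimes>\<^bsub>C\<^esub> a) (tunit C). \<exists>coev \<in> Hom C (tunit C) (a \<otimes>\<^bsub>C\<^esub> b).
        (idn C a \<boxtimes>\<^bsub>C\<^esub> ev) \<cdot>\<^bsub>C\<^esub> (coev \<boxtimes>\<^bsub>C\<^esub> idn C a) = idn C a \<and>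
        (ev \<boxtimes>\<^bsub>C\<^esub> idn C b) \<cdot>\<^bsub>C\<^esub> (idn C b \<boxtimes>\<^bsub>C\<^esub> coev) = idn C b)"

locale rigid_tensor_category = strict_tensor_category C
  for C :: "('o, 'm::ab_group_add) tensor_cat" (structure) +
  assumes left_dual: "\<exists>b. dual_pair C b a"
    and right_dual: "\<exists>b. dual_pair C a b"

locale braided_tensor_category = strict_tensor_category C
  for C :: "('o, 'm::ab_group_add) tensor_cat" (structure) +
  assumes braid_iso: "iso_mor C (a \<otimes> b) (b \<otimes> a) (braid C a b)"
    and braid_natural: "f \<in> Hom C a a' \<Longrightarrow> g \<in> Hom C b b' \<Longrightarrow>
           braid C a' b' \<cdot> (f \<boxtimes> g) = (g \<boxtimes> f) \<cdot> braid C a b"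
    and hexagon_right: "braid C a (b \<otimes> c) =
           (idn C b \<boxtimes> braid C a c) \<cdot> (braid C a b \<boxtimes> idn C c)"
    and hexagon_left: "braid C (a \<otimes> b) c =
           (braid C a c \<boxtimes> idn C b) \<cdot> (idn C a \<boxtimes> braid C b c)"

locale semisimple_braided_category =
  semisimple_category C + rigid_tensor_category C + braided_tensor_category C
  for C :: "('o, 'm::ab_group_add) tensor_cat" (structure)

definition eigenvalues :: "('o, 'm::zero) tensor_cat \<Rightarrow> 'o \<Rightarrow> 'm \<Rightarrow> complex set" where
  "eigenvalues C a t =
     {z. \<exists>y. \<exists>f \<in> Hom C y a. f \<noteq> 0 \<and> t \<cdot>\<^bsub>C\<^esub> f = z \<odot>\<^bsub>C\<^esub> f}"

text \<open>The endomorphism \<open>t\<close> of \<open>a\<close> acts by the scalar \<open>z\<close> on the subobjects of \<open>a\<close> isomorphic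
  to \<open>y\<close>.\<close>

definition acts_by :: "('o, 'm) tensor_cat \<Rightarrow> 'o \<Rightarrow> 'm \<Rightarrow> 'o \<Rightarrow> complex \<Rightarrow> bool" where
  "acts_by C a t y z \<longleftrightarrow> (\<forall>f \<in> Hom C y a. t \<cdot>\<^bsub>C\<^esub> f = z \<odot>\<^bsub>C\<^esub> f)"


section \<open>Young diagrams and categories of orthogonal or symplectic type\<close>

text \<open>A Young diagram is the set of its boxes; \<open>(i, j)\<close> is the box in row \<open>i\<close> and column \<open>j\<close>,
  both counted from 0.\<close>

type_synonym diagram = "(nat \<times> nat) set"

definition young :: "diagram \<Rightarrow> bool" where
  "young D \<longleftrightarrow> finite D \<and> (\<forall>i j i' j'. (i, j) \<in> D \<and> i' \<le> i \<and> j' \<le> j \<longrightarrow> (i', j') \<in> D)"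

definition row_diagram :: "nat \<Rightarrow> diagram" where
  "row_diagram n = {0} \<times> {..<n}"

definition column_diagram :: "nat \<Rightarrow> diagram" where
  "column_diagram n = {..<n} \<times> {0}"

definition boxes_in_rows :: "nat \<Rightarrow> diagram \<Rightarrow> nat" where
  "boxes_in_rows k D = card {(i, j) \<in> D. i < k}"

definition boxes_in_columns :: "nat \<Rightarrow> diagram \<Rightarrow> nat" where
  "boxes_in_columns k D = card {(i, j) \<in> D. j < k}"

definition adds_box :: "diagram \<Rightarrow> diagram \<Rightarrow> bool" where
  "adds_box D D' \<longleftrightarrow> (\<exists>b. b \<notin> D \<and> D' = insert b D)"

datatype bcd_type =
    O_infinity
  | O_type nat
  | Sp_type nat
  | O_fusion nat nat
  | OSp_fusion nat nat
  | Sp_fusion nat nat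

text \<open>The number of rows is the number of boxes in the first column.\<close>

fun labels :: "bcd_type \<Rightarrow> diagram set" where
  "labels O_infinity = {D. young D}"
| "labels (O_type N) = {D. young D \<and> boxes_in_columns 2 D \<le> N}"
| "labels (Sp_type N) = {D. young D \<and> boxes_in_columns 1 D \<le> N}"
| "labels (O_fusion N M) =
     {D. young D \<and> boxes_in_columns 2 D \<le> N \<and> boxes_in_rows 2 D \<le> M}"
| "labels (OSp_fusion N M) =
     {D. young D \<and> boxes_in_columns 2 D \<le> N \<and> boxes_in_rows 1 D \<le> M}"
| "labels (Sp_fusion N M) =
     {D. young D \<and> boxes_in_columns 1 D \<le> N \<and> boxes_in_rows 1 D \<le> M}"

text \<open>\<open>X\<close> picks the simple object \<open>X D\<close> for every label \<open>D\<close>; its values at other sets are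
  irrelevant. The condition \<open>two_boxes\<close> is the standing assumption that \<open>X \<otimes> X\<close>, for the vector
  object \<open>X\<close>, has the three summands labelled by \<open>[2]\<close>, \<open>[1\<^sup>2]\<close> and the empty diagram; it rules
  out very small \<open>N\<close> and \<open>M\<close>.\<close>

locale bcd_category = semisimple_braided_category C
  for C :: "('o, 'm::ab_group_add) tensor_cat" (structure)
    and T :: bcd_type and X :: "diagram \<Rightarrow> 'o" +
  assumes two_boxes: "row_diagram 2 \<in> labels T" "column_diagram 2 \<in> labels T"
    and X_simple: "D \<in> labels T \<Longrightarrow> simple_obj C (X D)"
    and X_distinct: "D \<in> labels T \<Longrightarrow> D' \<in> labels T \<Longrightarrow> iso_obj C (X D) (X D') \<Longrightarrow> D = D'"
    and X_complete: "simple_obj C a \<Longrightarrow> \<exists>D \<in> labels T. iso_obj C a (X D)"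
    and X_empty: "X {} = tunit C"
    and X_fusion: "D \<in> labels T \<Longrightarrow>
           is_direct_sum C (X D \<otimes> X (row_diagram 1))
             {D' \<in> labels T. adds_box D D' \<or> adds_box D' D} X"

text \<open>
  Type \<open>O_type 2\<close> is degenerate: the normalizer \<open>G\<close> of a maximal torus in \<open>SL(2)\<close> has the same
  representation semiring as \<open>O(2)\<close>. For the usual symmetric braiding of \<open>Rep(G)\<close> and
  \<open>V = \<complex>\<^sup>2\<close>, the braiding \<open>c\<close> of \<open>V\<close> with itself is \<open>1\<close> on both nontrivial summands of
  \<open>V \<otimes> V\<close> and \<open>-1\<close> on the trivial one. A multiple of \<open>c\<close> has eigenvalues \<open>q\<close> and \<open>-1/q\<close>
  on the two nontrivial summands only if \<open>q = -1/q = \<plusminus>\<i>\<close>, so the normalized braiding has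
  the eigenvalues \<open>\<i>\<close> and \<open>-\<i>\<close>.
\<close>

end

theory Submission
  imports Defs
begin

text \<open>
  Let \<open>u : 1 \<rightarrow> V \<otimes> V\<close> and \<open>v : V \<otimes> V \<rightarrow> 1\<close> split off the unit of \<open>V \<otimes> V\<close>. By naturality of the
  braiding, \<open>t\<^sub>2 t\<^sub>1 (1 \<otimes> u) = \<gamma>\<^sup>2 (u \<otimes> 1)\<close> and \<open>t\<^sub>1 t\<^sub>2 (u \<otimes> 1) = \<gamma>\<^sup>2 (1 \<otimes> u)\<close>, and \<open>u \<otimes> 1\<close>, \<open>1 \<otimes> u\<close>
  are linearly independent. If \<open>1/r\<close> is \<open>q\<close> or \<open>-1/q\<close>, then \<open>t\<close> satisfies a Hecke relation
  \<open>t\<^sup>2 = z t + 1\<close>, \<open>z = q - 1/q\<close>, and these two equations give \<open>z = 0\<close>.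

  If \<open>q = -1/q\<close>, then \<open>t = q (1 - \<epsilon> u v)\<close> with \<open>\<epsilon> = \<gamma>\<^sup>2\<close>, after rescaling \<open>v\<close> so that \<open>v u = 2 \<epsilon>\<close> and
  \<open>u\<close>, \<open>v\<close> satisfy the zigzag identities. Such a braiding does not distinguish \<open>[2]\<close> from \<open>[1\<^sup>2]\<close>.
  When \<open>[2,1]\<close> is a label, \<open>X\<^bsub>[2,1]\<^esub>\<close> occurs in \<open>V\<^bsup>\<otimes>3\<^esup>\<close> both with all adjacent pairs of strands in
  \<open>X\<^bsub>[2]\<^esub>\<close> and with all adjacent pairs in \<open>X\<^bsub>[1\<^sup>2]\<^esub>\<close>; rotating the projection onto \<open>X\<^bsub>[2]\<^esub>\<close> by a quarter
  turn then leads to a contradiction. When \<open>[2,1]\<close> is not a label, the labels form a chain with one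
  extra leg, which is finite because type \<open>O(2)\<close> is excluded; its fusion rules are incompatible with
  the value \<open>\<plusminus>2\<close> of the loop \<open>v u\<close>.
\<close>

section \<open>Linear categories and the Schur lemma\<close>

text \<open>The obstacle is the case q = -1/q with 1/r different from q. There \<open>t\<close> is q
  times the involution 1 - 2 u v (with v u = 1), which up to a factor is the flip on a
  two-dimensional representation of SL(2) or of a subgroup. Relations between crossings, cups and
  caps alone can therefore not be contradictory; an endomorphism of \<open>V \<otimes> V\<close>
  outside the span of 1 and u v has to be pulled through the crossings. The projection onto the
  summand [2] serves for this. Without the label [2,1] there is too little room in
  \<open>V \<otimes> V \<otimes> V\<close> for that argument. The fusion graph of \<open>V\<close>
  is then a finite Dynkin diagram of type D, whose adjacency matrix has norm less than 2, whereas
  the loop value \<plusminus>2 would be an eigenvalue of it. Type O(2) gives the infinite diagram,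
  of norm 2, and this is why it is set apart. No trace is given on general objects, so quotients of
  neighbouring dimensions, obtained by closing a single strand \<open>V\<close>, take the place of
  dimensions.\<close>

context linear_category
begin

lemma zero_in_Hom [simp]: "0 \<in> Hom C a b"
  using Hom_subspace subspace_0 by blast

lemma add_in_Hom: "f \<in> Hom C a b \<Longrightarrow> g \<in> Hom C a b \<Longrightarrow> f + g \<in> Hom C a b"
  using Hom_subspace subspace_add by blast

lemma diff_in_Hom: "f \<in> Hom C a b \<Longrightarrow> g \<in> Hom C a b \<Longrightarrow> f - g \<in> Hom C a b"
  using Hom_subspace subspace_diff by blast

lemma smult_in_Hom: "f \<in> Hom C a b \<Longrightarrow> z \<odot> f \<in> Hom C a b"
  using Hom_subspace subspace_scale by blast

lemma sum_in_Hom: "(\<And>i. i \<in> I \<Longrightarrow> F i \<in> Hom C a b) \<Longrightarrow> sum F I \<in> Hom C a b"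
  using Hom_subspace subspace_sum by blast

lemma comp_zero_left: "f \<in> Hom C a b \<Longrightarrow> 0 \<cdot> f = 0"
  using comp_smult_left[of f a b 0 b 0] by simp

lemma comp_zero_right: "f \<in> Hom C a b \<Longrightarrow> f \<cdot> 0 = 0"
  using comp_smult_right[of 0 a a f b 0] by simp

lemma comp_diff_left:
  assumes "f \<in> Hom C a b" "g \<in> Hom C b c" "g' \<in> Hom C b c"
  shows "(g - g') \<cdot> f = g \<cdot> f - g' \<cdot> f"
  using comp_add_left[OF assms(1) diff_in_Hom[OF assms(2,3)] assms(3)] by (simp add: algebra_simps)

lemma comp_diff_right:
  assumes "f \<in> Hom C a b" "f' \<in> Hom C a b" "g \<in> Hom C b c"
  shows "g \<cdot> (f - f') = g \<cdot> f - g \<cdot> f'"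
  using comp_add_right[OF diff_in_Hom[OF assms(1,2)] assms(2,3)] by (simp add: algebra_simps)

lemma comp_sum_left:
  assumes "finite I" "f \<in> Hom C a b" "\<And>i. i \<in> I \<Longrightarrow> F i \<in> Hom C b c"
  shows "sum F I \<cdot> f = (\<Sum>i\<in>I. F i \<cdot> f)"
  using assms
proof (induction I rule: finite_induct)
  case empty
  then show ?case by (simp add: comp_zero_left)
next
  case (insert i I)
  have "(F i + sum F I) \<cdot> f = F i \<cdot> f + sum F I \<cdot> f"
    using insert.prems by (intro comp_add_left[of _ a b _ c]) (auto intro: sum_in_Hom)
  with insert show ?case by simp
qed

lemma comp_sum_right:
  assumes "finite I" "g \<in> Hom C b c" "\<And>i. i \<in> I \<Longrightarrow> F i \<in> Hom C a b"
  shows "g \<cdot> sum F I = (\<Sum>i\<in>I. g \<cdot> F i)"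
  using assms
proof (induction I rule: finite_induct)
  case empty
  then show ?case by (simp add: comp_zero_right)
next
  case (insert i I)
  have "g \<cdot> (F i + sum F I) = g \<cdot> F i + g \<cdot> sum F I"
    using insert.prems by (intro comp_add_right[of _ a b _ _ c]) (auto intro: sum_in_Hom)
  with insert show ?case by simp
qed

lemma simple_scalar:
  assumes "simple_obj C a" "f \<in> Hom C a a"
  obtains z where "f = z \<odot> idn C a"
  using assms unfolding simple_obj_def by auto

lemma simple_scalar_eq:
  "simple_obj C a \<Longrightarrow> z \<odot> idn C a = w \<odot> idn C a \<longleftrightarrow> z = w"
  unfolding simple_obj_def by auto

text \<open>If \<open>g \<cdot> f\<close> and \<open>f \<cdot> g\<close> are the scalars \<open>z\<close> and \<open>w\<close>, then \<open>z f = f g f = w f\<close>.\<close>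

lemma simple_iso:
  assumes "simple_obj C a" "simple_obj C b" "f \<in> Hom C a b" "g \<in> Hom C b a" "g \<cdot> f \<noteq> 0"
  shows "iso_obj C a b"
proof -
  obtain z where z: "g \<cdot> f = z \<odot> idn C a"
    using simple_scalar assms(1,3,4) comp_in_Hom by metis
  obtain w where w: "f \<cdot> g = w \<odot> idn C b"
    using simple_scalar assms(2,3,4) comp_in_Hom by metis
  have "z \<noteq> 0" using z assms(5) by auto
  have f: "f \<noteq> 0" using assms comp_zero_right by metis
  have "(f \<cdot> g) \<cdot> f = f \<cdot> (g \<cdot> f)" using comp_assoc assms by metis
  then have "w \<odot> f = z \<odot> f"
    using z w assms(3) by (simp add: comp_smult_left[OF _ idn_in_Hom] comp_smult_right[OF idn_in_Hom]
        idn_comp comp_idn)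
  then have "w = z" using f by simp
  have "(inverse z \<odot> g) \<cdot> f = idn C a" "f \<cdot> (inverse z \<odot> g) = idn C b"
    using \<open>z \<noteq> 0\<close> \<open>w = z\<close> z w assms(3,4) by (simp_all add: comp_smult_left comp_smult_right)
  then show ?thesis
    unfolding iso_obj_def iso_mor_def using assms(3,4) smult_in_Hom by blast
qed

end

context semisimple_category
begin

text \<open>If \<open>a\<close> and \<open>b\<close> are not isomorphic, then \<open>Hom(a, b)\<close> is a left ideal with square zero in
  the semisimple algebra \<open>End(a \<oplus> b)\<close>.\<close>

lemma schur:
  assumes "simple_obj C a" "simple_obj C b" "\<not> iso_obj C a b"
  shows "Hom C a b = {0}"
proof -
  obtain s where "is_direct_sum C s UNIV (\<lambda>i::bool. if i then a else b)"
    using biproduct by blast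
  then obtain \<iota> \<pi> where
    in': "\<And>i::bool. \<iota> i \<in> Hom C (if i then a else b) s \<and> \<pi> i \<in> Hom C s (if i then a else b)" and
    orth: "\<And>i j. \<pi> i \<cdot> \<iota> j = (if i = j then idn C (if i then a else b) else 0)" and
    compl: "(\<Sum>i\<in>UNIV. \<iota> i \<cdot> \<pi> i) = idn C s"
    unfolding is_direct_sum_def by auto
  define i j p r where "i = \<iota> True" and "j = \<iota> False" and "p = \<pi> True" and "r = \<pi> False"
  have i: "i \<in> Hom C a s" and j: "j \<in> Hom C b s" and p: "p \<in> Hom C s a" and r: "r \<in> Hom C s b"
    using in'[of True] in'[of False] by (auto simp: i_def j_def p_def r_def)
  have pi: "p \<cdot> i = idn C a" "p \<cdot> j = 0"
    using orth by (auto simp: i_def j_def p_def r_def)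
  have rj: "r \<cdot> j = idn C b" using orth[of False False] by (auto simp: j_def r_def)
  have one: "i \<cdot> p + j \<cdot> r = idn C s"
    using compl by (simp add: UNIV_bool i_def j_def p_def r_def add.commute)
  \<comment> \<open>This is the copy of \<open>Hom C a b\<close> inside End(s): project to
    \<open>a\<close>, cross over to \<open>b\<close>, include. The goal is that it vanishes.\<close>
  define I where "I = {j \<cdot> (h \<cdot> p) | h. h \<in> Hom C a b}"
  have II: "\<And>h. h \<in> Hom C a b \<Longrightarrow> j \<cdot> (h \<cdot> p) \<in> I" unfolding I_def by blast
  have IH: "\<And>h. h \<in> Hom C a b \<Longrightarrow> j \<cdot> (h \<cdot> p) \<in> Hom C s s"
    using comp_in_Hom i j p r by metis
  have null: "g \<cdot> h = 0" if "h \<in> Hom C a b" "g \<in> Hom C b a" for g h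
    using simple_iso[OF assms(1,2) that] assms(3) by blast
  \<comment> \<open>Insert 1 = \<open>i \<cdot> p + j \<cdot> r\<close> after
    \<open>g \<cdot> j\<close>. The part through \<open>a\<close> contains a composite from
    \<open>a\<close> over \<open>b\<close> back to \<open>a\<close>, which is zero by
    \<open>null\<close>. The formula yields both that \<open>I\<close> is a left ideal and that its
    square is zero.\<close>
  have mult: "g \<cdot> (j \<cdot> (h \<cdot> p)) = j \<cdot> (((r \<cdot> (g \<cdot> j)) \<cdot> h) \<cdot> p)"
    if g: "g \<in> Hom C s s" and h: "h \<in> Hom C a b" for g h
  proof -
    have hp: "h \<cdot> p \<in> Hom C s b" and gj: "g \<cdot> j \<in> Hom C b s"
      using g h j p comp_in_Hom by metis+
    have pgj: "p \<cdot> (g \<cdot> j) \<in> Hom C b a" and rgj: "r \<cdot> (g \<cdot> j) \<in> Hom C b b"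
      using gj p r comp_in_Hom by metis+
    have "g \<cdot> (j \<cdot> (h \<cdot> p)) = (g \<cdot> j) \<cdot> (h \<cdot> p)"
      using comp_assoc[OF hp j g] by simp
    also have "\<dots> = (i \<cdot> p + j \<cdot> r) \<cdot> ((g \<cdot> j) \<cdot> (h \<cdot> p))"
      using idn_comp[OF comp_in_Hom[OF hp gj]] one by simp
    also have "\<dots> = (i \<cdot> p) \<cdot> ((g \<cdot> j) \<cdot> (h \<cdot> p)) + (j \<cdot> r) \<cdot> ((g \<cdot> j) \<cdot> (h \<cdot> p))"
      by (rule comp_add_left[OF comp_in_Hom[OF hp gj] comp_in_Hom[OF p i] comp_in_Hom[OF r j]])
    also have "(i \<cdot> p) \<cdot> ((g \<cdot> j) \<cdot> (h \<cdot> p)) = i \<cdot> (((p \<cdot> (g \<cdot> j)) \<cdot> h) \<cdot> p)"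
      using comp_assoc[OF comp_in_Hom[OF hp gj] p i] comp_assoc[OF hp gj p] comp_assoc[OF p h pgj]
      by simp
    also have "\<dots> = 0"
      using null[OF h pgj] comp_zero_left[OF p] comp_zero_right[OF i] by simp
    also have "(j \<cdot> r) \<cdot> ((g \<cdot> j) \<cdot> (h \<cdot> p)) = j \<cdot> (((r \<cdot> (g \<cdot> j)) \<cdot> h) \<cdot> p)"
      using comp_assoc[OF comp_in_Hom[OF hp gj] r j] comp_assoc[OF hp gj r] comp_assoc[OF p h rgj]
      by simp
    finally show ?thesis by simp
  qed
  have "left_ideal C s I"
    unfolding left_ideal_def
  proof (intro conjI ballI)
    show "I \<subseteq> Hom C s s" unfolding I_def using IH by blast
    show "subspace I"
    proof (rule subspaceI)
      show "0 \<in> I"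
        unfolding I_def using comp_zero_left[OF p] comp_zero_right[OF j] zero_in_Hom[of a b]
        by (metis (mono_tags, lifting) mem_Collect_eq)
      show "x + y \<in> I" if xy: "x \<in> I" "y \<in> I" for x y
      proof -
        obtain h k where h: "h \<in> Hom C a b" "x = j \<cdot> (h \<cdot> p)"
          and k: "k \<in> Hom C a b" "y = j \<cdot> (k \<cdot> p)" using xy unfolding I_def by blast
        have "x + y = j \<cdot> ((h + k) \<cdot> p)"
          using h k comp_add_left[OF p h(1) k(1)]
            comp_add_right[OF comp_in_Hom[OF p h(1)] comp_in_Hom[OF p k(1)] j] by simp
        then show ?thesis using II[OF add_in_Hom[OF h(1) k(1)]] by simp
      qed
      show "z \<odot> x \<in> I" if x: "x \<in> I" for z x
      proof -
        obtain h where h: "h \<in> Hom C a b" "x = j \<cdot> (h \<cdot> p)" using x unfolding I_def by blast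
        have "z \<odot> x = j \<cdot> ((z \<odot> h) \<cdot> p)"
          using h comp_smult_left[OF p h(1)] comp_smult_right[OF comp_in_Hom[OF p h(1)] j] by simp
        then show ?thesis using II[OF smult_in_Hom[OF h(1)]] by simp
      qed
    qed
    show "g \<cdot> f \<in> I" if g: "g \<in> Hom C s s" and f: "f \<in> I" for g f
    proof -
      obtain h where h: "h \<in> Hom C a b" "f = j \<cdot> (h \<cdot> p)" using f unfolding I_def by blast
      have *: "(r \<cdot> (g \<cdot> j)) \<cdot> h \<in> Hom C a b"
        by (rule comp_in_Hom[OF h(1) comp_in_Hom[OF comp_in_Hom[OF j g] r]])
      show ?thesis using II[OF *] mult[OF g h(1)] h(2) by simp
    qed
  qed
  then obtain J where J: "left_ideal C s J" "I \<inter> J = {0}" "{f + g | f g. f \<in> I \<and> g \<in> J} = Hom C s s"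
    using semisimple[of s, unfolded semisimple_End_def, rule_format, of I] by auto
  obtain n e where ne: "n \<in> I" "e \<in> J" "idn C s = n + e"
  proof -
    have "idn C s \<in> {f + g | f g. f \<in> I \<and> g \<in> J}" using J(3) idn_in_Hom[of s] by simp
    then show ?thesis using that by auto
  qed
  have e: "e \<in> Hom C s s" using ne(2) J(1) unfolding left_ideal_def by auto
  have "h = 0" if h: "h \<in> Hom C a b" for h
  proof -
    define m where "m = j \<cdot> (h \<cdot> p)"
    have mI: "m \<in> I" and ms: "m \<in> Hom C s s" unfolding m_def using II[OF h] IH[OF h] by simp_all
    obtain k where k: "k \<in> Hom C a b" "n = j \<cdot> (k \<cdot> p)" using ne(1) unfolding I_def by blast
    have ns: "n \<in> Hom C s s" using IH[OF k(1)] k(2) by simp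
    have mj: "m \<cdot> j = 0"
    proof -
      have "m \<cdot> j = j \<cdot> (h \<cdot> (p \<cdot> j))"
        unfolding m_def using comp_assoc[OF j comp_in_Hom[OF p h] j] comp_assoc[OF j p h] by simp
      then show ?thesis using pi h comp_zero_right j by metis
    qed
    \<comment> \<open>With 1 = \<open>n + e\<close> and the square of \<open>I\<close> zero,
      \<open>m = m \<cdot> e\<close> lies in the left ideal \<open>J\<close>; being also in
      \<open>I\<close>, it vanishes.\<close>
    have "m \<cdot> n = 0"
      using mult[OF ms k(1)] k(2) mj comp_zero_right[OF r] comp_zero_left[OF k(1)]
        comp_zero_left[OF p] comp_zero_right[OF j] by simp
    then have "m = m \<cdot> e"
      using comp_idn[OF ms] ne(3) comp_add_right[OF ns e ms] by simp
    then have "m \<in> J" using ne(2) J(1) ms unfolding left_ideal_def by metis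
    then have "m = 0" using mI J(2) by blast
    then have "(r \<cdot> m) \<cdot> i = 0" using comp_zero_right[OF r] comp_zero_left[OF i] by simp
    moreover have "r \<cdot> m = h \<cdot> p"
      unfolding m_def using comp_assoc[OF comp_in_Hom[OF p h] j r] rj idn_comp[OF comp_in_Hom[OF p h]]
      by simp
    ultimately have "(h \<cdot> p) \<cdot> i = 0" by simp
    then show ?thesis using comp_assoc[OF i p h] pi(1) comp_idn[OF h] by simp
  qed
  then show ?thesis by auto
qed

end

section \<open>Strand calculus\<close>

context strict_tensor_category
begin

text \<open>The single normal form for a morphism with strands on both sides. Nested whiskerings
  merge by \<open>lay_lay\<close>, so a string diagram becomes a plain composite of
  \<open>lay\<close> terms whose objects are bracketed to the right.\<close>

definition lay :: "'o \<Rightarrow> 'm \<Rightarrow> 'o \<Rightarrow> 'm" where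
  "lay a f b = idn C a \<boxtimes> f \<boxtimes> idn C b"

lemma lay_in_Hom: "f \<in> Hom C x y \<Longrightarrow> lay a f b \<in> Hom C (a \<otimes> (x \<otimes> b)) (a \<otimes> (y \<otimes> b))"
  unfolding lay_def using tmor_in_Hom[OF tmor_in_Hom[OF idn_in_Hom] idn_in_Hom] tobj_assoc by metis

lemma lay_comp:
  assumes "f \<in> Hom C x y" "g \<in> Hom C y z"
  shows "lay a (g \<cdot> f) b = lay a g b \<cdot> lay a f b"
proof -
  note i = idn_in_Hom
  have "idn C a \<boxtimes> (g \<cdot> f) = (idn C a \<boxtimes> g) \<cdot> (idn C a \<boxtimes> f)"
    using tmor_comp[OF i i assms, of a] comp_idn[OF i, of a] by simp
  moreover have "((idn C a \<boxtimes> g) \<cdot> (idn C a \<boxtimes> f)) \<boxtimes> (idn C b \<cdot> idn C b) =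
      (idn C a \<boxtimes> g \<boxtimes> idn C b) \<cdot> (idn C a \<boxtimes> f \<boxtimes> idn C b)"
    by (rule tmor_comp[OF tmor_in_Hom[OF i assms(1)] tmor_in_Hom[OF i assms(2)] i i])
  ultimately show ?thesis unfolding lay_def using comp_idn[OF i, of b] by simp
qed

lemma lay_idn: "lay a (idn C x) b = idn C (a \<otimes> (x \<otimes> b))"
  unfolding lay_def by (simp add: tmor_idn tobj_assoc)

lemma lay_lay: "f \<in> Hom C x y \<Longrightarrow> lay a (lay c f d) b = lay (a \<otimes> c) f (d \<otimes> b)"
proof -
  assume f: "f \<in> Hom C x y"
  note i = idn_in_Hom
  have "idn C a \<boxtimes> ((idn C c \<boxtimes> f) \<boxtimes> idn C d) = (idn C a \<boxtimes> (idn C c \<boxtimes> f)) \<boxtimes> idn C d"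
    using tmor_assoc[OF i tmor_in_Hom[OF i f] i] by simp
  also have "idn C a \<boxtimes> (idn C c \<boxtimes> f) = idn C (a \<otimes> c) \<boxtimes> f"
    using tmor_assoc[OF i i f] by (simp add: tmor_idn)
  finally have "idn C a \<boxtimes> ((idn C c \<boxtimes> f) \<boxtimes> idn C d) \<boxtimes> idn C b =
      ((idn C (a \<otimes> c) \<boxtimes> f) \<boxtimes> idn C d) \<boxtimes> idn C b" by simp
  also have "\<dots> = (idn C (a \<otimes> c) \<boxtimes> f) \<boxtimes> (idn C d \<boxtimes> idn C b)"
    using tmor_assoc[OF tmor_in_Hom[OF i f] i i] .
  finally show ?thesis unfolding lay_def by (simp add: tmor_idn)
qed

lemma lay_tunit: "f \<in> Hom C x y \<Longrightarrow> lay (tunit C) f (tunit C) = f"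
  unfolding lay_def by (metis tunit_tmor tmor_tunit)

lemma idn_tmor: "f \<in> Hom C x y \<Longrightarrow> idn C a \<boxtimes> f = lay a f (tunit C)"
  unfolding lay_def by (metis tmor_tunit tmor_in_Hom idn_in_Hom)

lemma tmor_id: "f \<in> Hom C x y \<Longrightarrow> f \<boxtimes> idn C a = lay (tunit C) f a"
  unfolding lay_def by (metis tunit_tmor)

lemma lay_add: "f \<in> Hom C x y \<Longrightarrow> g \<in> Hom C x y \<Longrightarrow> lay a (f + g) b = lay a f b + lay a g b"
  unfolding lay_def
  using tmor_add_right[OF idn_in_Hom] tmor_add_left[OF tmor_in_Hom[OF idn_in_Hom] tmor_in_Hom[OF idn_in_Hom] idn_in_Hom]
  by metis

lemma lay_smult: "f \<in> Hom C x y \<Longrightarrow> lay a (z \<odot> f) b = z \<odot> lay a f b"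
  unfolding lay_def
  using tmor_smult_right[OF idn_in_Hom] tmor_smult_left[OF tmor_in_Hom[OF idn_in_Hom] idn_in_Hom]
  by metis

lemma lay_zero: "lay a 0 b = 0"
  using lay_smult[OF zero_in_Hom, of _ 0] by simp

lemma lay_diff: "f \<in> Hom C x y \<Longrightarrow> g \<in> Hom C x y \<Longrightarrow> lay a (f - g) b = lay a f b - lay a g b"
  using lay_add[OF diff_in_Hom, of f x y g g a b] by (simp add: algebra_simps)

text \<open>Both sides equal the tensor product of \<open>f\<close> and \<open>g\<close>, with the
  identity of \<open>k\<close> in between, by the interchange law \<open>tmor_comp\<close>.\<close>

lemma lay_exchange:
  assumes f: "f \<in> Hom C x y" and g: "g \<in> Hom C z w"
  shows "lay a f (k \<otimes> (w \<otimes> b)) \<cdot> lay (a \<otimes> (x \<otimes> k)) g b =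
         lay (a \<otimes> (y \<otimes> k)) g b \<cdot> lay a f (k \<otimes> (z \<otimes> b))"
proof -
  note i = idn_in_Hom
  have L: "lay (a \<otimes> (c \<otimes> k)) h b = (idn C a \<boxtimes> idn C c) \<boxtimes> (idn C k \<boxtimes> h \<boxtimes> idn C b)"
    if "h \<in> Hom C z w" for c h
  proof -
    have "lay (a \<otimes> (c \<otimes> k)) h b = (idn C (a \<otimes> c) \<boxtimes> idn C k) \<boxtimes> h \<boxtimes> idn C b"
      unfolding lay_def by (simp add: tmor_idn tobj_assoc)
    also have "\<dots> = idn C (a \<otimes> c) \<boxtimes> (idn C k \<boxtimes> h \<boxtimes> idn C b)"
      using tmor_assoc[OF i i that] tmor_assoc[OF i tmor_in_Hom[OF i that] i] by simp
    finally show ?thesis by (simp add: tmor_idn)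
  qed
  have R: "lay a f (k \<otimes> (c \<otimes> b)) = (idn C a \<boxtimes> f) \<boxtimes> (idn C k \<boxtimes> idn C c \<boxtimes> idn C b)" for c
    unfolding lay_def by (simp add: tmor_idn tobj_assoc)
  note i2 = tmor_in_Hom[OF i i]
  note fa = tmor_in_Hom[OF i f] and ga = tmor_in_Hom[OF tmor_in_Hom[OF i g] i]
  note j = tmor_in_Hom[OF i2 i]
  have "lay a f (k \<otimes> (w \<otimes> b)) \<cdot> lay (a \<otimes> (x \<otimes> k)) g b =
     ((idn C a \<boxtimes> f) \<cdot> (idn C a \<boxtimes> idn C x)) \<boxtimes>
     ((idn C k \<boxtimes> idn C w \<boxtimes> idn C b) \<cdot> (idn C k \<boxtimes> g \<boxtimes> idn C b))"
    unfolding L[OF g] R by (rule tmor_comp[OF i2 fa ga j, symmetric])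
  also have "(idn C a \<boxtimes> f) \<cdot> (idn C a \<boxtimes> idn C x) = (idn C a \<boxtimes> idn C y) \<cdot> (idn C a \<boxtimes> f)"
    using comp_idn[OF fa] idn_comp[OF fa] by (simp add: tmor_idn)
  also have "(idn C k \<boxtimes> idn C w \<boxtimes> idn C b) \<cdot> (idn C k \<boxtimes> g \<boxtimes> idn C b) =
     (idn C k \<boxtimes> g \<boxtimes> idn C b) \<cdot> (idn C k \<boxtimes> idn C z \<boxtimes> idn C b)"
    using comp_idn[OF ga] idn_comp[OF ga] by (simp add: tmor_idn)
  also have "((idn C a \<boxtimes> idn C y) \<cdot> (idn C a \<boxtimes> f)) \<boxtimes>
     ((idn C k \<boxtimes> g \<boxtimes> idn C b) \<cdot> (idn C k \<boxtimes> idn C z \<boxtimes> idn C b)) =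
     lay (a \<otimes> (y \<otimes> k)) g b \<cdot> lay a f (k \<otimes> (z \<otimes> b))"
    unfolding L[OF g] R by (rule tmor_comp[OF fa i2 j ga])
  finally show ?thesis .
qed

end

section \<open>Diagrams on tensor powers of a self-dual object\<close>

locale self_dual_object = strict_tensor_category C
  for C :: "('o, 'm::ab_group_add) tensor_cat" (structure) +
  fixes V :: 'o and u v :: 'm
  assumes u: "u \<in> Hom C (tunit C) (V \<otimes> V)"
    and v: "v \<in> Hom C (V \<otimes> V) (tunit C)"
    and zigzag_left: "(v \<boxtimes> idn C V) \<cdot> (idn C V \<boxtimes> u) = idn C V"
    and zigzag_right: "(idn C V \<boxtimes> v) \<cdot> (u \<boxtimes> idn C V) = idn C V"
begin

primrec pow :: "nat \<Rightarrow> 'o" where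
  "pow 0 = tunit C"
| "pow (Suc n) = V \<otimes> pow n"

lemma pow_add: "pow (m + n) = pow m \<otimes> pow n"
  by (induction m) (simp_all add: tunit_tobj tobj_assoc)

lemma pow_2: "pow 2 = V \<otimes> V" and pow_3: "pow 3 = V \<otimes> (V \<otimes> V)"
  by (simp_all add: numeral_2_eq_2 numeral_3_eq_3 tobj_tunit)

text \<open>\<open>app f i j\<close> applies \<open>f\<close> to the strands between the leftmost \<open>i\<close> and the rightmost \<open>j\<close> ones.\<close>

definition app :: "'m \<Rightarrow> nat \<Rightarrow> nat \<Rightarrow> 'm \<Rightarrow> 'm" where
  "app f i j h = lay (pow i) f (pow j) \<cdot> h"

lemma app_in_Hom:
  assumes "f \<in> Hom C (pow a) (pow b)" "h \<in> Hom C y (pow n)" "n = i + a + j" "m = i + b + j"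
  shows "app f i j h \<in> Hom C y (pow m)"
proof -
  have "lay (pow i) f (pow j) \<in> Hom C (pow n) (pow m)"
    using lay_in_Hom[OF assms(1), of "pow i" "pow j"] assms(3,4) by (simp add: pow_add tobj_assoc)
  then show ?thesis unfolding app_def using assms(2) comp_in_Hom by blast
qed

text \<open>Height exchange of \<open>f\<close> (left) and \<open>g\<close> (right) with
  \<open>k\<close> strands between them. Each may change the number of strands, hence the two values
  \<open>j\<close>, \<open>j'\<close> of strands to the right of \<open>f\<close> and
  \<open>i'\<close>, \<open>i''\<close> to the left of \<open>g\<close>. They are kept as separate
  variables with equations, so that the rule unifies with numerals and arithmetic settles the
  rest.\<close>

lemma app_exchange:
  assumes f: "f \<in> Hom C (pow a) (pow b)" and g: "g \<in> Hom C (pow c) (pow d)"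
    and h: "h \<in> Hom C y (pow n)" and n: "n = i + a + k + c + l"
    and e: "j = k + d + l" "j' = k + c + l" "i' = i + a + k" "i'' = i + b + k"
  shows "app f i j (app g i' l h) = app g i'' l (app f i j' h)"
proof -
  have G: "lay (pow i') g (pow l) \<in> Hom C (pow n) (pow (i' + d + l))"
    using lay_in_Hom[OF g, of "pow i'" "pow l"] n e by (simp add: pow_add tobj_assoc)
  have F: "lay (pow i) f (pow j) \<in> Hom C (pow (i' + d + l)) (pow (i + b + j))"
    using lay_in_Hom[OF f, of "pow i" "pow j"] n e by (simp add: pow_add tobj_assoc)
  have F': "lay (pow i) f (pow j') \<in> Hom C (pow n) (pow (i + b + j'))"
    using lay_in_Hom[OF f, of "pow i" "pow j'"] n e by (simp add: pow_add tobj_assoc)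
  have G': "lay (pow i'') g (pow l) \<in> Hom C (pow (i + b + j')) (pow (i + b + j))"
    using lay_in_Hom[OF g, of "pow i''" "pow l"] n e by (simp add: pow_add tobj_assoc)
  have "lay (pow i) f (pow j) \<cdot> lay (pow i') g (pow l) = lay (pow i'') g (pow l) \<cdot> lay (pow i) f (pow j')"
    using lay_exchange[OF f g, of "pow i" "pow k" "pow l"] e by (simp add: pow_add tobj_assoc)
  then show ?thesis
    unfolding app_def using comp_assoc[OF h G F] comp_assoc[OF h F' G'] by simp
qed

lemma app_comp:
  assumes f: "f \<in> Hom C (pow a) (pow b)" and g: "g \<in> Hom C (pow b) (pow c)"
    and h: "h \<in> Hom C y (pow n)" and n: "n = i + a + j"
  shows "app (g \<cdot> f) i j h = app g i j (app f i j h)"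
proof -
  have F: "lay (pow i) f (pow j) \<in> Hom C (pow n) (pow (i + b + j))"
    using lay_in_Hom[OF f, of "pow i" "pow j"] n by (simp add: pow_add tobj_assoc)
  have G: "lay (pow i) g (pow j) \<in> Hom C (pow (i + b + j)) (pow (i + c + j))"
    using lay_in_Hom[OF g, of "pow i" "pow j"] n by (simp add: pow_add tobj_assoc)
  show ?thesis unfolding app_def lay_comp[OF f g] using comp_assoc[OF h F G] .
qed

lemma app_lay:
  assumes "f \<in> Hom C (pow a) (pow b)"
  shows "app (lay (pow k) f (pow l)) i j h = app f (i + k) (l + j) h"
  unfolding app_def using lay_lay[OF assms] by (simp add: pow_add)

lemma app_add:
  assumes "f \<in> Hom C (pow a) (pow b)" "f' \<in> Hom C (pow a) (pow b)"
    and h: "h \<in> Hom C y (pow n)" and n: "n = i + a + j"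
  shows "app (f + f') i j h = app f i j h + app f' i j h"
proof -
  have F: "lay (pow i) g (pow j) \<in> Hom C (pow n) (pow (i + b + j))" if "g \<in> Hom C (pow a) (pow b)" for g
    using lay_in_Hom[OF that, of "pow i" "pow j"] n by (simp add: pow_add tobj_assoc)
  show ?thesis unfolding app_def lay_add[OF assms(1,2)]
    using comp_add_left[OF h F F] assms by blast
qed

lemma app_smult:
  assumes "f \<in> Hom C (pow a) (pow b)" "h \<in> Hom C y (pow n)" "n = i + a + j"
  shows "app (z \<odot> f) i j h = z \<odot> app f i j h"
proof -
  have F: "lay (pow i) f (pow j) \<in> Hom C (pow n) (pow (i + b + j))"
    using lay_in_Hom[OF assms(1), of "pow i" "pow j"] assms(3) by (simp add: pow_add tobj_assoc)
  show ?thesis unfolding app_def lay_smult[OF assms(1)] using comp_smult_left[OF assms(2) F] .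
qed

lemma app_diff:
  assumes "f \<in> Hom C (pow a) (pow b)" "f' \<in> Hom C (pow a) (pow b)"
    and h: "h \<in> Hom C y (pow n)" and n: "n = i + a + j"
  shows "app (f - f') i j h = app f i j h - app f' i j h"
  using app_add[OF diff_in_Hom[OF assms(1,2)] assms(2) h n] by (simp add: algebra_simps)

lemma app_zero: "h \<in> Hom C y (pow n) \<Longrightarrow> n = i + a + j \<Longrightarrow> app 0 i j h = 0"
  unfolding app_def lay_zero using comp_zero_left by simp

lemma app_idn: "h \<in> Hom C y (pow n) \<Longrightarrow> n = i + a + j \<Longrightarrow> app (idn C (pow a)) i j h = h"
  unfolding app_def lay_idn using idn_comp by (simp add: pow_add tobj_assoc)

lemma app_arg_add:
  assumes "f \<in> Hom C (pow a) (pow b)" "h \<in> Hom C y (pow n)" "h' \<in> Hom C y (pow n)" "n = i + a + j"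
  shows "app f i j (h + h') = app f i j h + app f i j h'"
proof -
  have F: "lay (pow i) f (pow j) \<in> Hom C (pow n) (pow (i + b + j))"
    using lay_in_Hom[OF assms(1), of "pow i" "pow j"] assms(4) by (simp add: pow_add tobj_assoc)
  show ?thesis unfolding app_def using comp_add_right[OF assms(2,3) F] .
qed

lemma app_arg_smult:
  assumes "f \<in> Hom C (pow a) (pow b)" "h \<in> Hom C y (pow n)" "n = i + a + j"
  shows "app f i j (z \<odot> h) = z \<odot> app f i j h"
proof -
  have F: "lay (pow i) f (pow j) \<in> Hom C (pow n) (pow (i + b + j))"
    using lay_in_Hom[OF assms(1), of "pow i" "pow j"] assms(3) by (simp add: pow_add tobj_assoc)
  show ?thesis unfolding app_def using comp_smult_right[OF assms(2) F] .
qed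

lemma app_arg_diff:
  assumes "f \<in> Hom C (pow a) (pow b)" "h \<in> Hom C y (pow n)" "h' \<in> Hom C y (pow n)" "n = i + a + j"
  shows "app f i j (h - h') = app f i j h - app f i j h'"
  using app_arg_add[OF assms(1) diff_in_Hom[OF assms(2,3)] assms(3,4)] by (simp add: algebra_simps)

lemma app_arg_zero: "f \<in> Hom C (pow a) (pow b) \<Longrightarrow> app f i j 0 = 0"
  unfolding app_def using comp_zero_right lay_in_Hom by blast

end

section \<open>Rotation of endomorphisms of two strands\<close>

context self_dual_object
begin

abbreviation "cup \<equiv> app u"
abbreviation "cap \<equiv> app v"

lemma u_pow: "u \<in> Hom C (pow 0) (pow 2)" and v_pow: "v \<in> Hom C (pow 2) (pow 0)"
  using u v by (simp_all add: pow_2)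

lemma cup_in_Hom: "h \<in> Hom C y (pow n) \<Longrightarrow> n = i + j \<Longrightarrow> cup i j h \<in> Hom C y (pow (n + 2))"
  using app_in_Hom[OF u_pow] by simp

lemma cap_in_Hom: "h \<in> Hom C y (pow n) \<Longrightarrow> n = m + 2 \<Longrightarrow> m = i + j \<Longrightarrow> cap i j h \<in> Hom C y (pow m)"
  using app_in_Hom[OF v_pow] by simp

lemma box_in_Hom:
  "f \<in> Hom C (pow 2) (pow 2) \<Longrightarrow> h \<in> Hom C y (pow n) \<Longrightarrow> n = i + 2 + j \<Longrightarrow> app f i j h \<in> Hom C y (pow n)"
  using app_in_Hom[of f 2 2 h y n i j n] by simp

lemma cap_cup_left:
  assumes h: "h \<in> Hom C y (pow n)" and n: "n = i + 1 + j" "i' = i + 1" "j' = 1 + j"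
  shows "cap i j' (cup i' j h) = h"
proof -
  have *: "lay (pow 0) v (pow 1) \<cdot> lay (pow 1) u (pow 0) = idn C (pow 1)"
    using zigzag_left tmor_id[OF v] idn_tmor[OF u] by (simp add: tobj_tunit)
  have F: "lay (pow 1) u (pow 0) \<in> Hom C (pow 1) (pow 3)"
    using lay_in_Hom[OF u_pow, of "pow 1" "pow 0"] by (simp add: pow_3 pow_2 tobj_tunit tunit_tobj)
  have G: "lay (pow 0) v (pow 1) \<in> Hom C (pow 3) (pow 1)"
    using lay_in_Hom[OF v_pow, of "pow 0" "pow 1"] by (simp add: pow_3 pow_2 tobj_tunit tunit_tobj tobj_assoc)
  show ?thesis
    using app_idn[OF h n(1)] app_comp[OF F G h n(1)] * n app_lay[OF u_pow, of 1 0 i j]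
      app_lay[OF v_pow, of 0 1 i j] by simp
qed

lemma cap_cup_right:
  assumes h: "h \<in> Hom C y (pow n)" and n: "n = i + 1 + j" "i' = i + 1" "j' = 1 + j"
  shows "cap i' j (cup i j' h) = h"
proof -
  have *: "lay (pow 1) v (pow 0) \<cdot> lay (pow 0) u (pow 1) = idn C (pow 1)"
    using zigzag_right tmor_id[OF u] idn_tmor[OF v] by (simp add: tobj_tunit)
  have F: "lay (pow 0) u (pow 1) \<in> Hom C (pow 1) (pow 3)"
    using lay_in_Hom[OF u_pow, of "pow 0" "pow 1"] by (simp add: pow_3 pow_2 tobj_tunit tunit_tobj tobj_assoc)
  have G: "lay (pow 1) v (pow 0) \<in> Hom C (pow 3) (pow 1)"
    using lay_in_Hom[OF v_pow, of "pow 1" "pow 0"] by (simp add: pow_3 pow_2 tobj_tunit tunit_tobj tobj_assoc)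
  show ?thesis
    using app_idn[OF h n(1)] app_comp[OF F G h n(1)] * n app_lay[OF u_pow, of 0 1 i j]
      app_lay[OF v_pow, of 1 0 i j] by simp
qed

text \<open>A quarter turn: the left output of \<open>f\<close> is bent down to become the left
  input, and the right input is bent up to become the right output. In \<open>rot_inv\<close> the
  left input becomes the left output and the right output the right input.\<close>

definition rot :: "'m \<Rightarrow> 'm" where
  "rot f = lay (tunit C) v (V \<otimes> V) \<cdot> (lay V f V \<cdot> lay (V \<otimes> V) u (tunit C))"

definition rot_inv :: "'m \<Rightarrow> 'm" where
  "rot_inv f = lay (V \<otimes> V) v (tunit C) \<cdot> (lay V f V \<cdot> lay (tunit C) u (V \<otimes> V))"

lemma
  assumes f: "f \<in> Hom C (pow 2) (pow 2)"
  shows rot_in_Hom: "rot f \<in> Hom C (pow 2) (pow 2)"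
    and app_rot: "h \<in> Hom C y (pow n) \<Longrightarrow> n = i + 2 + j \<Longrightarrow>
      i' = i + 1 \<Longrightarrow> i'' = i + 2 \<Longrightarrow> j' = 1 + j \<Longrightarrow> j'' = 2 + j \<Longrightarrow>
      app (rot f) i j h = cap i j'' (app f i' j' (cup i'' j h))"
proof -
  have A: "lay (pow 2) u (pow 0) \<in> Hom C (pow 2) (pow 4)"
    using lay_in_Hom[OF u_pow, of "pow 2" "pow 0"] pow_add[of 2 2]
    by (simp add: tobj_tunit tunit_tobj)
  have B: "lay (pow 1) f (pow 1) \<in> Hom C (pow 4) (pow 4)"
    using lay_in_Hom[OF f, of "pow 1" "pow 1"] pow_add[of 1 "2 + 1"] pow_add[of 2 1]
    by (simp del: pow.simps)
  have D: "lay (pow 0) v (pow 2) \<in> Hom C (pow 4) (pow 2)"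
    using lay_in_Hom[OF v_pow, of "pow 0" "pow 2"] pow_add[of 2 2] by (simp add: tunit_tobj)
  have r: "rot f = lay (pow 0) v (pow 2) \<cdot> (lay (pow 1) f (pow 1) \<cdot> lay (pow 2) u (pow 0))"
    by (simp add: rot_def pow_2 tobj_tunit)
  show "rot f \<in> Hom C (pow 2) (pow 2)"
    unfolding r by (rule comp_in_Hom[OF comp_in_Hom[OF A B] D])
  assume h: "h \<in> Hom C y (pow n)" "n = i + 2 + j"
    and e: "i' = i + 1" "i'' = i + 2" "j' = 1 + j" "j'' = 2 + j"
  show "app (rot f) i j h = cap i j'' (app f i' j' (cup i'' j h))"
    unfolding r e app_comp[OF comp_in_Hom[OF A B] D h] app_comp[OF A B h]
    using app_lay[OF u_pow, of 2 0] app_lay[OF f, of 1 1] app_lay[OF v_pow, of 0 2] by simp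
qed

lemma
  assumes f: "f \<in> Hom C (pow 2) (pow 2)"
  shows rot_inv_in_Hom: "rot_inv f \<in> Hom C (pow 2) (pow 2)"
    and app_rot_inv: "h \<in> Hom C y (pow n) \<Longrightarrow> n = i + 2 + j \<Longrightarrow>
      i' = i + 1 \<Longrightarrow> i'' = i + 2 \<Longrightarrow> j' = 1 + j \<Longrightarrow> j'' = 2 + j \<Longrightarrow>
      app (rot_inv f) i j h = cap i'' j (app f i' j' (cup i j'' h))"
proof -
  have A: "lay (pow 0) u (pow 2) \<in> Hom C (pow 2) (pow 4)"
    using lay_in_Hom[OF u_pow, of "pow 0" "pow 2"] pow_add[of 2 2]
    by (simp add: tobj_tunit tunit_tobj)
  have B: "lay (pow 1) f (pow 1) \<in> Hom C (pow 4) (pow 4)"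
    using lay_in_Hom[OF f, of "pow 1" "pow 1"] pow_add[of 1 "2 + 1"] pow_add[of 2 1]
    by (simp del: pow.simps)
  have D: "lay (pow 2) v (pow 0) \<in> Hom C (pow 4) (pow 2)"
    using lay_in_Hom[OF v_pow, of "pow 2" "pow 0"] pow_add[of 2 2] by (simp add: tunit_tobj tobj_tunit)
  have r: "rot_inv f = lay (pow 2) v (pow 0) \<cdot> (lay (pow 1) f (pow 1) \<cdot> lay (pow 0) u (pow 2))"
    by (simp add: rot_inv_def pow_2 tobj_tunit)
  show "rot_inv f \<in> Hom C (pow 2) (pow 2)"
    unfolding r by (rule comp_in_Hom[OF comp_in_Hom[OF A B] D])
  assume h: "h \<in> Hom C y (pow n)" "n = i + 2 + j"
    and e: "i' = i + 1" "i'' = i + 2" "j' = 1 + j" "j'' = 2 + j"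
  show "app (rot_inv f) i j h = cap i'' j (app f i' j' (cup i j'' h))"
    unfolding r e app_comp[OF comp_in_Hom[OF A B] D h] app_comp[OF A B h]
    using app_lay[OF u_pow, of 0 2] app_lay[OF f, of 1 1] app_lay[OF v_pow, of 2 0] by simp
qed

lemma app_00: "f \<in> Hom C (pow a) (pow b) \<Longrightarrow> app f 0 0 h = f \<cdot> h"
  unfolding app_def using lay_tunit by simp

text \<open>The calculus rewrites diagrams applied to a morphism; with the identity as that morphism
  it proves equations between endomorphisms.\<close>

lemma app_idn_arg: "f \<in> Hom C (pow a) (pow b) \<Longrightarrow> app f 0 0 (idn C (pow a)) = f"
  using app_00 comp_idn by simp

text \<open>Expanding both turns leaves \<open>f\<close> with a zigzag on its left output and
  another on its right input; both are pulled straight.\<close>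

lemma rot_inv_rot:
  assumes f: "f \<in> Hom C (pow 2) (pow 2)"
  shows "rot_inv (rot f) = f"
proof -
  define h where "h = idn C (pow 2)"
  have h: "h \<in> Hom C (pow 2) (pow 2)" unfolding h_def by (rule idn_in_Hom)
  note r = rot_in_Hom[OF f]
  have h4: "cup 0 2 h \<in> Hom C (pow 2) (pow 4)" using cup_in_Hom[OF h, of 0 2] by simp
  have k4: "cup 1 1 h \<in> Hom C (pow 2) (pow 4)" using cup_in_Hom[OF h, of 1 1] by simp
  have m4: "app f 0 2 (cup 1 1 h) \<in> Hom C (pow 2) (pow 4)" using box_in_Hom[OF f k4, of 0 2] by simp
  have "app (rot_inv (rot f)) 0 0 h = cap 2 0 (app (rot f) 1 1 (cup 0 2 h))"
    by (rule app_rot_inv[OF r h]) simp_all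
  also have "app (rot f) 1 1 (cup 0 2 h) = cap 1 3 (app f 2 2 (cup 3 1 (cup 0 2 h)))"
    by (rule app_rot[OF f h4]) simp_all
  also have "cup 3 1 (cup 0 2 h) = cup 0 4 (cup 1 1 h)"
    by (rule app_exchange[OF u_pow u_pow h, where k=1, symmetric]) simp_all
  also have "app f 2 2 (cup 0 4 (cup 1 1 h)) = cup 0 4 (app f 0 2 (cup 1 1 h))"
    by (rule app_exchange[OF u_pow f k4, where k=0, symmetric]) simp_all
  also have "cap 1 3 (cup 0 4 (app f 0 2 (cup 1 1 h))) = app f 0 2 (cup 1 1 h)"
    by (rule cap_cup_right[OF m4]) simp_all
  also have "cap 2 0 (app f 0 2 (cup 1 1 h)) = app f 0 0 (cap 2 0 (cup 1 1 h))"
    by (rule app_exchange[OF f v_pow k4, where k=0, symmetric]) simp_all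
  also have "cap 2 0 (cup 1 1 h) = h"
    by (rule cap_cup_right[OF h]) simp_all
  finally show ?thesis
    unfolding h_def using app_idn_arg[OF f] app_idn_arg[OF rot_inv_in_Hom[OF r]] by simp
qed

text \<open>The two planar diagrams without a box are exchanged by a quarter turn. For this reason
  only the coefficient of \<open>p\<close> survives when a rotation is undone.\<close>

lemma rot_inv_idn: "rot_inv (idn C (pow 2)) = u \<cdot> v"
proof -
  define h where "h = idn C (pow 2)"
  have h: "h \<in> Hom C (pow 2) (pow 2)" unfolding h_def by (rule idn_in_Hom)
  note i = idn_in_Hom[of "pow 2"]
  have h4: "cup 0 2 h \<in> Hom C (pow 2) (pow 4)" using cup_in_Hom[OF h, of 0 2] by simp
  have "app (rot_inv (idn C (pow 2))) 0 0 h = cap 2 0 (app (idn C (pow 2)) 1 1 (cup 0 2 h))"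
    by (rule app_rot_inv[OF i h]) simp_all
  also have "app (idn C (pow 2)) 1 1 (cup 0 2 h) = cup 0 2 h"
    by (rule app_idn[OF h4]) simp
  also have "cap 2 0 (cup 0 2 h) = cup 0 0 (cap 0 0 h)"
    by (rule app_exchange[OF u_pow v_pow h, where k=0, symmetric]) simp_all
  finally show ?thesis
    unfolding h_def using app_idn_arg[OF v_pow] app_00[OF u_pow] app_idn_arg[OF rot_inv_in_Hom[OF i]]
    by simp
qed

lemma rot_inv_uv: "rot_inv (u \<cdot> v) = idn C (pow 2)"
proof -
  define h where "h = idn C (pow 2)"
  have h: "h \<in> Hom C (pow 2) (pow 2)" unfolding h_def by (rule idn_in_Hom)
  have i: "u \<cdot> v \<in> Hom C (pow 2) (pow 2)" using u_pow v_pow comp_in_Hom by blast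
  have h4: "cup 0 2 h \<in> Hom C (pow 2) (pow 4)" using cup_in_Hom[OF h, of 0 2] by simp
  have "app (rot_inv (u \<cdot> v)) 0 0 h = cap 2 0 (app (u \<cdot> v) 1 1 (cup 0 2 h))"
    by (rule app_rot_inv[OF i h]) simp_all
  also have "app (u \<cdot> v) 1 1 (cup 0 2 h) = cup 1 1 (cap 1 1 (cup 0 2 h))"
    using app_comp[OF v_pow u_pow h4, of 1 1] by simp
  also have "cap 1 1 (cup 0 2 h) = h"
    by (rule cap_cup_right[OF h]) simp_all
  also have "cap 2 0 (cup 1 1 h) = h"
    by (rule cap_cup_right[OF h]) simp_all
  finally show ?thesis
    unfolding h_def using app_idn_arg[OF rot_inv_in_Hom[OF i]] by simp
qed

lemma rot_inv_add:
  assumes "f \<in> Hom C (pow 2) (pow 2)" "g \<in> Hom C (pow 2) (pow 2)"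
  shows "rot_inv (f + g) = rot_inv f + rot_inv g"
proof -
  define h where "h = idn C (pow 2)"
  have h: "h \<in> Hom C (pow 2) (pow 2)" unfolding h_def by (rule idn_in_Hom)
  have h4: "cup 0 2 h \<in> Hom C (pow 2) (pow 4)" using cup_in_Hom[OF h, of 0 2] by simp
  note fg = add_in_Hom[OF assms]
  have F: "app x 1 1 (cup 0 2 h) \<in> Hom C (pow 2) (pow 4)" if "x \<in> Hom C (pow 2) (pow 2)" for x
    using box_in_Hom[OF that h4] by simp
  have r: "app (rot_inv x) 0 0 h = cap 2 0 (app x 1 1 (cup 0 2 h))" if "x \<in> Hom C (pow 2) (pow 2)" for x
    by (rule app_rot_inv[OF that h]) simp_all
  have "app (rot_inv (f + g)) 0 0 h = app (rot_inv f) 0 0 h + app (rot_inv g) 0 0 h"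
    using r[OF fg] r[OF assms(1)] r[OF assms(2)]
      app_add[OF assms h4, of 1 1] app_arg_add[OF v_pow F F, of f g 2 0] assms by simp
  then show ?thesis unfolding h_def using rot_inv_in_Hom[THEN app_idn_arg] fg assms by simp
qed

lemma rot_inv_smult:
  assumes "f \<in> Hom C (pow 2) (pow 2)"
  shows "rot_inv (z \<odot> f) = z \<odot> rot_inv f"
proof -
  define h where "h = idn C (pow 2)"
  have h: "h \<in> Hom C (pow 2) (pow 2)" unfolding h_def by (rule idn_in_Hom)
  have h4: "cup 0 2 h \<in> Hom C (pow 2) (pow 4)" using cup_in_Hom[OF h, of 0 2] by simp
  note zf = smult_in_Hom[OF assms, of z]
  have F: "app f 1 1 (cup 0 2 h) \<in> Hom C (pow 2) (pow 4)"
    using box_in_Hom[OF assms h4] by simp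
  have r: "app (rot_inv x) 0 0 h = cap 2 0 (app x 1 1 (cup 0 2 h))" if "x \<in> Hom C (pow 2) (pow 2)" for x
    by (rule app_rot_inv[OF that h]) simp_all
  have "app (rot_inv (z \<odot> f)) 0 0 h = z \<odot> app (rot_inv f) 0 0 h"
    using r[OF zf] r[OF assms(1)]
      app_smult[OF assms h4, of 1 1 z] app_arg_smult[OF v_pow F, of 2 0] by simp
  then show ?thesis unfolding h_def using rot_inv_in_Hom[THEN app_idn_arg] zf assms by simp
qed

text \<open>On the left a strand runs from the left output of \<open>g\<close> to the right input of
  \<open>f\<close>. After the turns the same strand joins the right output of \<open>rot f\<close>
  to the left input of \<open>rot g\<close>, so the order of the boxes is reversed.\<close>

lemma rot_rot:
  assumes f: "f \<in> Hom C (pow 2) (pow 2)" and g: "g \<in> Hom C (pow 2) (pow 2)"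
    and h: "h \<in> Hom C y (pow 3)"
  shows "cap 0 3 (app f 1 2 (app g 2 1 (cup 3 0 h))) = app (rot g) 1 0 (app (rot f) 0 1 h)"
proof -
  define w where "w = cup 3 0 h"
  define c where "c = cup 2 1 h"
  define m where "m = app g 2 1 w"
  have w: "w \<in> Hom C y (pow 5)" unfolding w_def using cup_in_Hom[OF h, of 3 0] by simp
  have c: "c \<in> Hom C y (pow 5)" unfolding c_def using cup_in_Hom[OF h, of 2 1] by simp
  have m: "m \<in> Hom C y (pow 5)" unfolding m_def using box_in_Hom[OF g w, of 2 1] by simp
  have fc: "app f 1 2 c \<in> Hom C y (pow 5)" using box_in_Hom[OF f c, of 1 2] by simp
  have rf: "app (rot f) 0 1 h \<in> Hom C y (pow 3)" using box_in_Hom[OF rot_in_Hom[OF f] h, of 0 1] by simp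
  have c7: "cup 5 0 c \<in> Hom C y (pow 7)" using cup_in_Hom[OF c, of 5 0] by simp
  have fc7: "app f 1 4 (cup 5 0 c) \<in> Hom C y (pow 7)" using box_in_Hom[OF f c7, of 1 4] by simp
  have m7: "cup 2 3 m \<in> Hom C y (pow 7)" using cup_in_Hom[OF m, of 2 3] by simp
  have fm7: "app f 1 4 (cup 2 3 m) \<in> Hom C y (pow 7)" using box_in_Hom[OF f m7, of 1 4] by simp
  have e: "app (rot f) 0 1 h = cap 0 3 (app f 1 2 c)"
    unfolding c_def by (rule app_rot[OF f h]) simp_all
  have "app (rot g) 1 0 (app (rot f) 0 1 h) = cap 1 2 (app g 2 1 (cup 3 0 (cap 0 3 (app f 1 2 c))))"
    unfolding e[symmetric] by (rule app_rot[OF g rf]) simp_all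
  also have "cup 3 0 (cap 0 3 (app f 1 2 c)) = cap 0 5 (cup 5 0 (app f 1 2 c))"
    by (rule app_exchange[OF v_pow u_pow fc, where k=3, symmetric]) simp_all
  also have "cup 5 0 (app f 1 2 c) = app f 1 4 (cup 5 0 c)"
    by (rule app_exchange[OF f u_pow c, where k=2, symmetric]) simp_all
  also have "app g 2 1 (cap 0 5 (app f 1 4 (cup 5 0 c))) = cap 0 5 (app g 4 1 (app f 1 4 (cup 5 0 c)))"
    by (rule app_exchange[OF v_pow g fc7, where k=2, symmetric]) simp_all
  also have "app g 4 1 (app f 1 4 (cup 5 0 c)) = app f 1 4 (app g 4 1 (cup 5 0 c))"
    by (rule app_exchange[OF f g c7, where k=1, symmetric]) simp_all
  \<comment> \<open>The two cups may be created in either order. The cup at 2 and the cap at 3 then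
    form the zigzag by which the expanded right side exceeds the left side.\<close>
  also have "cup 5 0 c = cup 2 3 w"
    unfolding c_def w_def
    by (rule app_exchange[OF u_pow u_pow h, where k=1, symmetric]) simp_all
  also have "app g 4 1 (cup 2 3 w) = cup 2 3 m"
    unfolding m_def
    by (rule app_exchange[OF u_pow g w, where k=0, symmetric]) simp_all
  also have "cap 1 2 (cap 0 5 (app f 1 4 (cup 2 3 m))) = cap 0 3 (cap 3 2 (app f 1 4 (cup 2 3 m)))"
    by (rule app_exchange[OF v_pow v_pow fm7, where k=1, symmetric]) simp_all
  also have "cap 3 2 (app f 1 4 (cup 2 3 m)) = app f 1 2 (cap 3 2 (cup 2 3 m))"
    by (rule app_exchange[OF f v_pow m7, where k=0, symmetric]) simp_all
  also have "cap 3 2 (cup 2 3 m) = m"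
    by (rule cap_cup_right[OF m]) simp_all
  finally show ?thesis by (simp add: m_def w_def)
qed

text \<open>The inner cap and cup of the two factors \<open>u \<cdot> v\<close> form a zigzag. What
  remains cuts the diagram into \<open>g\<close> closed up to \<open>rot g\<close>, followed by
  \<open>f\<close> closed up to \<open>rot f\<close>: the opposite order to
  \<open>rot_rot\<close>.\<close>

lemma rot_through:
  assumes f: "f \<in> Hom C (pow 2) (pow 2)" and g: "g \<in> Hom C (pow 2) (pow 2)"
    and h: "h \<in> Hom C y (pow 3)"
  shows "cap 0 3 (app f 1 2 (app (u \<cdot> v) 2 1 (app (u \<cdot> v) 1 2 (app g 2 1 (cup 3 0 h))))) =
         app (rot f) 0 1 (app (rot g) 1 0 h)"
proof -
  define m where "m = app g 2 1 (cup 3 0 h)"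
  have w: "cup 3 0 h \<in> Hom C y (pow 5)" using cup_in_Hom[OF h, of 3 0] by simp
  have m: "m \<in> Hom C y (pow 5)" unfolding m_def using box_in_Hom[OF g w, of 2 1] by simp
  have k: "cap 1 2 m \<in> Hom C y (pow 3)" using cap_in_Hom[OF m] by simp
  have k5: "cup 1 2 (cap 1 2 m) \<in> Hom C y (pow 5)" using cup_in_Hom[OF k] by simp
  have "cap 0 3 (app f 1 2 (app (u \<cdot> v) 2 1 (app (u \<cdot> v) 1 2 m))) =
      cap 0 3 (app f 1 2 (cup 2 1 (cap 2 1 (cup 1 2 (cap 1 2 m)))))"
    using app_comp[OF v_pow u_pow m, of 1 2] app_comp[OF v_pow u_pow k5, of 2 1] by simp
  also have "cap 2 1 (cup 1 2 (cap 1 2 m)) = cap 1 2 m"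
    by (rule cap_cup_right[OF k]) simp_all
  also have "cap 0 3 (app f 1 2 (cup 2 1 (cap 1 2 m))) = app (rot f) 0 1 (cap 1 2 m)"
    by (rule app_rot[OF f k, symmetric]) simp_all
  also have "cap 1 2 m = app (rot g) 1 0 h"
    unfolding m_def by (rule app_rot[OF g h, symmetric]) simp_all
  finally show ?thesis by (simp add: m_def)
qed

text \<open>With \<open>s\<close> a crossing of strands, \<open>rot_rot\<close>, \<open>rot_through\<close> and a crossing are the three ways to
  let two copies of \<open>p\<close> share a strand; naturality of the crossing relates them.\<close>

lemma rot_scalar:
  assumes p: "p \<in> Hom C (V \<otimes> V) (V \<otimes> V)" and pp: "p \<cdot> p = p" and pu: "p \<cdot> u = 0" and vp: "v \<cdot> p = 0"
    and \<epsilon>: "\<epsilon> * \<epsilon> = 1" and s: "s = idn C (V \<otimes> V) - \<epsilon> \<odot> (u \<cdot> v)"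
    and natural: "lay (tunit C) p V \<cdot> (lay V s (tunit C) \<cdot> lay (tunit C) s V) =
      (lay V s (tunit C) \<cdot> lay (tunit C) s V) \<cdot> lay V p (tunit C)"
    and h: "h \<in> Hom C y (V \<otimes> (V \<otimes> V))"
    and v1: "lay (tunit C) v V \<cdot> h = 0"
    and r1: "lay (tunit C) (rot p) V \<cdot> h = \<kappa> \<odot> h"
    and r2: "lay V (rot p) (tunit C) \<cdot> h = \<kappa> \<odot> h"
  shows "(2 * \<kappa> * \<kappa> + \<epsilon> * \<kappa>) \<odot> h = 0"
proof -
  have p: "p \<in> Hom C (pow 2) (pow 2)" using p by (simp add: pow_2)
  have h: "h \<in> Hom C y (pow 3)" using h by (simp add: pow_3)
  have v1: "cap 0 1 h = 0" using v1 by (simp add: app_def tobj_tunit)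
  have r1: "app (rot p) 0 1 h = \<kappa> \<odot> h" using r1 by (simp add: app_def tobj_tunit)
  have r2: "app (rot p) 1 0 h = \<kappa> \<odot> h" using r2 by (simp add: app_def tobj_tunit)
  define U where "U = u \<cdot> v"
  have U: "U \<in> Hom C (pow 2) (pow 2)" unfolding U_def using u_pow v_pow comp_in_Hom by blast
  have eU: "\<epsilon> \<odot> U \<in> Hom C (pow 2) (pow 2)" using smult_in_Hom[OF U] .
  have i2: "idn C (pow 2) \<in> Hom C (pow 2) (pow 2)" by (rule idn_in_Hom)
  have s_def: "s = idn C (pow 2) - \<epsilon> \<odot> U" using s by (simp add: U_def pow_2)
  have s: "s \<in> Hom C (pow 2) (pow 2)" unfolding s_def using diff_in_Hom[OF i2 eU] .
  have sk: "app s i j k = k - \<epsilon> \<odot> app u i j (app v i j k)"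
    if "k \<in> Hom C y (pow n)" "n = i + 2 + j" for i j k n
  proof -
    have "app s i j k = app (idn C (pow 2)) i j k - \<epsilon> \<odot> app U i j k"
      unfolding s_def using app_diff[OF i2 eU that] app_smult[OF U that] by simp
    also have "app (idn C (pow 2)) i j k = k" by (rule app_idn[OF that])
    also have "app U i j k = app u i j (app v i j k)"
      unfolding U_def by (rule app_comp[OF v_pow u_pow that])
    finally show ?thesis .
  qed
  have cup_box: "app p i j (cup i j k) = 0" if "k \<in> Hom C y (pow n)" "n = i + j" for i j k n
    using app_comp[OF u_pow p that(1), of i j] that pu app_zero[OF that(1)] by simp
  have box_cap: "cap i j (app p i j k) = 0" if "k \<in> Hom C y (pow n)" "n = i + 2 + j" for i j k n
    using app_comp[OF p v_pow that] vp app_zero[OF that] by simp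
  define x where "x = cup 3 0 h"
  define z where "z = app p 2 1 x"
  have x: "x \<in> Hom C y (pow 5)" unfolding x_def using cup_in_Hom[OF h] by simp
  have z: "z \<in> Hom C y (pow 5)" unfolding z_def using box_in_Hom[OF p x] by simp
  have sz: "app s 1 2 z \<in> Hom C y (pow 5)" using box_in_Hom[OF s z] by simp
  have pz: "app p 2 1 z = z"
    using app_comp[OF p p x, of 2 1] pp by (simp add: z_def)
  \<comment> \<open>Since \<open>z\<close> is fixed by \<open>p\<close> on strands 2 and 3,
    naturality shows that after both crossings it is fixed by \<open>p\<close> on strands 1 and
    2.\<close>
  have nat: "app p 1 2 (app s 2 1 (app s 1 2 z)) = app s 2 1 (app s 1 2 z)"
  proof -
    have P0: "lay (pow 0) p (pow 1) \<in> Hom C (pow 3) (pow 3)" and P1: "lay (pow 1) p (pow 0) \<in> Hom C (pow 3) (pow 3)"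
      and S0: "lay (pow 0) s (pow 1) \<in> Hom C (pow 3) (pow 3)" and S1: "lay (pow 1) s (pow 0) \<in> Hom C (pow 3) (pow 3)"
      using lay_in_Hom[OF p, of "pow 0" "pow 1"] lay_in_Hom[OF p, of "pow 1" "pow 0"]
        lay_in_Hom[OF s, of "pow 0" "pow 1"] lay_in_Hom[OF s, of "pow 1" "pow 0"]
      by (simp_all add: pow_3 pow_2 tobj_tunit tunit_tobj tobj_assoc)
    define A where "A = lay (pow 0) p (pow 1)"
    define A' where "A' = lay (pow 1) p (pow 0)"
    define B where "B = lay (pow 0) s (pow 1)"
    define B' where "B' = lay (pow 1) s (pow 0)"
    note S01 = comp_in_Hom[OF S0 S1, folded B_def B'_def]
    note A = P0[folded A_def] and A' = P1[folded A'_def] and B = S0[folded B_def] and B' = S1[folded B'_def]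
    have n5: "5 = 1 + 3 + (1::nat)" by simp
    have A'z: "app A' 1 1 z \<in> Hom C y (pow 5)" by (rule app_in_Hom[OF A' z n5 n5])
    have "A \<cdot> (B' \<cdot> B) = (B' \<cdot> B) \<cdot> A'"
      using natural by (simp add: tobj_tunit A_def A'_def B_def B'_def)
    then have "app (A \<cdot> (B' \<cdot> B)) 1 1 z = app ((B' \<cdot> B) \<cdot> A') 1 1 z" by (rule arg_cong)
    then have "app A 1 1 (app B' 1 1 (app B 1 1 z)) = app B' 1 1 (app B 1 1 (app A' 1 1 z))"
      unfolding app_comp[OF S01 A z n5] app_comp[OF A' S01 z n5] app_comp[OF B B' z n5]
        app_comp[OF B B' A'z n5] .
    moreover have "1 + 1 = (2::nat)" "0 + 1 = (1::nat)" "1 + 0 = (1::nat)" by simp_all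
    ultimately have "app p 1 2 (app s 2 1 (app s 1 2 z)) = app s 2 1 (app s 1 2 (app p 2 1 z))"
      by (simp only: A_def A'_def B_def B'_def app_lay[OF p] app_lay[OF s])
    then show ?thesis unfolding pz .
  qed
  have U1: "app U 1 2 z = cup 1 2 (cap 1 2 z)" unfolding U_def by (rule app_comp[OF v_pow u_pow z]) simp
  have U1z: "app U 1 2 z \<in> Hom C y (pow 5)" using box_in_Hom[OF U z] by simp
  have U2: "app U 2 1 (app U 1 2 z) = cup 2 1 (cap 2 1 (app U 1 2 z))"
    unfolding U_def[symmetric] by (subst (1) U_def, rule app_comp[OF v_pow u_pow U1z]) simp
  have U2z: "app U 2 1 (app U 1 2 z) \<in> Hom C y (pow 5)" using box_in_Hom[OF U U1z] by simp
  have cz: "cap 1 2 z \<in> Hom C y (pow 3)" using cap_in_Hom[OF z] by simp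
  have c2z: "cap 2 1 z = 0" unfolding z_def by (rule box_cap[OF x]) simp
  have s1: "app s 1 2 z = z - \<epsilon> \<odot> app U 1 2 z" unfolding U1 by (rule sk[OF z]) simp
  have e1: "\<epsilon> \<odot> app U 1 2 z \<in> Hom C y (pow 5)" using smult_in_Hom[OF U1z] .
  \<comment> \<open>Both crossings are resolved. Of the four terms, the one that contracts strands 2
    and 3 of \<open>z\<close> at once vanishes because \<open>v \<cdot> p = 0\<close>.\<close>
  have "app s 2 1 (app s 1 2 z) = app s 2 1 z - \<epsilon> \<odot> app s 2 1 (app U 1 2 z)"
    unfolding s1 using app_arg_diff[OF s z e1, of 2 1] app_arg_smult[OF s U1z, of 2 1] by simp
  also have "app s 2 1 z = z" using sk[OF z, of 2 1] c2z app_arg_zero[OF u_pow] by simp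
  also have "app s 2 1 (app U 1 2 z) = app U 1 2 z - \<epsilon> \<odot> app U 2 1 (app U 1 2 z)"
    unfolding U2 by (rule sk[OF U1z]) simp
  finally have ss: "app s 2 1 (app s 1 2 z) = z - \<epsilon> \<odot> app U 1 2 z + app U 2 1 (app U 1 2 z)"
    using \<epsilon> by (simp add: scale_right_diff_distrib)
  \<comment> \<open>Inserting the \<open>p\<close> gained from naturality kills the term with a cup
    just below it, by \<open>p \<cdot> u = 0\<close>. The other two are the diagrams of
    \<open>rot_rot\<close> and \<open>rot_through\<close>, and each contributes
    \<kappa>\<kappa>.\<close>
  have "app s 2 1 (app s 1 2 z) = app p 1 2 (z - \<epsilon> \<odot> app U 1 2 z + app U 2 1 (app U 1 2 z))"
    using nat ss by simp
  also have "\<dots> = app p 1 2 z - \<epsilon> \<odot> app p 1 2 (app U 1 2 z) + app p 1 2 (app U 2 1 (app U 1 2 z))"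
    using app_arg_add[OF p diff_in_Hom[OF z e1] U2z, of 1 2] app_arg_diff[OF p z e1, of 1 2]
      app_arg_smult[OF p U1z, of 1 2] by simp
  also have "app p 1 2 (app U 1 2 z) = 0"
    unfolding U1 by (rule cup_box[OF cz]) simp
  finally have main: "app s 2 1 (app s 1 2 z) = app p 1 2 z + app p 1 2 (app U 2 1 (app U 1 2 z))" by simp
  have pz5: "app p 1 2 z \<in> Hom C y (pow 5)" and puz: "app p 1 2 (app U 2 1 (app U 1 2 z)) \<in> Hom C y (pow 5)"
    using box_in_Hom[OF p z] box_in_Hom[OF p U2z] by simp_all
  have "cap 0 3 (app s 2 1 (app s 1 2 z)) = cap 0 3 (app p 1 2 z) + cap 0 3 (app p 1 2 (app U 2 1 (app U 1 2 z)))"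
    unfolding main by (rule app_arg_add[OF v_pow pz5 puz]) simp
  also have "cap 0 3 (app p 1 2 z) = (\<kappa> * \<kappa>) \<odot> h"
    using rot_rot[OF p p h] r1 r2 app_arg_smult[OF rot_in_Hom[OF p] h, of 1 0 \<kappa>] by (simp add: z_def x_def)
  also have "cap 0 3 (app p 1 2 (app U 2 1 (app U 1 2 z))) = (\<kappa> * \<kappa>) \<odot> h"
    using rot_through[OF p p h] r1 r2 app_arg_smult[OF rot_in_Hom[OF p] h, of 0 1 \<kappa>]
    by (simp add: z_def x_def U_def)
  finally have lhs: "cap 0 3 (app s 2 1 (app s 1 2 z)) = (2 * \<kappa> * \<kappa>) \<odot> h"
    by (simp add: scale_left_distrib[symmetric])
  \<comment> \<open>The second evaluation of the same diagram: the cap on the left slides past the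
    upper crossing, which becomes a crossing of the first two strands and fixes \<open>h\<close>.
    Only the lower crossing has to be resolved.\<close>
  have sh: "app s 0 1 h = h" using sk[OF h, of 0 1] v1 app_arg_zero[OF u_pow] by simp
  have "app s 0 3 z = app p 2 1 (app s 0 3 x)"
    unfolding z_def by (rule app_exchange[OF s p x, where k=0]) simp_all
  also have "app s 0 3 x = cup 3 0 (app s 0 1 h)"
    unfolding x_def by (rule app_exchange[OF s u_pow h, where k=1]) simp_all
  finally have s0: "app s 0 3 z = z" unfolding sh by (simp add: z_def x_def)
  have cc: "cap 1 2 z = \<kappa> \<odot> h"
  proof -
    have "app (rot p) 1 0 h = cap 1 2 z"
      unfolding z_def x_def by (rule app_rot[OF p h]) simp_all
    then show ?thesis using r2 by simp
  qed
  have c0: "cap 0 3 z \<in> Hom C y (pow 3)" using cap_in_Hom[OF z] by simp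
  \<comment> \<open>A morphism fixed by \<open>s\<close> has zero contraction: first its cup-cap
    composite vanishes, and the cup is then undone by a zigzag.\<close>
  have "z - \<epsilon> \<odot> cup 0 3 (cap 0 3 z) = z" using sk[OF z, of 0 3] s0 by simp
  then have "\<epsilon> \<odot> cup 0 3 (cap 0 3 z) = 0" by simp
  then have "cup 0 3 (cap 0 3 z) = 0" using \<epsilon> by (metis scale_eq_0_iff mult_zero_left zero_neq_one)
  moreover have "cap 1 2 (cup 0 3 (cap 0 3 z)) = cap 0 3 z"
    by (rule cap_cup_right[OF c0]) simp_all
  ultimately have c0z: "cap 0 3 z = 0" using app_arg_zero[OF v_pow] by simp
  have "cap 0 3 (app s 1 2 z) = cap 0 3 z - \<epsilon> \<odot> cap 0 3 (cup 1 2 (cap 1 2 z))"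
    unfolding s1 using app_arg_diff[OF v_pow z e1, of 0 3] app_arg_smult[OF v_pow U1z, of 0 3] U1 by simp
  also have "cap 0 3 (cup 1 2 (cap 1 2 z)) = cap 1 2 z"
    by (rule cap_cup_left[OF cz]) simp_all
  finally have c1: "cap 0 3 (app s 1 2 z) = (- (\<epsilon> * \<kappa>)) \<odot> h"
    using c0z cc by (simp add: scale_minus_left)
  have "cap 0 3 (app s 2 1 (app s 1 2 z)) = app s 0 1 (cap 0 3 (app s 1 2 z))"
    by (rule app_exchange[OF v_pow s sz, where k=0]) simp_all
  also have "\<dots> = (- (\<epsilon> * \<kappa>)) \<odot> h"
    unfolding c1 using app_arg_smult[OF s h, of 0 1 "- (\<epsilon> * \<kappa>)"] sh by (simp del: scale_minus_left)
  finally have "(2 * \<kappa> * \<kappa>) \<odot> h = (- (\<epsilon> * \<kappa>)) \<odot> h" using lhs by simp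
  then show ?thesis by (simp add: scale_left_distrib scale_minus_left)
qed

end

text \<open>Reversing the tensor product mirrors every string diagram from left to right. It
  exchanges the two zigzag identities and turns \<open>rot\<close> into \<open>rot_inv\<close>, so
  calculations with one quarter turn carry over to the other.\<close>

definition reverse_tensor :: "('o, 'm) tensor_cat \<Rightarrow> ('o, 'm) tensor_cat" where
  "reverse_tensor C = C\<lparr>tobj := \<lambda>a b. tobj C b a, tmor := \<lambda>f g. tmor C g f\<rparr>"

lemma reverse_tensor_simps [simp]:
  "Hom (reverse_tensor C) = Hom C" "idn (reverse_tensor C) = idn C" "comp (reverse_tensor C) = comp C"
  "smult (reverse_tensor C) = smult C" "tunit (reverse_tensor C) = tunit C"
  "tobj (reverse_tensor C) a b = tobj C b a" "tmor (reverse_tensor C) f g = tmor C g f"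
  by (simp_all add: reverse_tensor_def)

lemma (in self_dual_object) reverse: "self_dual_object (reverse_tensor C) V u v"
proof -
  interpret r: linear_category "reverse_tensor C"
    using linear_category_axioms unfolding linear_category_def linear_category_axioms_def by simp
  show ?thesis
    by unfold_locales
      (simp_all add: tobj_assoc tunit_tobj tobj_tunit tmor_idn u v zigzag_left zigzag_right,
       (rule tmor_in_Hom tmor_comp tmor_assoc[symmetric] tmor_tunit tunit_tmor tmor_add_right
         tmor_add_left tmor_smult_right tmor_smult_left; assumption)+)
qed

context self_dual_object
begin

text \<open>The mirror image of \<open>rot_scalar\<close>: the order of the two crossings in the
  naturality hypothesis is reversed, and the contraction of \<open>h\<close> moves from the left
  pair of strands to the right pair.\<close>

lemma rot_inv_scalar:
  assumes p: "p \<in> Hom C (V \<otimes> V) (V \<otimes> V)" and pp: "p \<cdot> p = p" and pu: "p \<cdot> u = 0" and vp: "v \<cdot> p = 0"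
    and \<epsilon>: "\<epsilon> * \<epsilon> = 1" and s: "s = idn C (V \<otimes> V) - \<epsilon> \<odot> (u \<cdot> v)"
    and natural: "lay V p (tunit C) \<cdot> (lay (tunit C) s V \<cdot> lay V s (tunit C)) =
      (lay (tunit C) s V \<cdot> lay V s (tunit C)) \<cdot> lay (tunit C) p V"
    and h: "h \<in> Hom C y (V \<otimes> (V \<otimes> V))"
    and v1: "lay V v (tunit C) \<cdot> h = 0"
    and r1: "lay (tunit C) (rot_inv p) V \<cdot> h = \<kappa> \<odot> h"
    and r2: "lay V (rot_inv p) (tunit C) \<cdot> h = \<kappa> \<odot> h"
  shows "(2 * \<kappa> * \<kappa> + \<epsilon> * \<kappa>) \<odot> h = 0"
proof -
  interpret r: self_dual_object "reverse_tensor C" V u v by (rule reverse)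
  have lay: "r.lay a f b = lay b f a" if "f \<in> Hom C x z" for a b f x z
    using tmor_assoc[OF idn_in_Hom that idn_in_Hom] by (simp add: r.lay_def lay_def)
  have U: "u \<cdot> v \<in> Hom C (V \<otimes> V) (V \<otimes> V)" using comp_in_Hom[OF v u] .
  have sH: "s \<in> Hom C (V \<otimes> V) (V \<otimes> V)"
    unfolding s by (rule diff_in_Hom[OF idn_in_Hom smult_in_Hom[OF U]])
  have rot: "r.rot p = rot_inv p"
    by (simp add: r.rot_def rot_inv_def lay[OF u] lay[OF v] lay[OF p])
  have rH: "rot_inv p \<in> Hom C (V \<otimes> V) (V \<otimes> V)" using rot_inv_in_Hom p by (simp add: pow_2)
  show ?thesis
    using r.rot_scalar[of p \<epsilon> s h y \<kappa>] assms
    by (simp add: rot lay[OF u] lay[OF v] lay[OF p] lay[OF sH[unfolded s]] lay[OF rH] tobj_assoc)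
qed

text \<open>On a morphism killed by all contractions both rotations of \<open>p\<close> act by scalars in
  \<open>{0, - \<epsilon> / 2}\<close>, which forces their \<open>p\<close>-coefficients to be at most \<open>1 / 2\<close> in modulus. Since the
  rotations are mutually inverse and interchange \<open>1\<close> and \<open>u \<cdot> v\<close>, these coefficients are mutually
  inverse.\<close>

lemma no_two_types:
  assumes p: "p \<in> Hom C (V \<otimes> V) (V \<otimes> V)" and pp: "p \<cdot> p = p" and pu: "p \<cdot> u = 0" and vp: "v \<cdot> p = 0"
    and \<epsilon>: "\<epsilon> * \<epsilon> = 1" and s: "s = idn C (V \<otimes> V) - \<epsilon> \<odot> (u \<cdot> v)"
    and natural: "lay (tunit C) p V \<cdot> (lay V s (tunit C) \<cdot> lay (tunit C) s V) =
      (lay V s (tunit C) \<cdot> lay (tunit C) s V) \<cdot> lay V p (tunit C)"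
    and natural': "lay V p (tunit C) \<cdot> (lay (tunit C) s V \<cdot> lay V s (tunit C)) =
      (lay (tunit C) s V \<cdot> lay V s (tunit C)) \<cdot> lay (tunit C) p V"
    and span: "\<And>f. f \<in> Hom C (V \<otimes> V) (V \<otimes> V) \<Longrightarrow>
      \<exists>a b c. f = a \<odot> idn C (V \<otimes> V) + b \<odot> (u \<cdot> v) + c \<odot> p"
    and indep: "\<And>a b c. a \<odot> idn C (V \<otimes> V) + b \<odot> (u \<cdot> v) + c \<odot> p = 0 \<Longrightarrow> c = 0"
    and h: "h \<in> Hom C y (V \<otimes> (V \<otimes> V))" "h \<noteq> 0" "lay (tunit C) v V \<cdot> h = 0" "lay V v (tunit C) \<cdot> h = 0"
      "lay (tunit C) p V \<cdot> h = h" "lay V p (tunit C) \<cdot> h = h"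
    and k: "k \<in> Hom C y' (V \<otimes> (V \<otimes> V))" "k \<noteq> 0" "lay (tunit C) v V \<cdot> k = 0" "lay V v (tunit C) \<cdot> k = 0"
      "lay (tunit C) p V \<cdot> k = 0" "lay V p (tunit C) \<cdot> k = 0"
  shows False
proof -
  have p2: "p \<in> Hom C (pow 2) (pow 2)" using p by (simp add: pow_2)
  have U: "u \<cdot> v \<in> Hom C (V \<otimes> V) (V \<otimes> V)" using comp_in_Hom[OF v u] .
  have act: "lay a (x \<odot> idn C (V \<otimes> V) + y \<odot> (u \<cdot> v) + z \<odot> p) b \<cdot> g = x \<odot> g + z \<odot> (lay a p b \<cdot> g)"
    if g: "g \<in> Hom C d (a \<otimes> (V \<otimes> (V \<otimes> b)))" "lay a v b \<cdot> g = 0" for a b x y z g d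
  proof -
    note i = idn_in_Hom[of "V \<otimes> V"]
    note l = lay_in_Hom[of _ "V \<otimes> V" "V \<otimes> V" a b]
    have g': "g \<in> Hom C d (a \<otimes> (V \<otimes> V \<otimes> b))" using g(1) by (simp add: tobj_assoc)
    have "lay a (x \<odot> idn C (V \<otimes> V) + y \<odot> (u \<cdot> v) + z \<odot> p) b =
      x \<odot> lay a (idn C (V \<otimes> V)) b + y \<odot> lay a (u \<cdot> v) b + z \<odot> lay a p b"
      using lay_add[OF add_in_Hom[OF smult_in_Hom[OF i] smult_in_Hom[OF U]] smult_in_Hom[OF p]]
        lay_add[OF smult_in_Hom[OF i] smult_in_Hom[OF U]] lay_smult[OF i] lay_smult[OF U] lay_smult[OF p]
      by simp
    then have "lay a (x \<odot> idn C (V \<otimes> V) + y \<odot> (u \<cdot> v) + z \<odot> p) b \<cdot> g =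
      x \<odot> (lay a (idn C (V \<otimes> V)) b \<cdot> g) + y \<odot> (lay a (u \<cdot> v) b \<cdot> g) + z \<odot> (lay a p b \<cdot> g)"
      using comp_add_left[OF g' add_in_Hom[OF smult_in_Hom[OF l[OF i]] smult_in_Hom[OF l[OF U]]]
          smult_in_Hom[OF l[OF p]]] comp_add_left[OF g' smult_in_Hom[OF l[OF i]] smult_in_Hom[OF l[OF U]]]
        comp_smult_left[OF g' l[OF i]] comp_smult_left[OF g' l[OF U]] comp_smult_left[OF g' l[OF p]]
      by simp
    moreover have "lay a (idn C (V \<otimes> V)) b \<cdot> g = g" using idn_comp[OF g'] by (simp add: lay_idn)
    moreover have "lay a (u \<cdot> v) b \<cdot> g = 0"
      unfolding lay_comp[OF v u] comp_assoc[OF g' lay_in_Hom[OF v] lay_in_Hom[OF u]] g(2)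
      by (rule comp_zero_right[OF lay_in_Hom[OF u]])
    ultimately show ?thesis by simp
  qed
  have h': "h \<in> Hom C y (tunit C \<otimes> (V \<otimes> (V \<otimes> V)))" "h \<in> Hom C y (V \<otimes> (V \<otimes> (V \<otimes> tunit C)))"
    and k': "k \<in> Hom C y' (tunit C \<otimes> (V \<otimes> (V \<otimes> V)))" "k \<in> Hom C y' (V \<otimes> (V \<otimes> (V \<otimes> tunit C)))"
    using h(1) k(1) by (simp_all add: tunit_tobj tobj_tunit)
  have fin: "c = 0 \<or> 4 * (c * c) = 1" if "2 * a * a + \<epsilon> * a = 0" "2 * (a + c) * (a + c) + \<epsilon> * (a + c) = 0" for a c
  proof -
    have "a = 0 \<or> 2 * a = - \<epsilon>" using that(1) by (metis add_eq_0_iff2 distrib_right mult_eq_0_iff)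
    moreover have "a + c = 0 \<or> 2 * (a + c) = - \<epsilon>"
      using that(2) by (metis add_eq_0_iff2 distrib_right mult_eq_0_iff)
    moreover have "4 * (c * c) = 1" if "2 * c = \<epsilon> \<or> 2 * c = - \<epsilon>"
    proof -
      have "4 * (c * c) = (2 * c) * (2 * c)" by simp
      also have "\<dots> = \<epsilon> * \<epsilon>" using that by (elim disjE) (simp_all only: minus_mult_minus)
      finally show ?thesis using \<epsilon> by simp
    qed
    ultimately show ?thesis by (auto simp: algebra_simps add_eq_0_iff)
  qed
  obtain a b c where abc: "rot p = a \<odot> idn C (V \<otimes> V) + b \<odot> (u \<cdot> v) + c \<odot> p"
    using span[of "rot p"] rot_in_Hom[OF p2] by (auto simp: pow_2)
  obtain a' b' c' where abc': "rot_inv p = a' \<odot> idn C (V \<otimes> V) + b' \<odot> (u \<cdot> v) + c' \<odot> p"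
    using span[of "rot_inv p"] rot_inv_in_Hom[OF p2] by (auto simp: pow_2)
  \<comment> \<open>On \<open>h\<close>, where \<open>p\<close> acts by 1, the rotation acts by
    \<open>a + c\<close>; on \<open>k\<close>, where \<open>p\<close> acts by 0, it acts by
    \<open>a\<close>. Both scalars are thus roots of the same quadratic equation.\<close>
  have "lay (tunit C) (rot p) V \<cdot> h = (a + c) \<odot> h" "lay V (rot p) (tunit C) \<cdot> h = (a + c) \<odot> h"
    "lay (tunit C) (rot p) V \<cdot> k = a \<odot> k" "lay V (rot p) (tunit C) \<cdot> k = a \<odot> k"
    unfolding abc using act[OF h'(1) h(3)] act[OF h'(2) h(4)] act[OF k'(1) k(3)] act[OF k'(2) k(4)] h(5,6) k(5,6)
    by (simp_all add: scale_left_distrib)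
  then have "(2 * (a + c) * (a + c) + \<epsilon> * (a + c)) \<odot> h = 0" "(2 * a * a + \<epsilon> * a) \<odot> k = 0"
    using rot_scalar[OF p pp pu vp \<epsilon> s natural h(1,3)] rot_scalar[OF p pp pu vp \<epsilon> s natural k(1,3)] by blast+
  then have c: "c = 0 \<or> 4 * (c * c) = 1" using fin h(2) k(2) by (metis scale_eq_0_iff)
  have "lay (tunit C) (rot_inv p) V \<cdot> h = (a' + c') \<odot> h" "lay V (rot_inv p) (tunit C) \<cdot> h = (a' + c') \<odot> h"
    "lay (tunit C) (rot_inv p) V \<cdot> k = a' \<odot> k" "lay V (rot_inv p) (tunit C) \<cdot> k = a' \<odot> k"
    unfolding abc' using act[OF h'(1) h(3)] act[OF h'(2) h(4)] act[OF k'(1) k(3)] act[OF k'(2) k(4)] h(5,6) k(5,6)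
    by (simp_all add: scale_left_distrib)
  then have "(2 * (a' + c') * (a' + c') + \<epsilon> * (a' + c')) \<odot> h = 0" "(2 * a' * a' + \<epsilon> * a') \<odot> k = 0"
    using rot_inv_scalar[OF p pp pu vp \<epsilon> s natural' h(1,4)]
      rot_inv_scalar[OF p pp pu vp \<epsilon> s natural' k(1,4)] by blast+
  then have c': "c' = 0 \<or> 4 * (c' * c') = 1" using fin h(2) k(2) by (metis scale_eq_0_iff)
  have i2: "idn C (pow 2) \<in> Hom C (pow 2) (pow 2)" and U2: "u \<cdot> v \<in> Hom C (pow 2) (pow 2)"
    using idn_in_Hom U by (simp_all add: pow_2)
  \<comment> \<open>Rotating back sends 1 and \<open>u \<cdot> v\<close> to each other, so the
    coefficient of \<open>p\<close> on the right is \<open>c * c'\<close>, and independence makes it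
    1.\<close>
  have "p = rot_inv (a \<odot> idn C (pow 2) + b \<odot> (u \<cdot> v) + c \<odot> p)"
    using rot_inv_rot[OF p2] abc by (simp add: pow_2)
  also have "\<dots> = a \<odot> (u \<cdot> v) + b \<odot> idn C (pow 2) + c \<odot> rot_inv p"
    using rot_inv_add[OF add_in_Hom[OF smult_in_Hom[OF i2] smult_in_Hom[OF U2]] smult_in_Hom[OF p2]]
      rot_inv_add[OF smult_in_Hom[OF i2] smult_in_Hom[OF U2]]
      rot_inv_smult[OF i2] rot_inv_smult[OF U2] rot_inv_smult[OF p2] rot_inv_idn rot_inv_uv by simp
  finally have "(b + c * a') \<odot> idn C (V \<otimes> V) + (a + c * b') \<odot> (u \<cdot> v) + (c * c' - 1) \<odot> p = 0"
    unfolding abc' by (simp add: pow_2 scale_left_distrib scale_right_distrib scale_left_diff_distrib algebra_simps)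
  then have cc: "c * c' = 1" using indep by fastforce
  then have "4 * (c * c) = 1" "4 * (c' * c') = 1" using c c' by auto
  then have "(4 * (c * c)) * (4 * (c' * c')) = 1" by simp
  then have "16 * ((c * c') * (c * c')) = (1::complex)" by (simp only: ac_simps) simp
  then show False using cc by simp
qed

end

section \<open>Braiding and duality\<close>

context braided_tensor_category
begin

lemma braid_in_Hom: "braid C a b \<in> Hom C (a \<otimes> b) (b \<otimes> a)"
  using braid_iso unfolding iso_mor_def by blast

lemma iso_idempotent:
  assumes "iso_mor C a a f" "f \<cdot> f = f"
  shows "f = idn C a"
proof -
  obtain g where f: "f \<in> Hom C a a" and g: "g \<in> Hom C a a" "g \<cdot> f = idn C a"
    using assms(1) unfolding iso_mor_def by blast
  then have "g \<cdot> (f \<cdot> f) = f" using comp_assoc[OF f f g(1)] idn_comp[OF f] by simp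
  then show ?thesis using assms(2) g(2) by simp
qed

text \<open>The hexagon with two unit objects only says that this braiding is idempotent; being
  invertible, it is the identity.\<close>

lemma braid_tunit_right: "braid C a (tunit C) = idn C a"
proof (rule iso_idempotent)
  let ?c = "braid C a (tunit C)"
  have c: "?c \<in> Hom C a a" using braid_in_Hom[of a "tunit C"] by (simp add: tunit_tobj tobj_tunit)
  show "iso_mor C a a ?c" using braid_iso[of a "tunit C"] by (simp add: tunit_tobj tobj_tunit)
  show "?c \<cdot> ?c = ?c"
    using hexagon_right[of a "tunit C" "tunit C"] tunit_tmor[OF c] tmor_tunit[OF c] by (simp add: tunit_tobj)
qed

lemma braid_tunit_left: "braid C (tunit C) a = idn C a"
proof (rule iso_idempotent)
  let ?c = "braid C (tunit C) a"
  have c: "?c \<in> Hom C a a" using braid_in_Hom[of "tunit C" a] by (simp add: tunit_tobj tobj_tunit)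
  show "iso_mor C a a ?c" using braid_iso[of "tunit C" a] by (simp add: tunit_tobj tobj_tunit)
  show "?c \<cdot> ?c = ?c"
    using hexagon_left[of "tunit C" "tunit C" a] tunit_tmor[OF c] tmor_tunit[OF c] by (simp add: tunit_tobj)
qed

text \<open>Naturality of the braiding of \<open>a\<close> with \<open>a \<otimes> a\<close>, with
  that braiding split by the hexagon into two crossings of single strands.\<close>

lemma
  assumes f: "f \<in> Hom C (a \<otimes> a) (a \<otimes> a)"
  shows braid_slide_left: "lay a (braid C a a) (tunit C) \<cdot> (lay (tunit C) (braid C a a) a \<cdot> lay a f (tunit C)) =
      lay (tunit C) f a \<cdot> (lay a (braid C a a) (tunit C) \<cdot> lay (tunit C) (braid C a a) a)"
    and braid_slide_right: "lay (tunit C) (braid C a a) a \<cdot> (lay a (braid C a a) (tunit C) \<cdot> lay (tunit C) f a) =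
      lay a f (tunit C) \<cdot> (lay (tunit C) (braid C a a) a \<cdot> lay a (braid C a a) (tunit C))"
proof -
  let ?c = "braid C a a"
  have l: "lay a g (tunit C) \<in> Hom C (a \<otimes> (a \<otimes> a)) (a \<otimes> (a \<otimes> a))"
    "lay (tunit C) g a \<in> Hom C (a \<otimes> (a \<otimes> a)) (a \<otimes> (a \<otimes> a))" if "g \<in> Hom C (a \<otimes> a) (a \<otimes> a)" for g
    using lay_in_Hom[OF that, of a "tunit C"] lay_in_Hom[OF that, of "tunit C" a]
    by (simp_all add: tunit_tobj tobj_tunit tobj_assoc)
  note c = braid_in_Hom[of a a]
  have "braid C a (a \<otimes> a) \<cdot> (idn C a \<boxtimes> f) = (f \<boxtimes> idn C a) \<cdot> braid C a (a \<otimes> a)"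
    by (rule braid_natural[OF idn_in_Hom f])
  then show "lay a ?c (tunit C) \<cdot> (lay (tunit C) ?c a \<cdot> lay a f (tunit C)) =
      lay (tunit C) f a \<cdot> (lay a ?c (tunit C) \<cdot> lay (tunit C) ?c a)"
    unfolding hexagon_right idn_tmor[OF f] tmor_id[OF f] idn_tmor[OF c] tmor_id[OF c]
    using comp_assoc[OF l(1)[OF f] l(2)[OF c] l(1)[OF c]] by simp
  have "braid C (a \<otimes> a) a \<cdot> (f \<boxtimes> idn C a) = (idn C a \<boxtimes> f) \<cdot> braid C (a \<otimes> a) a"
    by (rule braid_natural[OF f idn_in_Hom])
  then show "lay (tunit C) ?c a \<cdot> (lay a ?c (tunit C) \<cdot> lay (tunit C) f a) =
      lay a f (tunit C) \<cdot> (lay (tunit C) ?c a \<cdot> lay a ?c (tunit C))"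
    unfolding hexagon_left idn_tmor[OF f] tmor_id[OF f] idn_tmor[OF c] tmor_id[OF c]
    using comp_assoc[OF l(2)[OF f] l(1)[OF c] l(2)[OF c]] by simp
qed

text \<open>The same for a cup in place of an endomorphism. On the side of the unit the braiding is
  the identity, so no crossing remains there.\<close>

lemma
  assumes u: "u \<in> Hom C (tunit C) (a \<otimes> a)"
  shows braid_cup_left: "lay a (braid C a a) (tunit C) \<cdot> (lay (tunit C) (braid C a a) a \<cdot> lay a u (tunit C)) =
      lay (tunit C) u a"
    and braid_cup_right: "lay (tunit C) (braid C a a) a \<cdot> (lay a (braid C a a) (tunit C) \<cdot> lay (tunit C) u a) =
      lay a u (tunit C)"
proof -
  let ?c = "braid C a a"
  have l: "lay a g (tunit C) \<in> Hom C (a \<otimes> (a \<otimes> a)) (a \<otimes> (a \<otimes> a))"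
    "lay (tunit C) g a \<in> Hom C (a \<otimes> (a \<otimes> a)) (a \<otimes> (a \<otimes> a))" if "g \<in> Hom C (a \<otimes> a) (a \<otimes> a)" for g
    using lay_in_Hom[OF that, of a "tunit C"] lay_in_Hom[OF that, of "tunit C" a]
    by (simp_all add: tunit_tobj tobj_tunit tobj_assoc)
  have w: "lay a u (tunit C) \<in> Hom C a (a \<otimes> (a \<otimes> a))" "lay (tunit C) u a \<in> Hom C a (a \<otimes> (a \<otimes> a))"
    using lay_in_Hom[OF u, of a "tunit C"] lay_in_Hom[OF u, of "tunit C" a]
    by (simp_all add: tunit_tobj tobj_tunit tobj_assoc)
  note c = braid_in_Hom[of a a]
  have "braid C a (a \<otimes> a) \<cdot> (idn C a \<boxtimes> u) = (u \<boxtimes> idn C a) \<cdot> braid C a (tunit C)"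
    by (rule braid_natural[OF idn_in_Hom u])
  then show "lay a ?c (tunit C) \<cdot> (lay (tunit C) ?c a \<cdot> lay a u (tunit C)) = lay (tunit C) u a"
    unfolding hexagon_right idn_tmor[OF u] tmor_id[OF u] idn_tmor[OF c] tmor_id[OF c] braid_tunit_right
      comp_idn[OF w(2)]
    using comp_assoc[OF w(1) l(2)[OF c] l(1)[OF c]] by simp
  have "braid C (a \<otimes> a) a \<cdot> (u \<boxtimes> idn C a) = (idn C a \<boxtimes> u) \<cdot> braid C (tunit C) a"
    by (rule braid_natural[OF u idn_in_Hom])
  then show "lay (tunit C) ?c a \<cdot> (lay a ?c (tunit C) \<cdot> lay (tunit C) u a) = lay a u (tunit C)"
    unfolding hexagon_left idn_tmor[OF u] tmor_id[OF u] idn_tmor[OF c] tmor_id[OF c] braid_tunit_left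
      comp_idn[OF w(1)]
    using comp_assoc[OF w(2) l(1)[OF c] l(2)[OF c]] by simp
qed

end

text \<open>By the Schur lemma \<open>a\<close> and \<open>b\<close> are isomorphic, and every
  morphism between them is a multiple of one isomorphism; for \<open>f\<close> the factor is
  nonzero.\<close>

lemma (in semisimple_category) simple_left_inverse:
  assumes "simple_obj C a" "simple_obj C b" "f \<in> Hom C a b" "f \<noteq> 0"
  obtains g where "g \<in> Hom C b a" "g \<cdot> f = idn C a"
proof -
  have "iso_obj C a b" using schur[OF assms(1,2)] assms(3,4) by blast
  then obtain h k where h: "h \<in> Hom C a b" and k: "k \<in> Hom C b a" and hk: "h \<cdot> k = idn C b"
    unfolding iso_obj_def iso_mor_def by blast
  obtain z where z: "k \<cdot> f = z \<odot> idn C a"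
    using simple_scalar[OF assms(1) comp_in_Hom[OF assms(3) k]] by metis
  have "f = h \<cdot> (k \<cdot> f)"
    using comp_assoc[OF assms(3) k h] hk idn_comp[OF assms(3)] by simp
  also have "\<dots> = z \<odot> h" using z comp_smult_right[OF idn_in_Hom h] comp_idn[OF h] by simp
  finally have "z \<noteq> 0" using assms(4) by auto
  then have "(inverse z \<odot> k) \<cdot> f = idn C a"
    using comp_smult_left[OF assms(3) k] z by simp
  then show ?thesis using that smult_in_Hom[OF k] by blast
qed

section \<open>Bending strands and duals of simple objects\<close>

context strict_tensor_category
begin

text \<open>One half of the duality bijection between morphisms from the unit to
  \<open>a \<otimes> b\<close> and endomorphisms of \<open>a\<close>: the composite of
  \<open>ev\<close> with \<open>g\<close> determines \<open>g\<close>.\<close>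

lemma bend_back:
  assumes ev: "ev \<in> Hom C (b \<otimes> a) (tunit C)" and coev: "coev \<in> Hom C (tunit C) (a \<otimes> b)"
    and zig: "lay (tunit C) ev b \<cdot> lay b coev (tunit C) = idn C b"
    and g: "g \<in> Hom C (tunit C) (a \<otimes> b)"
  shows "lay (tunit C) (lay a ev (tunit C) \<cdot> lay (tunit C) g a) b \<cdot> coev = g"
proof -
  have A: "lay a ev (tunit C) \<in> Hom C (a \<otimes> (b \<otimes> a)) a" and B: "lay (tunit C) g a \<in> Hom C a (a \<otimes> (b \<otimes> a))"
    using lay_in_Hom[OF ev, of a "tunit C"] lay_in_Hom[OF g, of "tunit C" a]
    by (simp_all add: tunit_tobj tobj_tunit tobj_assoc)
  have A': "lay a ev b \<in> Hom C (a \<otimes> (b \<otimes> (a \<otimes> b))) (a \<otimes> b)"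
    and B': "lay (tunit C) g (a \<otimes> b) \<in> Hom C (a \<otimes> b) (a \<otimes> (b \<otimes> (a \<otimes> b)))"
    and D: "lay (a \<otimes> b) coev (tunit C) \<in> Hom C (a \<otimes> b) (a \<otimes> (b \<otimes> (a \<otimes> b)))"
    using lay_in_Hom[OF ev, of a b] lay_in_Hom[OF g, of "tunit C" "a \<otimes> b"] lay_in_Hom[OF coev, of "a \<otimes> b" "tunit C"]
    by (simp_all add: tunit_tobj tobj_tunit tobj_assoc)
  have E: "lay (tunit C) ev b \<in> Hom C (b \<otimes> (a \<otimes> b)) b" and F: "lay b coev (tunit C) \<in> Hom C b (b \<otimes> (a \<otimes> b))"
    using lay_in_Hom[OF ev, of "tunit C" b] lay_in_Hom[OF coev, of b "tunit C"]
    by (simp_all add: tunit_tobj tobj_tunit tobj_assoc)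
  have "lay (tunit C) (lay a ev (tunit C) \<cdot> lay (tunit C) g a) b \<cdot> coev =
    (lay a ev b \<cdot> lay (tunit C) g (a \<otimes> b)) \<cdot> coev"
    unfolding lay_comp[OF B A] lay_lay[OF ev] lay_lay[OF g] by (simp add: tunit_tobj tobj_tunit)
  also have "\<dots> = lay a ev b \<cdot> (lay (tunit C) g (a \<otimes> b) \<cdot> coev)"
    by (rule comp_assoc[OF coev B' A'])
  also have "lay (tunit C) g (a \<otimes> b) \<cdot> coev = lay (a \<otimes> b) coev (tunit C) \<cdot> g"
    using lay_exchange[OF g coev, of "tunit C" "tunit C" "tunit C"] lay_tunit[OF coev] lay_tunit[OF g]
    by (simp add: tunit_tobj tobj_tunit)
  also have "lay a ev b \<cdot> (lay (a \<otimes> b) coev (tunit C) \<cdot> g) = (lay a ev b \<cdot> lay (a \<otimes> b) coev (tunit C)) \<cdot> g"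
    by (rule comp_assoc[OF g D A', symmetric])
  also have "lay a ev b \<cdot> lay (a \<otimes> b) coev (tunit C) = lay a (lay (tunit C) ev b \<cdot> lay b coev (tunit C)) (tunit C)"
    unfolding lay_comp[OF F E] lay_lay[OF ev] lay_lay[OF coev] by (simp add: tunit_tobj tobj_tunit)
  also have "\<dots> = idn C (a \<otimes> b)" unfolding zig by (simp add: lay_idn tobj_tunit)
  finally show ?thesis using idn_comp[OF g] by simp
qed

end

context semisimple_braided_category
begin

text \<open>An endomorphism of \<open>b\<close> is determined by its composite with
  \<open>coev\<close>. That composite bends to an endomorphism of \<open>a\<close>, hence is a
  multiple of \<open>coev\<close>, so End(b) consists of scalars.\<close>

lemma simple_dual:
  assumes a: "simple_obj C a"
    and ev: "ev \<in> Hom C (b \<otimes> a) (tunit C)" and coev: "coev \<in> Hom C (tunit C) (a \<otimes> b)"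
    and zig: "lay (tunit C) ev b \<cdot> lay b coev (tunit C) = idn C b"
    and zag: "lay a ev (tunit C) \<cdot> lay (tunit C) coev a = idn C a"
  shows "simple_obj C b"
proof -
  have E: "lay (tunit C) ev b \<in> Hom C (b \<otimes> (a \<otimes> b)) b" and F: "lay b coev (tunit C) \<in> Hom C b (b \<otimes> (a \<otimes> b))"
    and G: "lay (tunit C) coev a \<in> Hom C a (a \<otimes> (b \<otimes> a))" and H: "lay a ev (tunit C) \<in> Hom C (a \<otimes> (b \<otimes> a)) a"
    using lay_in_Hom[OF ev, of "tunit C" b] lay_in_Hom[OF coev, of b "tunit C"]
      lay_in_Hom[OF coev, of "tunit C" a] lay_in_Hom[OF ev, of a "tunit C"]
    by (simp_all add: tunit_tobj tobj_tunit tobj_assoc)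
  have inj: "k = 0" if k: "k \<in> Hom C b b" and 0: "lay a k (tunit C) \<cdot> coev = 0" for k
  proof -
    have ak: "lay a k (tunit C) \<in> Hom C (a \<otimes> b) (a \<otimes> b)"
      using lay_in_Hom[OF k, of a "tunit C"] by (simp add: tobj_tunit)
    have K: "lay (b \<otimes> a) k (tunit C) \<in> Hom C (b \<otimes> (a \<otimes> b)) (b \<otimes> (a \<otimes> b))"
      using lay_in_Hom[OF k, of "b \<otimes> a" "tunit C"] by (simp add: tobj_tunit tobj_assoc)
    have "k = k \<cdot> (lay (tunit C) ev b \<cdot> lay b coev (tunit C))" unfolding zig using comp_idn[OF k] by simp
    also have "\<dots> = (k \<cdot> lay (tunit C) ev b) \<cdot> lay b coev (tunit C)" by (rule comp_assoc[OF F E k, symmetric])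
    also have "k \<cdot> lay (tunit C) ev b = lay (tunit C) ev b \<cdot> lay (b \<otimes> a) k (tunit C)"
      using lay_exchange[OF ev k, of "tunit C" "tunit C" "tunit C"] lay_tunit[OF k]
      by (simp add: tunit_tobj tobj_tunit)
    also have "(lay (tunit C) ev b \<cdot> lay (b \<otimes> a) k (tunit C)) \<cdot> lay b coev (tunit C) =
      lay (tunit C) ev b \<cdot> (lay (b \<otimes> a) k (tunit C) \<cdot> lay b coev (tunit C))"
      by (rule comp_assoc[OF F K E])
    also have "lay (b \<otimes> a) k (tunit C) \<cdot> lay b coev (tunit C) = lay b (lay a k (tunit C) \<cdot> coev) (tunit C)"
      unfolding lay_comp[OF coev ak] lay_lay[OF k] by (simp add: tobj_tunit)
    also have "\<dots> = 0" unfolding 0 by (rule lay_zero)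
    finally show ?thesis using comp_zero_right[OF E] by simp
  qed
  have "h \<in> range (\<lambda>z. z \<odot> idn C b)" if h: "h \<in> Hom C b b" for h
  proof -
    have ah: "lay a h (tunit C) \<in> Hom C (a \<otimes> b) (a \<otimes> b)"
      using lay_in_Hom[OF h, of a "tunit C"] by (simp add: tobj_tunit)
    define g where "g = lay a h (tunit C) \<cdot> coev"
    have g: "g \<in> Hom C (tunit C) (a \<otimes> b)" unfolding g_def using comp_in_Hom[OF coev ah] .
    have "lay (tunit C) g a \<in> Hom C a (a \<otimes> (b \<otimes> a))"
      using lay_in_Hom[OF g, of "tunit C" a] by (simp add: tunit_tobj tobj_tunit tobj_assoc)
    then obtain z where z: "lay a ev (tunit C) \<cdot> lay (tunit C) g a = z \<odot> idn C a"
      using simple_scalar[OF a comp_in_Hom[OF _ H]] by metis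
    have "g = z \<odot> coev"
      using bend_back[OF ev coev zig g] z lay_smult[OF idn_in_Hom, of "tunit C" z a b] lay_idn[of "tunit C" a b]
        comp_smult_left[OF coev idn_in_Hom] idn_comp[OF coev] by (simp add: tunit_tobj)
    moreover have "lay a (h - z \<odot> idn C b) (tunit C) = lay a h (tunit C) - z \<odot> idn C (a \<otimes> b)"
      using lay_diff[OF h smult_in_Hom[OF idn_in_Hom]] lay_smult[OF idn_in_Hom] lay_idn by (simp add: tobj_tunit)
    ultimately have "lay a (h - z \<odot> idn C b) (tunit C) \<cdot> coev = 0"
      using comp_diff_left[OF coev ah smult_in_Hom[OF idn_in_Hom]] comp_smult_left[OF coev idn_in_Hom]
        idn_comp[OF coev] by (simp add: g_def)
    then have "h - z \<odot> idn C b = 0" by (rule inj[OF diff_in_Hom[OF h smult_in_Hom[OF idn_in_Hom]]])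
    then have "h = z \<odot> idn C b" by simp
    then show ?thesis by (rule range_eqI)
  qed
  moreover have "idn C b \<noteq> 0"
  proof
    assume 0: "idn C b = 0"
    have "coev = lay a (idn C b) (tunit C) \<cdot> coev" using lay_idn idn_comp[OF coev] by (simp add: tobj_tunit)
    then have "coev = 0" using 0 lay_zero comp_zero_left[OF coev] by simp
    then have "idn C a = 0" using zag lay_zero comp_zero_right[OF H] by simp
    then show False using a unfolding simple_obj_def by simp
  qed
  ultimately show ?thesis
    unfolding simple_obj_def using smult_in_Hom[OF idn_in_Hom] by blast
qed

text \<open>Up to an isomorphism from \<open>a\<close> to its dual \<open>b\<close>, the morphism
  \<open>v\<close> is the evaluation. The zigzag of \<open>u\<close> and \<open>v\<close> is then
  \<open>u\<close> with one leg bent, and bending loses no information.\<close>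

lemma zigzag_nonzero:
  assumes a: "simple_obj C a"
    and u: "u \<in> Hom C (tunit C) (a \<otimes> a)" "u \<noteq> 0" and v: "v \<in> Hom C (a \<otimes> a) (tunit C)" "v \<noteq> 0"
  shows "lay a v (tunit C) \<cdot> lay (tunit C) u a \<noteq> 0"
proof
  assume 0: "lay a v (tunit C) \<cdot> lay (tunit C) u a = 0"
  obtain b ev coev where ev: "ev \<in> Hom C (b \<otimes> a) (tunit C)" and coev: "coev \<in> Hom C (tunit C) (a \<otimes> b)"
    and "(idn C a \<boxtimes> ev) \<cdot> (coev \<boxtimes> idn C a) = idn C a" "(ev \<boxtimes> idn C b) \<cdot> (idn C b \<boxtimes> coev) = idn C b"
    using left_dual[of a] unfolding dual_pair_def by blast
  then have zig: "lay (tunit C) ev b \<cdot> lay b coev (tunit C) = idn C b"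
    and zag: "lay a ev (tunit C) \<cdot> lay (tunit C) coev a = idn C a"
    by (simp_all add: idn_tmor[OF ev] tmor_id[OF ev] idn_tmor[OF coev] tmor_id[OF coev])
  note b = simple_dual[OF a ev coev zig zag]
  have E: "lay (tunit C) v b \<in> Hom C (a \<otimes> (a \<otimes> b)) b" and F: "lay a coev (tunit C) \<in> Hom C a (a \<otimes> (a \<otimes> b))"
    and E': "lay (tunit C) v (b \<otimes> a) \<in> Hom C (a \<otimes> (a \<otimes> (b \<otimes> a))) (b \<otimes> a)"
    and F': "lay a coev a \<in> Hom C (a \<otimes> a) (a \<otimes> (a \<otimes> (b \<otimes> a)))"
    and G: "lay (a \<otimes> a) ev (tunit C) \<in> Hom C (a \<otimes> (a \<otimes> (b \<otimes> a))) (a \<otimes> a)"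
    and G': "lay a ev (tunit C) \<in> Hom C (a \<otimes> (b \<otimes> a)) a" and H': "lay (tunit C) coev a \<in> Hom C a (a \<otimes> (b \<otimes> a))"
    using lay_in_Hom[OF v(1), of "tunit C" b] lay_in_Hom[OF coev, of a "tunit C"]
      lay_in_Hom[OF v(1), of "tunit C" "b \<otimes> a"] lay_in_Hom[OF coev, of a a]
      lay_in_Hom[OF ev, of "a \<otimes> a" "tunit C"] lay_in_Hom[OF ev, of a "tunit C"] lay_in_Hom[OF coev, of "tunit C" a]
    by (simp_all add: tunit_tobj tobj_tunit tobj_assoc)
  \<comment> \<open>The mate of \<open>v\<close> under the duality; \<open>v\<close> is recovered as
    \<open>ev\<close> after \<open>\<psi>\<close> on the left strand, so \<open>\<psi>\<close> is
    nonzero and, by simplicity, has a left inverse.\<close>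
  define \<psi> where "\<psi> = lay (tunit C) v b \<cdot> lay a coev (tunit C)"
  have \<psi>: "\<psi> \<in> Hom C a b" unfolding \<psi>_def by (rule comp_in_Hom[OF F E])
  have \<psi>a: "lay (tunit C) \<psi> a \<in> Hom C (a \<otimes> a) (b \<otimes> a)"
    using lay_in_Hom[OF \<psi>, of "tunit C" a] by (simp add: tunit_tobj)
  have v_\<psi>: "ev \<cdot> lay (tunit C) \<psi> a = v"
  proof -
    have "ev \<cdot> lay (tunit C) \<psi> a = ev \<cdot> (lay (tunit C) v (b \<otimes> a) \<cdot> lay a coev a)"
      unfolding \<psi>_def lay_comp[OF F E] lay_lay[OF v(1)] lay_lay[OF coev] by (simp add: tunit_tobj)
    also have "\<dots> = (ev \<cdot> lay (tunit C) v (b \<otimes> a)) \<cdot> lay a coev a"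
      by (rule comp_assoc[OF F' E' ev, symmetric])
    also have "ev \<cdot> lay (tunit C) v (b \<otimes> a) = v \<cdot> lay (a \<otimes> a) ev (tunit C)"
      using lay_exchange[OF v(1) ev, of "tunit C" "tunit C" "tunit C"] lay_tunit[OF v(1)] lay_tunit[OF ev]
      by (simp add: tunit_tobj tobj_tunit)
    also have "(v \<cdot> lay (a \<otimes> a) ev (tunit C)) \<cdot> lay a coev a = v \<cdot> (lay (a \<otimes> a) ev (tunit C) \<cdot> lay a coev a)"
      by (rule comp_assoc[OF F' G v(1)])
    also have "lay (a \<otimes> a) ev (tunit C) \<cdot> lay a coev a = lay a (lay a ev (tunit C) \<cdot> lay (tunit C) coev a) (tunit C)"
      unfolding lay_comp[OF H' G'] lay_lay[OF ev] lay_lay[OF coev] by (simp add: tunit_tobj tobj_tunit)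
    also have "\<dots> = idn C (a \<otimes> a)" unfolding zag by (simp add: lay_idn tobj_tunit)
    finally show ?thesis using comp_idn[OF v(1)] by simp
  qed
  have "\<psi> \<noteq> 0" using v_\<psi> v(2) lay_zero comp_zero_right[OF ev] by auto
  then obtain \<phi> where \<phi>: "\<phi> \<in> Hom C b a" "\<phi> \<cdot> \<psi> = idn C a"
    using simple_left_inverse[OF a b \<psi>] by blast
  have a\<psi>: "lay a \<psi> (tunit C) \<in> Hom C (a \<otimes> a) (a \<otimes> b)" and a\<phi>: "lay a \<phi> (tunit C) \<in> Hom C (a \<otimes> b) (a \<otimes> a)"
    using lay_in_Hom[OF \<psi>, of a "tunit C"] lay_in_Hom[OF \<phi>(1), of a "tunit C"] by (simp_all add: tobj_tunit)
  define g where "g = lay a \<psi> (tunit C) \<cdot> u"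
  have g: "g \<in> Hom C (tunit C) (a \<otimes> b)" unfolding g_def by (rule comp_in_Hom[OF u(1) a\<psi>])
  have P: "lay (tunit C) u a \<in> Hom C a (a \<otimes> (a \<otimes> a))" and Q: "lay a \<psi> a \<in> Hom C (a \<otimes> (a \<otimes> a)) (a \<otimes> (b \<otimes> a))"
    using lay_in_Hom[OF u(1), of "tunit C" a] lay_in_Hom[OF \<psi>, of a a] by (simp_all add: tunit_tobj tobj_assoc)
  have "lay a v (tunit C) = lay a ev (tunit C) \<cdot> lay a \<psi> a"
    unfolding v_\<psi>[symmetric] lay_comp[OF \<psi>a ev] lay_lay[OF \<psi>] by (simp add: tobj_tunit)
  then have "0 = lay a ev (tunit C) \<cdot> (lay a \<psi> a \<cdot> lay (tunit C) u a)"
    using 0 comp_assoc[OF P Q G'] by simp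
  also have "lay a \<psi> a \<cdot> lay (tunit C) u a = lay (tunit C) g a"
    unfolding g_def lay_comp[OF u(1) a\<psi>] lay_lay[OF \<psi>] by (simp add: tunit_tobj)
  finally have "g = 0"
    using bend_back[OF ev coev zig g] lay_zero comp_zero_left[OF coev] by simp
  then have "lay a \<phi> (tunit C) \<cdot> (lay a \<psi> (tunit C) \<cdot> u) = 0" using comp_zero_right[OF a\<phi>] by (simp add: g_def)
  then have "lay a (\<phi> \<cdot> \<psi>) (tunit C) \<cdot> u = 0"
    unfolding lay_comp[OF \<psi> \<phi>(1)] using comp_assoc[OF u(1) a\<psi> a\<phi>] by simp
  then show False using \<phi>(2) u(2) idn_comp[OF u(1)] by (simp add: lay_idn tobj_tunit)
qed

end

section \<open>Relations of the normalized braiding\<close>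

locale normalized_braiding = semisimple_braided_category C
  for C :: "('o, 'm::ab_group_add) tensor_cat" (structure) +
  fixes V :: 'o and u v p t :: 'm and \<gamma> \<rho> :: complex
  assumes V_simple: "simple_obj C V" and unit_simple: "simple_obj C (tunit C)"
    and u_in: "u \<in> Hom C (tunit C) (V \<otimes> V)" and v_in: "v \<in> Hom C (V \<otimes> V) (tunit C)"
    and vu: "v \<cdot> u = idn C (tunit C)"
    and p_in: "p \<in> Hom C (V \<otimes> V) (V \<otimes> V)" and p_nonzero: "p \<noteq> 0" and pu: "p \<cdot> u = 0"
    and t_eq: "t = \<gamma> \<odot> braid C V V" and \<gamma>4: "\<gamma> ^ 4 = 1"
    and tu: "t \<cdot> u = \<rho> \<odot> u"
begin

abbreviation "W1 \<equiv> lay (tunit C) u V"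
abbreviation "W2 \<equiv> lay V u (tunit C)"
abbreviation "T1 \<equiv> lay (tunit C) t V"
abbreviation "T2 \<equiv> lay V t (tunit C)"
abbreviation "\<epsilon> \<equiv> \<gamma> * \<gamma>"

lemma \<epsilon>: "\<epsilon> * \<epsilon> = 1"
  using \<gamma>4 by (simp add: power4_eq_xxxx ac_simps)

lemma t_in: "t \<in> Hom C (V \<otimes> V) (V \<otimes> V)"
  unfolding t_eq by (rule smult_in_Hom[OF braid_in_Hom])

lemma W1_in: "W1 \<in> Hom C V (V \<otimes> (V \<otimes> V))" and W2_in: "W2 \<in> Hom C V (V \<otimes> (V \<otimes> V))"
  using lay_in_Hom[OF u_in, of "tunit C" V] lay_in_Hom[OF u_in, of V "tunit C"]
  by (simp_all add: tunit_tobj tobj_tunit tobj_assoc)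

lemma lay1_in: "f \<in> Hom C (V \<otimes> V) (V \<otimes> V) \<Longrightarrow> lay (tunit C) f V \<in> Hom C (V \<otimes> (V \<otimes> V)) (V \<otimes> (V \<otimes> V))"
  and lay2_in: "f \<in> Hom C (V \<otimes> V) (V \<otimes> V) \<Longrightarrow> lay V f (tunit C) \<in> Hom C (V \<otimes> (V \<otimes> V)) (V \<otimes> (V \<otimes> V))"
  using lay_in_Hom[of f "V \<otimes> V" "V \<otimes> V" "tunit C" V] lay_in_Hom[of f "V \<otimes> V" "V \<otimes> V" V "tunit C"]
  by (simp_all add: tunit_tobj tobj_tunit tobj_assoc)

lemma v1_in: "lay (tunit C) v V \<in> Hom C (V \<otimes> (V \<otimes> V)) V" and v2_in: "lay V v (tunit C) \<in> Hom C (V \<otimes> (V \<otimes> V)) V"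
  using lay_in_Hom[OF v_in, of "tunit C" V] lay_in_Hom[OF v_in, of V "tunit C"]
  by (simp_all add: tunit_tobj tobj_tunit tobj_assoc)

lemma T1_W1: "T1 \<cdot> W1 = \<rho> \<odot> W1" and T2_W2: "T2 \<cdot> W2 = \<rho> \<odot> W2"
  using lay_comp[OF u_in t_in, of _ V] lay_comp[OF u_in t_in, of V] tu lay_smult[OF u_in] by metis+

text \<open>A cup slid past one strand meets two crossings, and each contributes a factor
  \<gamma>.\<close>

lemma T2_T1_W2: "T2 \<cdot> (T1 \<cdot> W2) = \<epsilon> \<odot> W1" and T1_T2_W1: "T1 \<cdot> (T2 \<cdot> W1) = \<epsilon> \<odot> W2"
proof -
  note c = braid_in_Hom[of V V]
  have T: "T1 = \<gamma> \<odot> lay (tunit C) (braid C V V) V" "T2 = \<gamma> \<odot> lay V (braid C V V) (tunit C)"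
    unfolding t_eq using lay_smult[OF c] by simp_all
  note i1 = lay1_in[OF c] and i2 = lay2_in[OF c]
  show "T2 \<cdot> (T1 \<cdot> W2) = \<epsilon> \<odot> W1"
    unfolding T comp_smult_left[OF W2_in i1] comp_smult_left[OF smult_in_Hom[OF comp_in_Hom[OF W2_in i1]] i2]
      comp_smult_right[OF comp_in_Hom[OF W2_in i1] i2]
    using braid_cup_left[OF u_in] by simp
  show "T1 \<cdot> (T2 \<cdot> W1) = \<epsilon> \<odot> W2"
    unfolding T comp_smult_left[OF W1_in i2] comp_smult_left[OF smult_in_Hom[OF comp_in_Hom[OF W1_in i2]] i1]
      comp_smult_right[OF comp_in_Hom[OF W1_in i2] i1]
    using braid_cup_right[OF u_in] by simp
qed

lemma u_nonzero: "u \<noteq> 0" and v_nonzero: "v \<noteq> 0"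
  using vu unit_simple comp_zero_right[OF v_in] comp_zero_left[OF u_in] unfolding simple_obj_def by auto

lemma v2_W1: "lay V v (tunit C) \<cdot> W1 \<noteq> 0"
  by (rule zigzag_nonzero[OF V_simple u_in u_nonzero v_in v_nonzero])

text \<open>Applying \<open>p\<close> to the left pair of strands kills \<open>W1\<close>. It does
  not kill \<open>W2\<close>: with one more strand on the right and the last two strands contracted,
  the result is a nonzero multiple of \<open>p\<close>, by \<open>v2_W1\<close>.\<close>

lemma W_independent:
  assumes "x \<odot> W1 + y \<odot> W2 = 0"
  shows "x = 0" and "y = 0"
proof -
  obtain z where z: "lay V v (tunit C) \<cdot> W1 = z \<odot> idn C V"
    using simple_scalar[OF V_simple comp_in_Hom[OF W1_in v2_in]] by metis
  have z0: "z \<noteq> 0" using z v2_W1 by auto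
  have P: "lay (tunit C) p V \<in> Hom C (V \<otimes> (V \<otimes> V)) (V \<otimes> (V \<otimes> V))" by (rule lay1_in[OF p_in])
  have "lay (tunit C) p V \<cdot> (x \<odot> W1 + y \<odot> W2) = x \<odot> (lay (tunit C) p V \<cdot> W1) + y \<odot> (lay (tunit C) p V \<cdot> W2)"
    using comp_add_right[OF smult_in_Hom[OF W1_in] smult_in_Hom[OF W2_in] P]
      comp_smult_right[OF W1_in P] comp_smult_right[OF W2_in P] by simp
  also have "lay (tunit C) p V \<cdot> W1 = 0"
    unfolding lay_comp[OF u_in p_in, symmetric] pu by (rule lay_zero)
  finally have "y \<odot> (lay (tunit C) p V \<cdot> W2) = 0"
    using assms comp_zero_right[OF P] by simp
  moreover have "lay (tunit C) p V \<cdot> W2 \<noteq> 0"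
  proof
    assume 0: "lay (tunit C) p V \<cdot> W2 = 0"
    have A: "lay (tunit C) p (V \<otimes> V) \<in> Hom C (V \<otimes> (V \<otimes> (V \<otimes> V))) (V \<otimes> (V \<otimes> (V \<otimes> V)))"
      and B: "lay V u V \<in> Hom C (V \<otimes> V) (V \<otimes> (V \<otimes> (V \<otimes> V)))"
      and D: "lay (V \<otimes> V) v (tunit C) \<in> Hom C (V \<otimes> (V \<otimes> (V \<otimes> V))) (V \<otimes> V)"
      using lay_in_Hom[OF p_in, of "tunit C" "V \<otimes> V"] lay_in_Hom[OF u_in, of V V]
        lay_in_Hom[OF v_in, of "V \<otimes> V" "tunit C"] by (simp_all add: tunit_tobj tobj_tunit tobj_assoc)
    have "0 = lay (tunit C) (lay (tunit C) p V \<cdot> W2) V" unfolding 0 by (rule lay_zero[symmetric])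
    also have "\<dots> = lay (tunit C) p (V \<otimes> V) \<cdot> lay V u V"
      unfolding lay_comp[OF W2_in P] lay_lay[OF p_in] lay_lay[OF u_in] by (simp add: tunit_tobj)
    finally have "0 = lay (V \<otimes> V) v (tunit C) \<cdot> (lay (tunit C) p (V \<otimes> V) \<cdot> lay V u V)"
      using comp_zero_right[OF D] by simp
    also have "\<dots> = (lay (V \<otimes> V) v (tunit C) \<cdot> lay (tunit C) p (V \<otimes> V)) \<cdot> lay V u V"
      by (rule comp_assoc[OF B A D, symmetric])
    also have "lay (V \<otimes> V) v (tunit C) \<cdot> lay (tunit C) p (V \<otimes> V) = p \<cdot> lay (V \<otimes> V) v (tunit C)"
      using lay_exchange[OF p_in v_in, of "tunit C" "tunit C" "tunit C"] lay_tunit[OF p_in]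
      by (simp add: tunit_tobj tobj_tunit)
    also have "(p \<cdot> lay (V \<otimes> V) v (tunit C)) \<cdot> lay V u V = p \<cdot> (lay (V \<otimes> V) v (tunit C) \<cdot> lay V u V)"
      by (rule comp_assoc[OF B D p_in])
    also have "lay (V \<otimes> V) v (tunit C) \<cdot> lay V u V = lay V (lay V v (tunit C) \<cdot> W1) (tunit C)"
      unfolding lay_comp[OF W1_in v2_in] lay_lay[OF v_in] lay_lay[OF u_in] by (simp add: tobj_tunit)
    also have "\<dots> = z \<odot> idn C (V \<otimes> V)"
      unfolding z using lay_smult[OF idn_in_Hom] lay_idn by (simp add: tobj_tunit)
    finally have "z \<odot> p = 0" using comp_smult_right[OF idn_in_Hom p_in] comp_idn[OF p_in] by simp
    then show False using z0 p_nonzero by simp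
  qed
  ultimately show y: "y = 0" by simp
  have "W1 \<noteq> 0" using v2_W1 comp_zero_right[OF v2_in] by auto
  then show "x = 0" using assms y by simp
qed

text \<open>Multiply \<open>T1 T2 W1 = \<epsilon> W2\<close> by \<open>T1\<close> and
  \<open>T2 T1 W2 = \<epsilon> W1\<close> by \<open>T2\<close>, and reduce the squares. The two
  equations express \<open>T2 W1\<close> and \<open>T1 W2\<close> through each other; as
  \<epsilon>\<epsilon> = 1, elimination leaves a relation between \<open>W1\<close> and
  \<open>W2\<close> alone.\<close>

lemma hecke_unit:
  assumes "t \<cdot> t = z \<odot> t + idn C (V \<otimes> V)"
  shows "z = 0"
proof -
  note T1 = lay1_in[OF t_in] and T2 = lay2_in[OF t_in]
  have sq: "lay a t b \<cdot> (lay a t b \<cdot> f) = z \<odot> (lay a t b \<cdot> f) + f"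
    if "lay a t b \<in> Hom C (a \<otimes> (V \<otimes> V \<otimes> b)) (a \<otimes> (V \<otimes> V \<otimes> b))" "f \<in> Hom C y (a \<otimes> (V \<otimes> V \<otimes> b))" for a b f y
  proof -
    have "lay a t b \<cdot> (lay a t b \<cdot> f) = lay a (z \<odot> t + idn C (V \<otimes> V)) b \<cdot> f"
      using comp_assoc[OF that(2,1,1)] lay_comp[OF t_in t_in] assms by simp
    also have "lay a (z \<odot> t + idn C (V \<otimes> V)) b = z \<odot> lay a t b + idn C (a \<otimes> (V \<otimes> V \<otimes> b))"
      using lay_add[OF smult_in_Hom[OF t_in] idn_in_Hom] lay_smult[OF t_in] lay_idn by simp
    finally show ?thesis
      using comp_add_left[OF that(2) smult_in_Hom[OF that(1)] idn_in_Hom] comp_smult_left[OF that(2,1)]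
        idn_comp[OF that(2)] by simp
  qed
  have sq1: "T1 \<cdot> (T1 \<cdot> f) = z \<odot> (T1 \<cdot> f) + f" and sq2: "T2 \<cdot> (T2 \<cdot> f) = z \<odot> (T2 \<cdot> f) + f"
    if "f \<in> Hom C y (V \<otimes> (V \<otimes> V))" for f y
    using that sq[of "tunit C" V f y] sq[of V "tunit C" f y] T1 T2 by (simp_all add: tunit_tobj tobj_tunit tobj_assoc)
  define A where "A = T2 \<cdot> W1"
  define B where "B = T1 \<cdot> W2"
  have A_in: "A \<in> Hom C V (V \<otimes> (V \<otimes> V))" and B_in: "B \<in> Hom C V (V \<otimes> (V \<otimes> V))"
    unfolding A_def B_def using comp_in_Hom[OF W1_in T2] comp_in_Hom[OF W2_in T1] .
  have "\<epsilon> \<odot> B = z \<odot> (\<epsilon> \<odot> W2) + A"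
    using sq1[OF A_in] comp_smult_right[OF W2_in T1] T1_T2_W1 by (simp add: A_def B_def)
  then have A: "A = \<epsilon> \<odot> B - (z * \<epsilon>) \<odot> W2" by (simp add: algebra_simps)
  have "\<epsilon> \<odot> A = z \<odot> (\<epsilon> \<odot> W1) + B"
    using sq2[OF B_in] comp_smult_right[OF W1_in T2] T2_T1_W2 by (simp add: A_def B_def)
  then have "\<epsilon> \<odot> (\<epsilon> \<odot> B - (z * \<epsilon>) \<odot> W2) = (z * \<epsilon>) \<odot> W1 + B" unfolding A by simp
  then have "(\<epsilon> * \<epsilon>) \<odot> B - (z * (\<epsilon> * \<epsilon>)) \<odot> W2 = (z * \<epsilon>) \<odot> W1 + B"
    by (simp add: scale_right_diff_distrib ac_simps)
  then have "(z * \<epsilon>) \<odot> W1 + z \<odot> W2 = 0" unfolding \<epsilon> by (simp add: algebra_simps)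
  then show ?thesis by (rule W_independent)
qed

text \<open>Expand both slide equations in the basis \<open>W1\<close>, \<open>W2\<close>. The
  coefficients give \<open>a * \<kappa> = a * \<kappa>' = - \<epsilon> * q\<close> and
  \<open>q * \<rho> = 1\<close>, where \<rho> = q + a. In particular the two zigzag scalars agree,
  so that a single rescaling of \<open>v\<close> normalizes both.\<close>

lemma kauffman:
  assumes q: "q * q = -1" and t: "t = q \<odot> idn C (V \<otimes> V) + a \<odot> (u \<cdot> v)" and a: "a \<noteq> 0"
  shows "a = - 2 * q" and "lay V v (tunit C) \<cdot> W1 = (\<epsilon> / 2) \<odot> idn C V"
    and "lay (tunit C) v V \<cdot> W2 = (\<epsilon> / 2) \<odot> idn C V"
proof -
  note T1 = lay1_in[OF t_in] and T2 = lay2_in[OF t_in]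
  have U: "u \<cdot> v \<in> Hom C (V \<otimes> V) (V \<otimes> V)" using comp_in_Hom[OF v_in u_in] .
  have "t \<cdot> u = (q + a) \<odot> u"
    unfolding t comp_add_left[OF u_in smult_in_Hom[OF idn_in_Hom] smult_in_Hom[OF U]]
      comp_smult_left[OF u_in idn_in_Hom] comp_smult_left[OF u_in U] comp_assoc[OF u_in v_in u_in] vu
      idn_comp[OF u_in] comp_idn[OF u_in] by (simp add: scale_left_distrib)
  then have \<rho>: "\<rho> = q + a" using tu u_nonzero by simp
  obtain \<kappa>' where k': "lay V v (tunit C) \<cdot> W1 = \<kappa>' \<odot> idn C V"
    using simple_scalar[OF V_simple comp_in_Hom[OF W1_in v2_in]] by metis
  obtain \<kappa> where k: "lay (tunit C) v V \<cdot> W2 = \<kappa> \<odot> idn C V"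
    using simple_scalar[OF V_simple comp_in_Hom[OF W2_in v1_in]] by metis
  have lt: "lay b t d = q \<odot> idn C (b \<otimes> (V \<otimes> V \<otimes> d)) + a \<odot> (lay b u d \<cdot> lay b v d)" for b d
    unfolding t lay_add[OF smult_in_Hom[OF idn_in_Hom] smult_in_Hom[OF U]] lay_smult[OF idn_in_Hom] lay_smult[OF U]
      lay_comp[OF v_in u_in] lay_idn ..
  have T1f: "T1 \<cdot> f = q \<odot> f + a \<odot> (W1 \<cdot> (lay (tunit C) v V \<cdot> f))"
    and T2f: "T2 \<cdot> f = q \<odot> f + a \<odot> (W2 \<cdot> (lay V v (tunit C) \<cdot> f))"
    if f: "f \<in> Hom C y (V \<otimes> (V \<otimes> V))" for f y
    unfolding lt using comp_add_left[OF f smult_in_Hom[OF idn_in_Hom] smult_in_Hom[OF comp_in_Hom[OF v1_in W1_in]]]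
      comp_add_left[OF f smult_in_Hom[OF idn_in_Hom] smult_in_Hom[OF comp_in_Hom[OF v2_in W2_in]]]
      comp_smult_left[OF f idn_in_Hom] comp_smult_left[OF f comp_in_Hom[OF v1_in W1_in]]
      comp_smult_left[OF f comp_in_Hom[OF v2_in W2_in]] idn_comp[OF f]
      comp_assoc[OF f v1_in W1_in] comp_assoc[OF f v2_in W2_in]
    by (simp_all add: tunit_tobj tobj_tunit tobj_assoc)
  have T1W2: "T1 \<cdot> W2 = q \<odot> W2 + (a * \<kappa>) \<odot> W1"
    using T1f[OF W2_in] k comp_smult_right[OF idn_in_Hom W1_in] comp_idn[OF W1_in] by simp
  have T2W1: "T2 \<cdot> W1 = q \<odot> W1 + (a * \<kappa>') \<odot> W2"
    using T2f[OF W1_in] k' comp_smult_right[OF idn_in_Hom W2_in] comp_idn[OF W2_in] by simp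
  have "\<epsilon> \<odot> W1 = q \<odot> (\<rho> \<odot> W2) + (a * \<kappa>) \<odot> (q \<odot> W1 + (a * \<kappa>') \<odot> W2)"
    using T2_T1_W2 unfolding T1W2 comp_add_right[OF smult_in_Hom[OF W2_in] smult_in_Hom[OF W1_in] T2]
      comp_smult_right[OF W2_in T2] comp_smult_right[OF W1_in T2] T2_W2 T2W1 by simp
  then have "(a * \<kappa> * q - \<epsilon>) \<odot> W1 + (q * \<rho> + a * \<kappa> * (a * \<kappa>')) \<odot> W2 = 0"
    by (simp add: scale_left_distrib scale_right_distrib scale_left_diff_distrib algebra_simps)
  then have e1: "a * \<kappa> * q - \<epsilon> = 0" and e2: "q * \<rho> + a * \<kappa> * (a * \<kappa>') = 0"
    using W_independent by blast+
  have "\<epsilon> \<odot> W2 = q \<odot> (\<rho> \<odot> W1) + (a * \<kappa>') \<odot> (q \<odot> W2 + (a * \<kappa>) \<odot> W1)"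
    using T1_T2_W1 unfolding T2W1 comp_add_right[OF smult_in_Hom[OF W1_in] smult_in_Hom[OF W2_in] T1]
      comp_smult_right[OF W2_in T1] comp_smult_right[OF W1_in T1] T1_W1 T1W2 by simp
  then have "(q * \<rho> + a * \<kappa>' * (a * \<kappa>)) \<odot> W1 + (a * \<kappa>' * q - \<epsilon>) \<odot> W2 = 0"
    by (simp add: scale_left_distrib scale_right_distrib scale_left_diff_distrib algebra_simps)
  then have e3: "a * \<kappa>' * q - \<epsilon> = 0" using W_independent by blast
  have f1: "a * \<kappa> = - (\<epsilon> * q)"
  proof -
    have "a * \<kappa> = - (a * \<kappa> * (q * q))" using q by simp
    also have "\<dots> = - ((a * \<kappa> * q) * q)" by simp
    finally show ?thesis using e1 by simp
  qed
  have f2: "a * \<kappa>' = - (\<epsilon> * q)"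
  proof -
    have "a * \<kappa>' = - (a * \<kappa>' * (q * q))" using q by simp
    also have "\<dots> = - ((a * \<kappa>' * q) * q)" by simp
    finally show ?thesis using e3 by simp
  qed
  have "q * \<rho> + (\<epsilon> * \<epsilon>) * (q * q) = 0" using e2 unfolding f1 f2 by (simp add: algebra_simps)
  then have "q * \<rho> = 1" using \<epsilon> q by simp
  then have "q * a = 2" using \<rho> q by (simp add: algebra_simps)
  then have "(q * q) * a = 2 * q" by (simp add: ac_simps)
  then have "- a = 2 * q" using q by simp
  then have "- (- a) = - (2 * q)" by (rule arg_cong)
  then show a': "a = - 2 * q" by simp
  have q0: "q \<noteq> 0" using q by auto
  have "\<kappa> = \<epsilon> / 2" "\<kappa>' = \<epsilon> / 2" using f1 f2 q0 unfolding a' by (simp_all add: field_simps)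
  then show "lay V v (tunit C) \<cdot> W1 = (\<epsilon> / 2) \<odot> idn C V" "lay (tunit C) v V \<cdot> W2 = (\<epsilon> / 2) \<odot> idn C V"
    using k k' by simp_all
qed

text \<open>The counit is rescaled so that it satisfies the zigzag identities with \<open>u\<close>.\<close>

definition w :: 'm where "w = (2 * \<epsilon>) \<odot> v"

text \<open>By \<open>s_eq\<close> this is the reflection 1 - 2 u v; it is written with the rescaled
  counit because \<open>rot_scalar\<close> takes its crossing in this shape. In the Kauffman case
  \<open>t\<close> is q times it.\<close>

definition s :: 'm where "s = idn C (V \<otimes> V) - \<epsilon> \<odot> (u \<cdot> w)"

lemma w_in: "w \<in> Hom C (V \<otimes> V) (tunit C)"
  unfolding w_def by (rule smult_in_Hom[OF v_in])

lemma uv_in: "u \<cdot> v \<in> Hom C (V \<otimes> V) (V \<otimes> V)"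
  by (rule comp_in_Hom[OF v_in u_in])

lemma uw: "u \<cdot> w = (2 * \<epsilon>) \<odot> (u \<cdot> v)"
  unfolding w_def by (rule comp_smult_right[OF v_in u_in])

lemma wu: "w \<cdot> u = (2 * \<epsilon>) \<odot> idn C (tunit C)"
  unfolding w_def comp_smult_left[OF u_in v_in] vu ..

lemma s_eq: "s = idn C (V \<otimes> V) - 2 \<odot> (u \<cdot> v)"
proof -
  have "\<epsilon> * (2 * \<epsilon>) = 2" using \<epsilon> by (simp add: ac_simps)
  then show ?thesis unfolding s_def uw by simp
qed

lemma s_in: "s \<in> Hom C (V \<otimes> V) (V \<otimes> V)"
  unfolding s_eq by (rule diff_in_Hom[OF idn_in_Hom smult_in_Hom[OF uv_in]])

lemma s_s: "s \<cdot> s = idn C (V \<otimes> V)"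
proof -
  note i = idn_in_Hom[of "V \<otimes> V"] and U = uv_in
  have UU: "(u \<cdot> v) \<cdot> (u \<cdot> v) = u \<cdot> v"
    using comp_assoc[OF uv_in v_in u_in] comp_assoc[OF v_in u_in v_in] vu idn_comp[OF v_in] by simp
  have "s \<cdot> s = s - 2 \<odot> ((u \<cdot> v) \<cdot> s)"
    unfolding s_eq using comp_diff_left[OF s_in i smult_in_Hom[OF U, of 2]] comp_smult_left[OF s_in U, of 2]
      idn_comp[OF s_in] by (simp add: s_eq)
  also have "(u \<cdot> v) \<cdot> s = (u \<cdot> v) - 2 \<odot> (u \<cdot> v)"
    unfolding s_eq using comp_diff_right[OF i smult_in_Hom[OF U, of 2] U] comp_smult_right[OF U U, of 2]
      comp_idn[OF U] UU by simp
  also have "\<dots> = - (u \<cdot> v)"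
    using scale_left_diff_distrib[of 1 2 "u \<cdot> v"] by simp
  finally show ?thesis unfolding s_eq by simp
qed

end

section \<open>The Kauffman case: \<open>t\<close> is a scalar multiple of an involution\<close>

locale kauffman_braiding = normalized_braiding +
  fixes q a :: complex
  assumes q: "q * q = -1" and t_kauffman: "t = q \<odot> idn C (V \<otimes> V) + a \<odot> (u \<cdot> v)" and a: "a \<noteq> 0"
    and pp: "p \<cdot> p = p" and vp: "v \<cdot> p = 0"
begin

lemma t_s: "t = q \<odot> s"
  unfolding t_kauffman kauffman(1)[OF q t_kauffman a] s_eq
  by (simp add: scale_right_diff_distrib ac_simps)

sublocale self_dual_object C V u w
proof
  show "u \<in> Hom C (tunit C) (V \<otimes> V)" "w \<in> Hom C (V \<otimes> V) (tunit C)" by (rule u_in w_in)+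
  have "2 * \<epsilon> * (\<epsilon> / 2) = 1" using \<epsilon> by (simp add: ac_simps)
  then show "(w \<boxtimes> idn C V) \<cdot> (idn C V \<boxtimes> u) = idn C V" "(idn C V \<boxtimes> w) \<cdot> (u \<boxtimes> idn C V) = idn C V"
    unfolding idn_tmor[OF u_in] tmor_id[OF u_in] idn_tmor[OF w_in] tmor_id[OF w_in]
    unfolding w_def lay_smult[OF v_in]
      comp_smult_left[OF W1_in v2_in] comp_smult_left[OF W2_in v1_in] kauffman(2,3)[OF q t_kauffman a]
    by simp_all
qed

text \<open>Each side of the braiding version contains exactly two crossings, so the factor between
  the braiding and \<open>s\<close> cancels.\<close>

lemma
  assumes f: "f \<in> Hom C (V \<otimes> V) (V \<otimes> V)"
  shows slide_left: "lay V s (tunit C) \<cdot> (lay (tunit C) s V \<cdot> lay V f (tunit C)) =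
      lay (tunit C) f V \<cdot> (lay V s (tunit C) \<cdot> lay (tunit C) s V)"
    and slide_right: "lay (tunit C) s V \<cdot> (lay V s (tunit C) \<cdot> lay (tunit C) f V) =
      lay V f (tunit C) \<cdot> (lay (tunit C) s V \<cdot> lay V s (tunit C))"
proof -
  have \<gamma>: "\<gamma> \<noteq> 0" using \<gamma>4 by auto
  have q0: "q \<noteq> 0" using q by auto
  have "inverse \<gamma> \<odot> (\<gamma> \<odot> braid C V V) = inverse \<gamma> \<odot> (q \<odot> s)" using t_eq t_s by simp
  then have c: "braid C V V = (inverse \<gamma> * q) \<odot> s" using \<gamma> by simp
  define x where "x = inverse \<gamma> * q"
  have x0: "x * x \<noteq> 0" using \<gamma> q0 by (simp add: x_def)
  note l1 = lay1_in[OF s_in] and l2 = lay2_in[OF s_in] and f1 = lay1_in[OF f] and f2 = lay2_in[OF f]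
  have "(x * x) \<odot> (lay V s (tunit C) \<cdot> (lay (tunit C) s V \<cdot> lay V f (tunit C))) =
      (x * x) \<odot> (lay (tunit C) f V \<cdot> (lay V s (tunit C) \<cdot> lay (tunit C) s V))"
    using braid_slide_left[OF f]
    unfolding c x_def[symmetric] lay_smult[OF s_in] comp_smult_left[OF f2 l1]
      comp_smult_left[OF smult_in_Hom[OF comp_in_Hom[OF f2 l1]] l2] comp_smult_right[OF comp_in_Hom[OF f2 l1] l2]
      comp_smult_left[OF smult_in_Hom[OF l1] l2] comp_smult_right[OF l1 l2]
      comp_smult_right[OF smult_in_Hom[OF comp_in_Hom[OF l1 l2]] f1]
      comp_smult_right[OF comp_in_Hom[OF l1 l2] f1] by simp
  then show "lay V s (tunit C) \<cdot> (lay (tunit C) s V \<cdot> lay V f (tunit C)) =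
      lay (tunit C) f V \<cdot> (lay V s (tunit C) \<cdot> lay (tunit C) s V)" using x0 by simp
  have "(x * x) \<odot> (lay (tunit C) s V \<cdot> (lay V s (tunit C) \<cdot> lay (tunit C) f V)) =
      (x * x) \<odot> (lay V f (tunit C) \<cdot> (lay (tunit C) s V \<cdot> lay V s (tunit C)))"
    using braid_slide_right[OF f]
    unfolding c x_def[symmetric] lay_smult[OF s_in] comp_smult_left[OF f1 l2]
      comp_smult_left[OF smult_in_Hom[OF comp_in_Hom[OF f1 l2]] l1] comp_smult_right[OF comp_in_Hom[OF f1 l2] l1]
      comp_smult_left[OF smult_in_Hom[OF l2] l1] comp_smult_right[OF l2 l1]
      comp_smult_right[OF smult_in_Hom[OF comp_in_Hom[OF l2 l1]] f2]
      comp_smult_right[OF comp_in_Hom[OF l2 l1] f2] by simp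
  then show "lay (tunit C) s V \<cdot> (lay V s (tunit C) \<cdot> lay (tunit C) f V) =
      lay V f (tunit C) \<cdot> (lay (tunit C) s V \<cdot> lay V s (tunit C))" using x0 by simp
qed

text \<open>Since both contractions of \<open>h\<close> vanish, \<open>h\<close> is fixed by
  \<open>s\<close> in either position. Sliding \<open>p\<close> through two crossings then moves it
  from the left pair of strands to the right pair without changing the scalar.\<close>

lemma p_shift:
  assumes h: "h \<in> Hom C y (V \<otimes> (V \<otimes> V))"
    and v1: "lay (tunit C) v V \<cdot> h = 0" and v2: "lay V v (tunit C) \<cdot> h = 0"
    and p1: "lay (tunit C) p V \<cdot> h = x \<odot> h"
  shows "lay V p (tunit C) \<cdot> h = x \<odot> h"
proof -
  note S0 = lay1_in[OF s_in] and S1 = lay2_in[OF s_in] and P0 = lay1_in[OF p_in] and P1 = lay2_in[OF p_in]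
  have fix_s: "lay b s d \<cdot> h = h" if "lay b v d \<cdot> h = 0" "h \<in> Hom C y (b \<otimes> (V \<otimes> V \<otimes> d))" for b d
  proof -
    note i = idn_in_Hom[of "b \<otimes> (V \<otimes> V \<otimes> d)"]
    note U = comp_in_Hom[OF lay_in_Hom[OF v_in, of b d] lay_in_Hom[OF u_in, of b d]]
    have "lay b s d = idn C (b \<otimes> (V \<otimes> V \<otimes> d)) - 2 \<odot> (lay b u d \<cdot> lay b v d)"
      unfolding s_eq lay_diff[OF idn_in_Hom smult_in_Hom[OF uv_in]] lay_smult[OF uv_in] lay_comp[OF v_in u_in]
        lay_idn ..
    then show ?thesis
      using comp_diff_left[OF that(2) i smult_in_Hom[OF U]] comp_smult_left[OF that(2) U] idn_comp[OF that(2)]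
        comp_assoc[OF that(2) lay_in_Hom[OF v_in] lay_in_Hom[OF u_in]] that(1) comp_zero_right[OF lay_in_Hom[OF u_in]]
      by simp
  qed
  have S0h: "lay (tunit C) s V \<cdot> h = h" and S1h: "lay V s (tunit C) \<cdot> h = h"
    using fix_s[OF v1] fix_s[OF v2] h by (simp_all add: tunit_tobj tobj_tunit tobj_assoc)
  have ss: "lay b s d \<cdot> (lay b s d \<cdot> f) = f" if "f \<in> Hom C y (b \<otimes> (V \<otimes> V \<otimes> d))" for b d f
    using comp_assoc[OF that lay_in_Hom[OF s_in] lay_in_Hom[OF s_in]] lay_comp[OF s_in s_in, of b d] s_s
      idn_comp[OF that] by (simp add: lay_idn)
  have S00: "lay (tunit C) s V \<cdot> (lay (tunit C) s V \<cdot> f) = f" and S11: "lay V s (tunit C) \<cdot> (lay V s (tunit C) \<cdot> f) = f"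
    if "f \<in> Hom C y (V \<otimes> (V \<otimes> V))" for f
    using ss[of f "tunit C" V] ss[of f V "tunit C"] that by (simp_all add: tunit_tobj tobj_tunit tobj_assoc)
  define g where "g = lay V p (tunit C) \<cdot> h"
  have g: "g \<in> Hom C y (V \<otimes> (V \<otimes> V))" unfolding g_def by (rule comp_in_Hom[OF h P1])
  have "(lay V s (tunit C) \<cdot> (lay (tunit C) s V \<cdot> lay V p (tunit C))) \<cdot> h =
      (lay (tunit C) p V \<cdot> (lay V s (tunit C) \<cdot> lay (tunit C) s V)) \<cdot> h"
    using slide_left[OF p_in] by simp
  then have "lay V s (tunit C) \<cdot> (lay (tunit C) s V \<cdot> g) = x \<odot> h"
    unfolding comp_assoc[OF h comp_in_Hom[OF P1 S0] S1] comp_assoc[OF h P1 S0]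
      comp_assoc[OF h comp_in_Hom[OF S0 S1] P0] comp_assoc[OF h S0 S1] S0h S1h p1 g_def .
  then have "lay (tunit C) s V \<cdot> g = x \<odot> h"
    using S11[OF comp_in_Hom[OF g S0]] comp_smult_right[OF h S1] S1h by metis
  then have "g = x \<odot> h"
    using S00[OF g] comp_smult_right[OF h S0] S0h by metis
  then show ?thesis by (simp add: g_def)
qed

text \<open>This restates \<open>no_two_types\<close> in terms of the unscaled \<open>v\<close>; the
  action of \<open>p\<close> on the right pair of strands is supplied by
  \<open>p_shift\<close>.\<close>

lemma no_hook:
  assumes span: "\<And>f. f \<in> Hom C (V \<otimes> V) (V \<otimes> V) \<Longrightarrow>
      \<exists>a b c. f = a \<odot> idn C (V \<otimes> V) + b \<odot> (u \<cdot> v) + c \<odot> p"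
    and indep: "\<And>a b c. a \<odot> idn C (V \<otimes> V) + b \<odot> (u \<cdot> v) + c \<odot> p = 0 \<Longrightarrow> c = 0"
    and h: "h \<in> Hom C y (V \<otimes> (V \<otimes> V))" "h \<noteq> 0" "lay (tunit C) v V \<cdot> h = 0" "lay V v (tunit C) \<cdot> h = 0"
      "lay (tunit C) p V \<cdot> h = h"
    and k: "k \<in> Hom C y' (V \<otimes> (V \<otimes> V))" "k \<noteq> 0" "lay (tunit C) v V \<cdot> k = 0" "lay V v (tunit C) \<cdot> k = 0"
      "lay (tunit C) p V \<cdot> k = 0"
  shows False
proof -
  note S0 = lay1_in[OF s_in] and S1 = lay2_in[OF s_in] and P0 = lay1_in[OF p_in] and P1 = lay2_in[OF p_in]
  have \<epsilon>0: "\<epsilon> \<noteq> 0" using \<epsilon> by (metis mult_zero_left zero_neq_one)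
  have wp: "w \<cdot> p = 0" unfolding w_def comp_smult_left[OF p_in v_in] vp by simp
  have w0: "lay b w d \<cdot> f = 0" if "lay b v d \<cdot> f = 0" "f \<in> Hom C y (b \<otimes> (V \<otimes> V \<otimes> d))" for b d f y
    unfolding w_def lay_smult[OF v_in] comp_smult_left[OF that(2) lay_in_Hom[OF v_in]] that(1) by simp
  have in1: "f \<in> Hom C y (tunit C \<otimes> (V \<otimes> V \<otimes> V))" and in2: "f \<in> Hom C y (V \<otimes> (V \<otimes> V \<otimes> tunit C))"
    if "f \<in> Hom C y (V \<otimes> (V \<otimes> V))" for f y
    using that by (simp_all add: tunit_tobj tobj_tunit tobj_assoc)
  have l: "lay (tunit C) p V \<cdot> (lay V s (tunit C) \<cdot> lay (tunit C) s V) =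
      (lay V s (tunit C) \<cdot> lay (tunit C) s V) \<cdot> lay V p (tunit C)"
    using slide_left[OF p_in] comp_assoc[OF P1 S0 S1] by simp
  have r: "lay V p (tunit C) \<cdot> (lay (tunit C) s V \<cdot> lay V s (tunit C)) =
      (lay (tunit C) s V \<cdot> lay V s (tunit C)) \<cdot> lay (tunit C) p V"
    using slide_right[OF p_in] comp_assoc[OF P0 S1 S0] by simp
  have span': "\<exists>a b c. f = a \<odot> idn C (V \<otimes> V) + b \<odot> (u \<cdot> w) + c \<odot> p" if f: "f \<in> Hom C (V \<otimes> V) (V \<otimes> V)" for f
  proof -
    obtain a b c where "f = a \<odot> idn C (V \<otimes> V) + b \<odot> (u \<cdot> v) + c \<odot> p" using span[OF f] by blast
    then have "f = a \<odot> idn C (V \<otimes> V) + (b / (2 * \<epsilon>)) \<odot> (u \<cdot> w) + c \<odot> p"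
      unfolding uw using \<epsilon>0 by simp
    then show ?thesis by blast
  qed
  have indep': "c = 0" if "a \<odot> idn C (V \<otimes> V) + b \<odot> (u \<cdot> w) + c \<odot> p = 0" for a b c
    using indep[of a "b * (2 * \<epsilon>)" c] that by (simp add: uw)
  show False
    using no_two_types[OF p_in pp pu wp \<epsilon> s_def l r span' indep' h(1,2) w0[OF h(3) in1[OF h(1)]]
        w0[OF h(4) in2[OF h(1)]] h(5) _ k(1,2) w0[OF k(3) in1[OF k(1)]] w0[OF k(4) in2[OF k(1)]] k(5)]
      p_shift[OF h(1,3,4), of 1] p_shift[OF k(1,3,4), of 0] h(5) k(5) by simp
qed

end

section \<open>Partial traces and weights\<close>

context self_dual_object
begin

definition partial_trace :: "'o \<Rightarrow> 'm \<Rightarrow> 'm" where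
  "partial_trace a f = lay a v (tunit C) \<cdot> (lay (tunit C) f V \<cdot> lay a u (tunit C))"

lemma
  shows cup_at: "lay a u (tunit C) \<in> Hom C a (a \<otimes> (V \<otimes> V))"
    and cap_at: "lay a v (tunit C) \<in> Hom C (a \<otimes> (V \<otimes> V)) a"
  using lay_in_Hom[OF u, of a "tunit C"] lay_in_Hom[OF v, of a "tunit C"]
  by (simp_all add: tobj_tunit)

lemma strand_at: "f \<in> Hom C (a \<otimes> V) (b \<otimes> V) \<Longrightarrow> lay (tunit C) f V \<in> Hom C (a \<otimes> (V \<otimes> V)) (b \<otimes> (V \<otimes> V))"
  using lay_in_Hom[of f "a \<otimes> V" "b \<otimes> V" "tunit C" V] by (simp add: tunit_tobj tobj_assoc)

lemma partial_trace_in_Hom: "f \<in> Hom C (a \<otimes> V) (a \<otimes> V) \<Longrightarrow> partial_trace a f \<in> Hom C a a"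
  unfolding partial_trace_def using comp_in_Hom[OF comp_in_Hom[OF cup_at strand_at] cap_at] by blast

lemma partial_trace_add:
  assumes f: "f \<in> Hom C (a \<otimes> V) (a \<otimes> V)" and g: "g \<in> Hom C (a \<otimes> V) (a \<otimes> V)"
  shows "partial_trace a (f + g) = partial_trace a f + partial_trace a g"
  unfolding partial_trace_def lay_add[OF f g] comp_add_left[OF cup_at strand_at[OF f] strand_at[OF g]]
    comp_add_right[OF comp_in_Hom[OF cup_at strand_at[OF f]] comp_in_Hom[OF cup_at strand_at[OF g]] cap_at] ..

lemma partial_trace_zero: "partial_trace a 0 = 0"
  unfolding partial_trace_def lay_zero comp_zero_left[OF cup_at] comp_zero_right[OF cap_at] ..

lemma partial_trace_smult:
  assumes f: "f \<in> Hom C (a \<otimes> V) (a \<otimes> V)"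
  shows "partial_trace a (z \<odot> f) = z \<odot> partial_trace a f"
  unfolding partial_trace_def lay_smult[OF f] comp_smult_left[OF cup_at strand_at[OF f]]
    comp_smult_right[OF comp_in_Hom[OF cup_at strand_at[OF f]] cap_at] ..

lemma partial_trace_sum:
  assumes "finite I" "\<And>i. i \<in> I \<Longrightarrow> F i \<in> Hom C (a \<otimes> V) (a \<otimes> V)"
  shows "partial_trace a (sum F I) = (\<Sum>i\<in>I. partial_trace a (F i))"
  using assms
proof (induction I rule: finite_induct)
  case empty
  then show ?case by (simp add: partial_trace_zero)
next
  case (insert i I)
  have "partial_trace a (F i + sum F I) = partial_trace a (F i) + partial_trace a (sum F I)"
    using insert.prems by (intro partial_trace_add) (auto intro: sum_in_Hom)
  with insert show ?case by simp
qed

lemma partial_trace_idn: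
  assumes "v \<cdot> u = \<delta> \<odot> idn C (tunit C)"
  shows "partial_trace a (idn C (a \<otimes> V)) = \<delta> \<odot> idn C a"
proof -
  have "partial_trace a (idn C (a \<otimes> V)) = lay a v (tunit C) \<cdot> lay a u (tunit C)"
    unfolding partial_trace_def lay_idn using idn_comp[OF cup_at, of a] by (simp add: tunit_tobj tobj_assoc)
  also have "\<dots> = lay a (\<delta> \<odot> idn C (tunit C)) (tunit C)" using lay_comp[OF u v] assms by simp
  finally show ?thesis unfolding lay_smult[OF idn_in_Hom] lay_idn by (simp add: tobj_tunit)
qed

text \<open>The number \<open>n\<close> plays the role of dim b / dim a. It comes from closing only
  the strand \<open>V\<close>, for which a cup and a cap are at hand.\<close>

definition weight :: "'o \<Rightarrow> 'o \<Rightarrow> complex \<Rightarrow> bool" where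
  "weight a b n \<longleftrightarrow> (\<exists>\<iota> \<in> Hom C b (a \<otimes> V). \<exists>\<pi> \<in> Hom C (a \<otimes> V) b.
     \<pi> \<cdot> \<iota> = idn C b \<and> partial_trace a (\<iota> \<cdot> \<pi>) = n \<odot> idn C a)"

text \<open>The summand \<open>a\<close> of \<open>b \<otimes> V\<close> is obtained by bending the summand \<open>b\<close> of \<open>a \<otimes> V\<close>.\<close>

lemma weight_inverse:
  assumes "weight a b n" "n \<noteq> 0"
  shows "weight b a (inverse n)"
proof -
  obtain \<iota> \<pi> where i: "\<iota> \<in> Hom C b (a \<otimes> V)" and p: "\<pi> \<in> Hom C (a \<otimes> V) b"
    and pi: "\<pi> \<cdot> \<iota> = idn C b" and n: "partial_trace a (\<iota> \<cdot> \<pi>) = n \<odot> idn C a"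
    using assms(1) unfolding weight_def by blast
  have iV: "lay (tunit C) \<iota> V \<in> Hom C (b \<otimes> V) (a \<otimes> (V \<otimes> V))"
    and pV: "lay (tunit C) \<pi> V \<in> Hom C (a \<otimes> (V \<otimes> V)) (b \<otimes> V)"
    and iVV: "lay (tunit C) \<iota> (V \<otimes> V) \<in> Hom C (b \<otimes> (V \<otimes> V)) (a \<otimes> (V \<otimes> (V \<otimes> V)))"
    and pVV: "lay (tunit C) \<pi> (V \<otimes> V) \<in> Hom C (a \<otimes> (V \<otimes> (V \<otimes> V))) (b \<otimes> (V \<otimes> V))"
    using lay_in_Hom[OF i, of "tunit C" V] lay_in_Hom[OF p, of "tunit C" V]
      lay_in_Hom[OF i, of "tunit C" "V \<otimes> V"] lay_in_Hom[OF p, of "tunit C" "V \<otimes> V"]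
    by (simp_all add: tunit_tobj tobj_assoc)
  have vV: "lay a v V \<in> Hom C (a \<otimes> (V \<otimes> (V \<otimes> V))) (a \<otimes> V)" and uV: "lay a u V \<in> Hom C (a \<otimes> V) (a \<otimes> (V \<otimes> (V \<otimes> V)))"
    and v': "lay (a \<otimes> V) v (tunit C) \<in> Hom C (a \<otimes> (V \<otimes> (V \<otimes> V))) (a \<otimes> V)"
    and u': "lay (a \<otimes> V) u (tunit C) \<in> Hom C (a \<otimes> V) (a \<otimes> (V \<otimes> (V \<otimes> V)))"
    using lay_in_Hom[OF v, of a V] lay_in_Hom[OF u, of a V] lay_in_Hom[OF v, of "a \<otimes> V" "tunit C"]
      lay_in_Hom[OF u, of "a \<otimes> V" "tunit C"]
    by (simp_all add: tunit_tobj tobj_tunit tobj_assoc)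
  \<comment> \<open>Bending interchanges the roles: the projection \<open>\<pi>\<close> becomes an
    inclusion and \<open>\<iota>\<close> a projection. Their composite is the partial trace, so
    division by \<open>n\<close> normalizes the pair.\<close>
  define \<iota>' where "\<iota>' = lay (tunit C) \<pi> V \<cdot> lay a u (tunit C)"
  define \<pi>' where "\<pi>' = lay a v (tunit C) \<cdot> lay (tunit C) \<iota> V"
  have i': "\<iota>' \<in> Hom C a (b \<otimes> V)" unfolding \<iota>'_def by (rule comp_in_Hom[OF cup_at pV])
  have p': "\<pi>' \<in> Hom C (b \<otimes> V) a" unfolding \<pi>'_def by (rule comp_in_Hom[OF iV cap_at])
  have "\<pi>' \<cdot> \<iota>' = lay a v (tunit C) \<cdot> ((lay (tunit C) \<iota> V \<cdot> lay (tunit C) \<pi> V) \<cdot> lay a u (tunit C))"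
    unfolding \<pi>'_def \<iota>'_def comp_assoc[OF comp_in_Hom[OF cup_at pV] iV cap_at] comp_assoc[OF cup_at pV iV] ..
  also have "\<dots> = n \<odot> idn C a" using n lay_comp[OF p i] unfolding partial_trace_def by simp
  finally have pi': "\<pi>' \<cdot> \<iota>' = n \<odot> idn C a" .
  note ip = comp_in_Hom[OF p' i']
  have zl: "lay (tunit C) v V \<cdot> lay V u (tunit C) = idn C V" and zr: "lay V v (tunit C) \<cdot> lay (tunit C) u V = idn C V"
    using zigzag_left zigzag_right by (simp_all add: idn_tmor[OF u] tmor_id[OF u] idn_tmor[OF v] tmor_id[OF v])
  have W: "lay (tunit C) v V \<in> Hom C (V \<otimes> (V \<otimes> V)) V" "lay V u (tunit C) \<in> Hom C V (V \<otimes> (V \<otimes> V))"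
    "lay V v (tunit C) \<in> Hom C (V \<otimes> (V \<otimes> V)) V" "lay (tunit C) u V \<in> Hom C V (V \<otimes> (V \<otimes> V))"
    using lay_in_Hom[OF v, of "tunit C" V] lay_in_Hom[OF u, of V "tunit C"] cap_at[of V] lay_in_Hom[OF u, of "tunit C" V]
    by (simp_all add: tunit_tobj tobj_tunit tobj_assoc)
  have first: "lay (tunit C) \<pi>' V \<cdot> lay b u (tunit C) = \<iota>"
  proof -
    have "lay (tunit C) \<pi>' V \<cdot> lay b u (tunit C) = (lay a v V \<cdot> lay (tunit C) \<iota> (V \<otimes> V)) \<cdot> lay b u (tunit C)"
      unfolding \<pi>'_def lay_comp[OF iV cap_at] lay_lay[OF v] lay_lay[OF i] by (simp add: tunit_tobj)
    also have "\<dots> = lay a v V \<cdot> (lay (tunit C) \<iota> (V \<otimes> V) \<cdot> lay b u (tunit C))"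
      by (rule comp_assoc[OF cup_at iVV vV])
    also have "lay (tunit C) \<iota> (V \<otimes> V) \<cdot> lay b u (tunit C) = lay (a \<otimes> V) u (tunit C) \<cdot> \<iota>"
      using lay_exchange[OF i u, of "tunit C" "tunit C" "tunit C"] lay_tunit[OF i] by (simp add: tunit_tobj tobj_tunit)
    also have "lay a v V \<cdot> (lay (a \<otimes> V) u (tunit C) \<cdot> \<iota>) = (lay a v V \<cdot> lay (a \<otimes> V) u (tunit C)) \<cdot> \<iota>"
      by (rule comp_assoc[OF i u' vV, symmetric])
    also have "lay a v V \<cdot> lay (a \<otimes> V) u (tunit C) = lay a (lay (tunit C) v V \<cdot> lay V u (tunit C)) (tunit C)"
      unfolding lay_comp[OF W(2,1)] lay_lay[OF v] lay_lay[OF u] by (simp add: tobj_tunit)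
    finally show ?thesis unfolding zl lay_idn using idn_comp[OF i] by (simp add: tobj_tunit)
  qed
  have second: "lay b v (tunit C) \<cdot> lay (tunit C) \<iota>' V = \<pi>"
  proof -
    have "lay b v (tunit C) \<cdot> lay (tunit C) \<iota>' V = lay b v (tunit C) \<cdot> (lay (tunit C) \<pi> (V \<otimes> V) \<cdot> lay a u V)"
      unfolding \<iota>'_def lay_comp[OF cup_at pV] lay_lay[OF u] lay_lay[OF p] by (simp add: tunit_tobj)
    also have "\<dots> = (lay b v (tunit C) \<cdot> lay (tunit C) \<pi> (V \<otimes> V)) \<cdot> lay a u V"
      by (rule comp_assoc[OF uV pVV cap_at, symmetric])
    also have "lay b v (tunit C) \<cdot> lay (tunit C) \<pi> (V \<otimes> V) = \<pi> \<cdot> lay (a \<otimes> V) v (tunit C)"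
      using lay_exchange[OF p v, of "tunit C" "tunit C" "tunit C"] lay_tunit[OF p] by (simp add: tunit_tobj tobj_tunit)
    also have "(\<pi> \<cdot> lay (a \<otimes> V) v (tunit C)) \<cdot> lay a u V = \<pi> \<cdot> (lay (a \<otimes> V) v (tunit C) \<cdot> lay a u V)"
      by (rule comp_assoc[OF uV v' p])
    also have "lay (a \<otimes> V) v (tunit C) \<cdot> lay a u V = lay a (lay V v (tunit C) \<cdot> lay (tunit C) u V) (tunit C)"
      unfolding lay_comp[OF W(4,3)] lay_lay[OF v] lay_lay[OF u] by (simp add: tobj_tunit)
    finally show ?thesis unfolding zr lay_idn using comp_idn[OF p] by (simp add: tobj_tunit)
  qed
  have pV': "lay (tunit C) \<pi>' V \<in> Hom C (b \<otimes> (V \<otimes> V)) (a \<otimes> V)" and iV': "lay (tunit C) \<iota>' V \<in> Hom C (a \<otimes> V) (b \<otimes> (V \<otimes> V))"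
    using lay_in_Hom[OF p', of "tunit C" V] lay_in_Hom[OF i', of "tunit C" V] by (simp_all add: tunit_tobj tobj_assoc)
  \<comment> \<open>Closing the last strand unbends both morphisms again, so the trace is
    \<open>\<pi> \<cdot> \<iota>\<close>, the identity.\<close>
  have "partial_trace b (\<iota>' \<cdot> \<pi>') = lay b v (tunit C) \<cdot> (lay (tunit C) \<iota>' V \<cdot> (lay (tunit C) \<pi>' V \<cdot> lay b u (tunit C)))"
    unfolding partial_trace_def lay_comp[OF p' i'] comp_assoc[OF cup_at pV' iV'] ..
  also have "\<dots> = (lay b v (tunit C) \<cdot> lay (tunit C) \<iota>' V) \<cdot> \<iota>"
    unfolding first by (rule comp_assoc[OF i iV' cap_at, symmetric])
  also have "\<dots> = idn C b" unfolding second by (rule pi)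
  finally have tr: "partial_trace b (\<iota>' \<cdot> \<pi>') = idn C b" .
  have "(inverse n \<odot> \<pi>') \<cdot> \<iota>' = idn C a" using comp_smult_left[OF i' p'] pi' assms(2) by simp
  moreover have "partial_trace b (\<iota>' \<cdot> (inverse n \<odot> \<pi>')) = inverse n \<odot> idn C b"
    unfolding comp_smult_right[OF p' i'] partial_trace_smult[OF ip] tr ..
  ultimately show ?thesis unfolding weight_def using i' smult_in_Hom[OF p'] by blast
qed

end

section \<open>Label sets\<close>

definition hook :: diagram where
  "hook = {(0, 0), (0, 1), (1, 0)}"

lemma row_diagram_Suc: "row_diagram (Suc k) = insert (0, k) (row_diagram k)"
  unfolding row_diagram_def by auto

lemma column_diagram_Suc: "column_diagram (Suc k) = insert (k, 0) (column_diagram k)"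
  unfolding column_diagram_def by auto

lemma row_diagram_0: "row_diagram 0 = {}"
  by (simp add: row_diagram_def)

lemma diagrams_2_distinct:
  "row_diagram 2 \<noteq> {}" "column_diagram 2 \<noteq> {}" "row_diagram 2 \<noteq> column_diagram 2"
proof -
  have "(0, 1) \<in> row_diagram 2" "(1, 0) \<in> column_diagram 2" "(0, 1) \<notin> column_diagram 2"
    by (simp_all add: row_diagram_def column_diagram_def)
  then show "row_diagram 2 \<noteq> {}" "column_diagram 2 \<noteq> {}" "row_diagram 2 \<noteq> column_diagram 2" by blast+
qed

lemma column_diagram_1: "column_diagram 1 = row_diagram 1"
  by (auto simp: row_diagram_def column_diagram_def)

lemma young_row: "young (row_diagram k)" and young_column: "young (column_diagram k)"
  and young_hook: "young hook"
  by (auto simp: young_def row_diagram_def column_diagram_def hook_def le_Suc_eq)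

lemma card_row_diagram: "card (row_diagram k) = k" and card_column_diagram: "card (column_diagram k) = k"
  by (simp_all add: row_diagram_def column_diagram_def card_cartesian_product)

lemma finite_label: "D \<in> labels T \<Longrightarrow> finite D" and young_label: "D \<in> labels T \<Longrightarrow> young D"
  by (cases T; auto simp: young_def)+

lemma boxes_mono:
  assumes "finite D" "D' \<subseteq> D"
  shows "boxes_in_rows k D' \<le> boxes_in_rows k D" "boxes_in_columns k D' \<le> boxes_in_columns k D"
  unfolding boxes_in_rows_def boxes_in_columns_def
  using assms by (auto intro!: card_mono elim: finite_subset[rotated])

text \<open>Every label set is cut out by upper bounds on numbers of boxes, and these numbers do not
  grow on passing to a subdiagram.\<close>

lemma labels_subset:
  assumes "D \<in> labels T" "D' \<subseteq> D" "young D'"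
  shows "D' \<in> labels T"
  using boxes_mono[OF finite_label[OF assms(1)] assms(2)] assms le_trans
  by (cases T) (simp, (auto intro: le_trans)+)

lemma row_label_mono: "row_diagram j \<in> labels T \<Longrightarrow> i \<le> j \<Longrightarrow> row_diagram i \<in> labels T"
  and column_label_mono: "column_diagram j \<in> labels T \<Longrightarrow> i \<le> j \<Longrightarrow> column_diagram i \<in> labels T"
  by (erule labels_subset, force simp: row_diagram_def column_diagram_def, simp add: young_row young_column)+

lemma swap_diagrams: "prod.swap ` column_diagram k = row_diagram k" "prod.swap ` row_diagram k = column_diagram k"
  by (auto simp: row_diagram_def column_diagram_def image_iff)

lemma young_swap:
  assumes "young D"
  shows "young (prod.swap ` D)"
proof -
  have "(i, j) \<in> prod.swap ` D \<longleftrightarrow> (j, i) \<in> D" for i j by (force simp: image_iff)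
  then show ?thesis using assms unfolding young_def by blast
qed

lemma young_add_row:
  assumes "young (insert b (row_diagram k))" "b \<notin> row_diagram k" "k > 0"
  shows "b = (0, k) \<or> b = (1, 0)"
proof -
  obtain i j where b: "b = (i, j)" by fastforce
  have y: "(i', j') \<in> insert (i, j) (row_diagram k)" if "i' \<le> i" "j' \<le> j" for i' j'
    using assms(1) that unfolding young_def b by blast
  show ?thesis
  proof (cases "i = 0")
    case True
    then have "k \<le> j" using assms(2) b by (auto simp: row_diagram_def)
    then have "j = k" using y[of 0 k] by (auto simp: row_diagram_def True)
    then show ?thesis using b True by simp
  next
    case False
    then have "(1, 0) \<in> insert (i, j) (row_diagram k)" using y[of 1 0] by simp
    then show ?thesis using b by (auto simp: row_diagram_def)
  qed
qed

lemma young_add_column: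
  assumes "young (insert b (column_diagram k))" "b \<notin> column_diagram k" "k > 0"
  shows "b = (k, 0) \<or> b = (0, 1)"
proof -
  have "young (insert (prod.swap b) (row_diagram k))"
    using young_swap[OF assms(1)] swap_diagrams by simp
  moreover have "prod.swap b \<notin> row_diagram k"
    using assms(2) swap_diagrams(1)[of k] inj_image_mem_iff[OF inj_swap] by metis
  ultimately have "prod.swap b = (0, k) \<or> prod.swap b = (1, 0)" using young_add_row assms(3) by blast
  then show ?thesis by (cases b) auto
qed

lemma young_remove_row:
  assumes "young D" "insert b D = row_diagram (Suc k)" "b \<notin> D"
  shows "D = row_diagram k"
proof -
  have D: "D = row_diagram (Suc k) - {b}" using assms(2,3) by auto
  obtain j where b: "b = (0, j)" "j \<le> k" 
  proof -
    have "b \<in> row_diagram (Suc k)" using assms(2) by blast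
    then show ?thesis using that by (auto simp: row_diagram_def)
  qed
  have "j = k"
  proof (rule ccontr)
    assume "j \<noteq> k"
    then have "(0, k) \<in> D" unfolding D b by (auto simp: row_diagram_def)
    then have "(0, j) \<in> D" using assms(1) b(2) unfolding young_def by blast
    then show False using assms(3) b by simp
  qed
  then show ?thesis unfolding D b by (auto simp: row_diagram_def)
qed

lemma young_remove_column:
  assumes "young D" "insert b D = column_diagram (Suc k)" "b \<notin> D"
  shows "D = column_diagram k"
proof -
  have "insert (prod.swap b) (prod.swap ` D) = row_diagram (Suc k)"
    using assms(2) swap_diagrams(1)[of "Suc k"] by (metis image_insert)
  moreover have "prod.swap b \<notin> prod.swap ` D" using assms(3) inj_image_mem_iff[OF inj_swap] by metis
  ultimately have "prod.swap ` D = row_diagram k" using young_remove_row[OF young_swap[OF assms(1)]] by blast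
  then have "prod.swap ` prod.swap ` D = column_diagram k" using swap_diagrams(2) by simp
  then show ?thesis by (simp add: image_image)
qed

text \<open>The neighbours of \<open>D\<close> in the fusion graph: by \<open>X_fusion\<close> they
  label the summands of \<open>X D \<otimes> V\<close>, each of multiplicity one.\<close>

definition neighbours :: "bcd_type \<Rightarrow> diagram \<Rightarrow> diagram set" where
  "neighbours T D = {D' \<in> labels T. adds_box D D' \<or> adds_box D' D}"

lemma adds_boxI: "b \<notin> D \<Longrightarrow> adds_box D (insert b D)"
  unfolding adds_box_def by blast

lemma neighbours_empty:
  assumes "row_diagram 1 \<in> labels T"
  shows "neighbours T {} = {row_diagram 1}"
proof -
  have "b = (0, 0)" if "young {b}" for b
    using that unfolding young_def by (cases b) blast
  then show ?thesis
    using assms young_label[of _ T] unfolding neighbours_def adds_box_def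
    by (auto simp: row_diagram_def)
qed

lemma neighbours_row:
  assumes "row_diagram k \<in> labels T" "k > 0"
  shows "neighbours T (row_diagram k) =
    insert (row_diagram (k - 1)) ({row_diagram (Suc k), insert (1, 0) (row_diagram k)} \<inter> labels T)"
proof -
  obtain m where k: "k = Suc m" using assms(2) by (cases k) auto
  have m: "row_diagram m \<in> labels T"
    using labels_subset[OF assms(1) _ young_row, of m] by (auto simp: k row_diagram_Suc)
  have A: "adds_box (row_diagram m) (row_diagram k)" "adds_box (row_diagram k) (row_diagram (Suc k))"
    "adds_box (row_diagram k) (insert (1, 0) (row_diagram k))"
    unfolding k row_diagram_Suc by (rule adds_boxI, simp add: row_diagram_def)+
  have B: "D = row_diagram (Suc k) \<or> D = insert (1, 0) (row_diagram k)"
    if D: "D \<in> labels T" "adds_box (row_diagram k) D" for D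
  proof -
    obtain b where b: "b \<notin> row_diagram k" "D = insert b (row_diagram k)" using D(2) unfolding adds_box_def by blast
    then show ?thesis using young_add_row[of b k] young_label[OF D(1)] assms(2) row_diagram_Suc[of k] by metis
  qed
  have R: "D = row_diagram m" if "D \<in> labels T" "adds_box D (row_diagram k)" for D
    using that(2) young_remove_row[OF young_label[OF that(1)], of _ m] unfolding adds_box_def k by metis
  have k1: "k - 1 = m" using k by simp
  show ?thesis
  proof (intro equalityI subsetI)
    fix D assume "D \<in> neighbours T (row_diagram k)"
    then have "D \<in> labels T" "adds_box (row_diagram k) D \<or> adds_box D (row_diagram k)"
      unfolding neighbours_def by simp_all
    then show "D \<in> insert (row_diagram (k - 1)) ({row_diagram (Suc k), insert (1, 0) (row_diagram k)} \<inter> labels T)"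
      using B[of D] R[of D] unfolding k1 by blast
  next
    fix D assume "D \<in> insert (row_diagram (k - 1)) ({row_diagram (Suc k), insert (1, 0) (row_diagram k)} \<inter> labels T)"
    then consider "D = row_diagram m" | "D = row_diagram (Suc k)" "D \<in> labels T"
      | "D = insert (1, 0) (row_diagram k)" "D \<in> labels T" unfolding k1 by blast
    then show "D \<in> neighbours T (row_diagram k)"
      unfolding neighbours_def using A m by cases simp_all
  qed
qed

lemma neighbours_column:
  assumes "column_diagram k \<in> labels T" "k > 0"
  shows "neighbours T (column_diagram k) =
    insert (column_diagram (k - 1)) ({column_diagram (Suc k), insert (0, 1) (column_diagram k)} \<inter> labels T)"
proof -
  obtain m where k: "k = Suc m" using assms(2) by (cases k) auto
  have m: "column_diagram m \<in> labels T"
    using labels_subset[OF assms(1) _ young_column, of m] by (auto simp: k column_diagram_Suc)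
  have A: "adds_box (column_diagram m) (column_diagram k)" "adds_box (column_diagram k) (column_diagram (Suc k))"
    "adds_box (column_diagram k) (insert (0, 1) (column_diagram k))"
    unfolding k column_diagram_Suc by (rule adds_boxI, simp add: column_diagram_def)+
  have B: "D = column_diagram (Suc k) \<or> D = insert (0, 1) (column_diagram k)"
    if D: "D \<in> labels T" "adds_box (column_diagram k) D" for D
  proof -
    obtain b where b: "b \<notin> column_diagram k" "D = insert b (column_diagram k)" using D(2) unfolding adds_box_def by blast
    then show ?thesis using young_add_column[of b k] young_label[OF D(1)] assms(2) column_diagram_Suc[of k] by metis
  qed
  have R: "D = column_diagram m" if "D \<in> labels T" "adds_box D (column_diagram k)" for D
    using that(2) young_remove_column[OF young_label[OF that(1)], of _ m] unfolding adds_box_def k by metis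
  have k1: "k - 1 = m" using k by simp
  show ?thesis
  proof (intro equalityI subsetI)
    fix D assume "D \<in> neighbours T (column_diagram k)"
    then have "D \<in> labels T" "adds_box (column_diagram k) D \<or> adds_box D (column_diagram k)"
      unfolding neighbours_def by simp_all
    then show "D \<in> insert (column_diagram (k - 1)) ({column_diagram (Suc k), insert (0, 1) (column_diagram k)} \<inter> labels T)"
      using B[of D] R[of D] unfolding k1 by blast
  next
    fix D assume "D \<in> insert (column_diagram (k - 1)) ({column_diagram (Suc k), insert (0, 1) (column_diagram k)} \<inter> labels T)"
    then consider "D = column_diagram m" | "D = column_diagram (Suc k)" "D \<in> labels T"
      | "D = insert (0, 1) (column_diagram k)" "D \<in> labels T" unfolding k1 by blast
    then show "D \<in> neighbours T (column_diagram k)"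
      unfolding neighbours_def using A m by cases simp_all
  qed
qed

lemma insert_row_2: "insert (1, 0) (row_diagram 2) = hook"
  and insert_column_2: "insert (0, 1) (column_diagram 2) = hook"
  by (auto simp: hook_def row_diagram_def column_diagram_def)

lemma hook_not_row: "hook \<noteq> row_diagram k"
proof -
  have "(1, 0) \<in> hook" "(1, 0) \<notin> row_diagram k" by (simp_all add: hook_def row_diagram_def)
  then show ?thesis by blast
qed

lemma hook_neighbour:
  assumes "hook \<in> labels T"
  shows "hook \<in> neighbours T (row_diagram 2)" "hook \<in> neighbours T (column_diagram 2)"
proof -
  have "(1, 0) \<notin> row_diagram 2" "(0, 1) \<notin> column_diagram 2"
    by (simp_all add: row_diagram_def column_diagram_def)
  from this[THEN adds_boxI] have "adds_box (row_diagram 2) hook" "adds_box (column_diagram 2) hook"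
    unfolding insert_row_2 insert_column_2 .
  then show "hook \<in> neighbours T (row_diagram 2)" "hook \<in> neighbours T (column_diagram 2)"
    unfolding neighbours_def using assms by simp_all
qed

lemma insert_row_1: "insert (1, 0) (row_diagram 1) = column_diagram 2"
  by (auto simp: row_diagram_def column_diagram_def)

lemma neighbours_row_1:
  assumes "row_diagram 2 \<in> labels T" "column_diagram 2 \<in> labels T"
  shows "neighbours T (row_diagram 1) = {{}, row_diagram 2, column_diagram 2}"
proof -
  have r1: "row_diagram 1 \<in> labels T" using row_label_mono[OF assms(1)] by simp
  have "neighbours T (row_diagram 1) = insert (row_diagram 0) ({row_diagram 2, column_diagram 2} \<inter> labels T)"
    unfolding neighbours_row[OF r1 zero_less_one] insert_row_1 by (simp only: diff_self_eq_0 Suc_1)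
  also have "{row_diagram 2, column_diagram 2} \<inter> labels T = {row_diagram 2, column_diagram 2}"
    using assms by blast
  finally show ?thesis unfolding row_diagram_0 .
qed

text \<open>For \<open>k \<ge> 2\<close> both diagrams contain the hook. For \<open>k = 1\<close>
  they are the two-box diagrams, so [1] is where the graph branches.\<close>

lemma wide_not_label:
  assumes "hook \<notin> labels T" "k \<ge> 2"
  shows "insert (1, 0) (row_diagram k) \<notin> labels T" "insert (0, 1) (column_diagram k) \<notin> labels T"
proof -
  have "hook \<subseteq> insert (1, 0) (row_diagram k)" "hook \<subseteq> insert (0, 1) (column_diagram k)"
    using assms(2) by (auto simp: hook_def row_diagram_def column_diagram_def)
  then show "insert (1, 0) (row_diagram k) \<notin> labels T" "insert (0, 1) (column_diagram k) \<notin> labels T"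
    using assms(1) labels_subset[OF _ _ young_hook, of _ T] by metis+
qed

lemma boxes_row: "boxes_in_rows (Suc i) (row_diagram k) = k"
  and boxes_column: "boxes_in_columns (Suc i) (column_diagram k) = k"
proof -
  have "{(a, b) \<in> row_diagram k. a < Suc i} = row_diagram k" "{(a, b) \<in> column_diagram k. b < Suc i} = column_diagram k"
    by (auto simp: row_diagram_def column_diagram_def)
  then show "boxes_in_rows (Suc i) (row_diagram k) = k" "boxes_in_columns (Suc i) (column_diagram k) = k"
    unfolding boxes_in_rows_def boxes_in_columns_def by (simp_all add: card_row_diagram card_column_diagram)
qed

lemma boxes_hook:
  "boxes_in_rows 1 hook = 2" "boxes_in_rows 2 hook = 3" "boxes_in_columns 1 hook = 2" "boxes_in_columns 2 hook = 3"
proof -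
  have "{(a, b) \<in> hook. a < 1} = {(0, 0), (0, 1)}" "{(a, b) \<in> hook. a < 2} = hook"
    "{(a, b) \<in> hook. b < 1} = {(0, 0), (1, 0)}" "{(a, b) \<in> hook. b < 2} = hook"
    by (auto simp: hook_def)
  then show "boxes_in_rows 1 hook = 2" "boxes_in_rows 2 hook = 3" "boxes_in_columns 1 hook = 2" "boxes_in_columns 2 hook = 3"
    unfolding boxes_in_rows_def boxes_in_columns_def by (simp_all add: hook_def)
qed

text \<open>The two-box diagrams force the bounds to be at least 2, and the hook has three boxes in
  its first two columns and rows but only two in its first column or row. In types Sp and
  O(infinity) it is therefore a label; in O(N) its absence means N = 2. In the remaining fusion
  types a bound on two columns or two rows is below 3, which stops one leg at length two, and the
  other bound stops the other leg.\<close>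

lemma labels_without_hook:
  assumes two: "row_diagram 2 \<in> labels T" "column_diagram 2 \<in> labels T"
    and hook: "hook \<notin> labels T" and T: "T \<noteq> O_type 2"
  shows "(column_diagram 3 \<notin> labels T \<and> (\<exists>k. row_diagram k \<notin> labels T)) \<or>
         (row_diagram 3 \<notin> labels T \<and> (\<exists>k. column_diagram k \<notin> labels T))"
proof -
  note b = boxes_row[of 0] boxes_row[of 1] boxes_column[of 0] boxes_column[of 1] boxes_hook
  note b' = b[unfolded One_nat_def[symmetric] Suc_1]
  show ?thesis
  proof (cases T)
    case O_infinity
    then show ?thesis using hook young_hook by simp
  next
    case (O_type N)
    then show ?thesis using hook young_hook T two b' by auto
  next
    case (Sp_type N)
    then show ?thesis using hook young_hook two b' by auto
  next
    case (O_fusion N M)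
    then have "row_diagram (Suc M) \<notin> labels T" "column_diagram (Suc N) \<notin> labels T" using b' by simp_all
    moreover have "N < 3 \<or> M < 3" using hook young_hook b' O_fusion by auto
    moreover have "column_diagram 3 \<notin> labels T" if "N < 3" using that O_fusion b' by simp
    moreover have "row_diagram 3 \<notin> labels T" if "M < 3" using that O_fusion b' by simp
    ultimately show ?thesis by blast
  next
    case (OSp_fusion N M)
    then have "row_diagram (Suc M) \<notin> labels T" using b' by simp
    moreover have "N < 3" using hook young_hook two b' OSp_fusion by auto
    moreover have "column_diagram 3 \<notin> labels T" using \<open>N < 3\<close> OSp_fusion b' by simp
    ultimately show ?thesis by blast
  next
    case (Sp_fusion N M)
    then show ?thesis using hook young_hook two b' by auto
  qed
qed

section \<open>Fusion with the vector object\<close>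

context bcd_category
begin

abbreviation "V \<equiv> X (row_diagram 1)"

lemma row_1_label: "row_diagram 1 \<in> labels T" and empty_label: "{} \<in> labels T"
  using row_label_mono[OF two_boxes(1), of 1] row_label_mono[OF two_boxes(1), of 0]
  by (simp_all add: row_diagram_0)

lemma hom_distinct:
  assumes "D \<in> labels T" "D' \<in> labels T" "D \<noteq> D'" "f \<in> Hom C (X D) (X D')"
  shows "f = 0"
  using schur[OF X_simple X_simple, of D D'] X_distinct[of D D'] assms by blast

lemma hom_scalar:
  assumes "D \<in> labels T" "f \<in> Hom C (X D) (X D)"
  obtains z where "f = z \<odot> idn C (X D)"
  using simple_scalar[OF X_simple[OF assms(1)] assms(2)] by blast

text \<open>A direct sum decomposition with its inclusions and projections named, because splittings
  are compared with each other and with the eigenspaces of \<open>t\<close>.\<close>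

definition is_sum :: "diagram set \<Rightarrow> 'o \<Rightarrow> (diagram \<Rightarrow> 'm) \<Rightarrow> (diagram \<Rightarrow> 'm) \<Rightarrow> bool" where
  "is_sum I s \<iota> \<pi> \<longleftrightarrow> finite I \<and> I \<subseteq> labels T \<and>
     (\<forall>i\<in>I. \<iota> i \<in> Hom C (X i) s \<and> \<pi> i \<in> Hom C s (X i)) \<and>
     (\<forall>i\<in>I. \<forall>j\<in>I. \<pi> i \<cdot> \<iota> j = (if i = j then idn C (X i) else 0)) \<and>
     (\<Sum>i\<in>I. \<iota> i \<cdot> \<pi> i) = idn C s"

lemma
  assumes "is_sum I s \<iota> \<pi>"
  shows is_sum_finite: "finite I"
    and is_sum_label: "D \<in> I \<Longrightarrow> D \<in> labels T"
    and is_sum_inclusion: "D \<in> I \<Longrightarrow> \<iota> D \<in> Hom C (X D) s"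
    and is_sum_projection: "D \<in> I \<Longrightarrow> \<pi> D \<in> Hom C s (X D)"
    and is_sum_orthogonal: "D \<in> I \<Longrightarrow> D' \<in> I \<Longrightarrow> \<pi> D \<cdot> \<iota> D' = (if D = D' then idn C (X D) else 0)"
    and is_sum_complete: "(\<Sum>i\<in>I. \<iota> i \<cdot> \<pi> i) = idn C s"
  using assms unfolding is_sum_def by blast+

lemma fusion:
  assumes "D \<in> labels T"
  obtains \<iota> \<pi> where "is_sum (neighbours T D) (X D \<otimes> V) \<iota> \<pi>"
proof -
  have "neighbours T D \<subseteq> labels T" unfolding neighbours_def by blast
  then show ?thesis
    using that X_fusion[OF assms] unfolding is_sum_def is_direct_sum_def neighbours_def[symmetric] by blast
qed

context
  fixes I :: "diagram set" and s :: 'o and \<iota> \<pi> :: "diagram \<Rightarrow> 'm"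
  assumes dec: "is_sum I s \<iota> \<pi>"
begin

private lemmas fin = is_sum_finite[OF dec] and lab = is_sum_label[OF dec] and i = is_sum_inclusion[OF dec]
  and p = is_sum_projection[OF dec] and orth = is_sum_orthogonal[OF dec] and sum = is_sum_complete[OF dec]

lemma hom_into_sum:
  assumes D: "D \<in> I" and f: "f \<in> Hom C (X D) s"
  obtains z where "f = z \<odot> \<iota> D"
proof -
  have "f = (\<Sum>i\<in>I. \<iota> i \<cdot> \<pi> i) \<cdot> f" unfolding sum by (rule idn_comp[OF f, symmetric])
  also have "\<dots> = (\<Sum>i\<in>I. (\<iota> i \<cdot> \<pi> i) \<cdot> f)"
    by (rule comp_sum_left[OF fin f]) (rule comp_in_Hom[OF p i])
  also have "\<dots> = (\<Sum>i\<in>I. if i = D then \<iota> i \<cdot> (\<pi> i \<cdot> f) else 0)"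
  proof (rule sum.cong[OF refl])
    fix j assume j: "j \<in> I"
    have "\<pi> j \<cdot> f = 0" if "j \<noteq> D"
      using hom_distinct[OF lab[OF D] lab[OF j] _ comp_in_Hom[OF f p[OF j]]] that by simp
    then show "(\<iota> j \<cdot> \<pi> j) \<cdot> f = (if j = D then \<iota> j \<cdot> (\<pi> j \<cdot> f) else 0)"
      using comp_assoc[OF f p[OF j] i[OF j]] comp_zero_right[OF i[OF j]] by simp
  qed
  also have "\<dots> = \<iota> D \<cdot> (\<pi> D \<cdot> f)" using fin D by simp
  finally have *: "f = \<iota> D \<cdot> (\<pi> D \<cdot> f)" .
  obtain z where "\<pi> D \<cdot> f = z \<odot> idn C (X D)"
    using hom_scalar[OF lab[OF D] comp_in_Hom[OF f p[OF D]]] by blast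
  then have "f = z \<odot> \<iota> D" using * comp_smult_right[OF idn_in_Hom i[OF D]] comp_idn[OF i[OF D]] by simp
  then show ?thesis by (rule that)
qed

lemma hom_from_sum:
  assumes D: "D \<in> I" and g: "g \<in> Hom C s (X D)"
  obtains z where "g = z \<odot> \<pi> D"
proof -
  have "g = g \<cdot> (\<Sum>i\<in>I. \<iota> i \<cdot> \<pi> i)" unfolding sum by (rule comp_idn[OF g, symmetric])
  also have "\<dots> = (\<Sum>i\<in>I. g \<cdot> (\<iota> i \<cdot> \<pi> i))"
    by (rule comp_sum_right[OF fin g]) (rule comp_in_Hom[OF p i])
  also have "\<dots> = (\<Sum>i\<in>I. if i = D then (g \<cdot> \<iota> i) \<cdot> \<pi> i else 0)"
  proof (rule sum.cong[OF refl])
    fix j assume j: "j \<in> I"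
    have "g \<cdot> \<iota> j = 0" if "j \<noteq> D"
      using hom_distinct[OF lab[OF j] lab[OF D] that comp_in_Hom[OF i[OF j] g]] .
    then show "g \<cdot> (\<iota> j \<cdot> \<pi> j) = (if j = D then (g \<cdot> \<iota> j) \<cdot> \<pi> j else 0)"
      using comp_assoc[OF p[OF j] i[OF j] g] comp_zero_left[OF p[OF j]] by (cases "j = D") simp_all
  qed
  also have "\<dots> = (g \<cdot> \<iota> D) \<cdot> \<pi> D" using fin D by simp
  finally have *: "g = (g \<cdot> \<iota> D) \<cdot> \<pi> D" .
  obtain z where "g \<cdot> \<iota> D = z \<odot> idn C (X D)"
    using hom_scalar[OF lab[OF D] comp_in_Hom[OF i[OF D] g]] by blast
  then have "g = z \<odot> \<pi> D" using * comp_smult_left[OF p[OF D] idn_in_Hom] idn_comp[OF p[OF D]] by simp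
  then show ?thesis by (rule that)
qed

text \<open>Each label occurs once, so \<open>f\<close> and \<open>g\<close> are multiples of the
  given inclusion and projection, and the two factors are inverse to each other.\<close>

lemma projection_eq:
  assumes D: "D \<in> I" and f: "f \<in> Hom C (X D) s" and g: "g \<in> Hom C s (X D)" and gf: "g \<cdot> f = idn C (X D)"
  shows "f \<cdot> g = \<iota> D \<cdot> \<pi> D"
proof -
  obtain x where x: "f = x \<odot> \<iota> D" using hom_into_sum[OF D f] .
  obtain y where y: "g = y \<odot> \<pi> D" using hom_from_sum[OF D g] .
  have "g \<cdot> f = (x * y) \<odot> idn C (X D)"
    unfolding x y comp_smult_left[OF smult_in_Hom[OF i[OF D]] p[OF D]] comp_smult_right[OF i[OF D] p[OF D]]
    using orth[OF D D] by (simp add: mult.commute)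
  then have "x * y = 1" using gf simple_scalar_eq[OF X_simple[OF lab[OF D]], of "x * y" 1] by simp
  then show ?thesis
    unfolding x y comp_smult_left[OF smult_in_Hom[OF p[OF D]] i[OF D]] comp_smult_right[OF p[OF D] i[OF D]]
    by simp
qed

text \<open>An eigenvector with arbitrary source has some nonzero component, and comparing that
  component before and after \<open>t\<close> identifies the eigenvalue.\<close>

lemma eigenvalues_of_sum:
  assumes t: "t \<in> Hom C s s" and act: "\<And>i. i \<in> I \<Longrightarrow> t \<cdot> \<iota> i = c i \<odot> \<iota> i"
  shows "eigenvalues C s t = c ` I"
proof (intro equalityI subsetI)
  fix z assume "z \<in> c ` I"
  then obtain j where j: "j \<in> I" "z = c j" by blast
  have "\<iota> j \<noteq> 0"
    using orth[OF j(1) j(1)] X_simple[OF lab[OF j(1)]] comp_zero_right[OF p[OF j(1)]]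
    unfolding simple_obj_def by auto
  then show "z \<in> eigenvalues C s t"
    unfolding eigenvalues_def using i[OF j(1)] act[OF j(1)] j(2) by blast
next
  fix z assume "z \<in> eigenvalues C s t"
  then obtain y f where f: "f \<in> Hom C y s" "f \<noteq> 0" "t \<cdot> f = z \<odot> f" unfolding eigenvalues_def by blast
  have f_sum: "f = (\<Sum>i\<in>I. \<iota> i \<cdot> (\<pi> i \<cdot> f))"
  proof -
    have "f = (\<Sum>i\<in>I. \<iota> i \<cdot> \<pi> i) \<cdot> f" unfolding sum by (rule idn_comp[OF f(1), symmetric])
    also have "\<dots> = (\<Sum>i\<in>I. (\<iota> i \<cdot> \<pi> i) \<cdot> f)"
      by (rule comp_sum_left[OF fin f(1)]) (rule comp_in_Hom[OF p i])
    also have "\<dots> = (\<Sum>i\<in>I. \<iota> i \<cdot> (\<pi> i \<cdot> f))"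
      by (rule sum.cong[OF refl]) (rule comp_assoc[OF f(1) p i])
    finally show ?thesis .
  qed
  have t_sum: "t \<cdot> f = (\<Sum>i\<in>I. c i \<odot> (\<iota> i \<cdot> (\<pi> i \<cdot> f)))"
  proof -
    have "t \<cdot> f = t \<cdot> (\<Sum>i\<in>I. \<iota> i \<cdot> (\<pi> i \<cdot> f))" using f_sum by simp
    also have "\<dots> = (\<Sum>i\<in>I. t \<cdot> (\<iota> i \<cdot> (\<pi> i \<cdot> f)))"
      by (rule comp_sum_right[OF fin t]) (rule comp_in_Hom[OF comp_in_Hom[OF f(1) p] i])
    also have "\<dots> = (\<Sum>i\<in>I. c i \<odot> (\<iota> i \<cdot> (\<pi> i \<cdot> f)))"
    proof (rule sum.cong[OF refl])
      fix j assume j: "j \<in> I"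
      show "t \<cdot> (\<iota> j \<cdot> (\<pi> j \<cdot> f)) = c j \<odot> (\<iota> j \<cdot> (\<pi> j \<cdot> f))"
        using comp_assoc[OF comp_in_Hom[OF f(1) p[OF j]] i[OF j] t] act[OF j]
          comp_smult_left[OF comp_in_Hom[OF f(1) p[OF j]] i[OF j]] by simp
    qed
    finally show ?thesis .
  qed
  obtain j where j: "j \<in> I" "\<pi> j \<cdot> f \<noteq> 0"
  proof (rule ccontr)
    assume "\<not> thesis"
    then have "\<And>j. j \<in> I \<Longrightarrow> \<pi> j \<cdot> f = 0" using that by blast
    then have "f = 0" using f_sum comp_zero_right[OF i] by simp
    then show False using f(2) by simp
  qed
  have proj: "\<pi> j \<cdot> (\<Sum>i\<in>I. c' i \<odot> (\<iota> i \<cdot> (\<pi> i \<cdot> f))) = c' j \<odot> (\<pi> j \<cdot> f)" for c'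
  proof -
    have "\<pi> j \<cdot> (\<Sum>i\<in>I. c' i \<odot> (\<iota> i \<cdot> (\<pi> i \<cdot> f))) = (\<Sum>i\<in>I. \<pi> j \<cdot> (c' i \<odot> (\<iota> i \<cdot> (\<pi> i \<cdot> f))))"
      by (rule comp_sum_right[OF fin p[OF j(1)]]) (rule smult_in_Hom[OF comp_in_Hom[OF comp_in_Hom[OF f(1) p] i]])
    also have "\<dots> = (\<Sum>i\<in>I. if i = j then c' i \<odot> (\<pi> i \<cdot> f) else 0)"
    proof (rule sum.cong[OF refl])
      fix k assume k: "k \<in> I"
      note pf = comp_in_Hom[OF f(1) p[OF k]]
      show "\<pi> j \<cdot> (c' k \<odot> (\<iota> k \<cdot> (\<pi> k \<cdot> f))) = (if k = j then c' k \<odot> (\<pi> k \<cdot> f) else 0)"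
        using comp_smult_right[OF comp_in_Hom[OF pf i[OF k]] p[OF j(1)]] comp_assoc[OF pf i[OF k] p[OF j(1)]]
          orth[OF j(1) k] idn_comp[OF pf] comp_zero_left[OF pf] by (cases "k = j") simp_all
    qed
    also have "\<dots> = c' j \<odot> (\<pi> j \<cdot> f)" using fin j(1) by simp
    finally show ?thesis .
  qed
  have "\<pi> j \<cdot> (t \<cdot> f) = c j \<odot> (\<pi> j \<cdot> f)" unfolding t_sum by (rule proj)
  moreover have "\<pi> j \<cdot> (t \<cdot> f) = z \<odot> (\<pi> j \<cdot> f)" unfolding f(3) by (rule comp_smult_right[OF f(1) p[OF j(1)]])
  ultimately have "z = c j" using j(2) by simp
  then show "z \<in> c ` I" using j(1) by blast
qed

end

lemma projection_unique:
  assumes D: "D \<in> labels T" and D': "D' \<in> neighbours T D"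
    and f: "f \<in> Hom C (X D') (X D \<otimes> V)" and g: "g \<in> Hom C (X D \<otimes> V) (X D')"
    and f': "f' \<in> Hom C (X D') (X D \<otimes> V)" and g': "g' \<in> Hom C (X D \<otimes> V) (X D')"
    and gf: "g \<cdot> f = idn C (X D')" and gf': "g' \<cdot> f' = idn C (X D')"
  shows "f \<cdot> g = f' \<cdot> g'"
proof -
  obtain \<iota> \<pi> where "is_sum (neighbours T D) (X D \<otimes> V) \<iota> \<pi>" using fusion[OF D] .
  note eq = projection_eq[OF this D']
  show ?thesis using eq[OF f g gf] eq[OF f' g' gf'] by simp
qed

text \<open>The hook is a summand of \<open>X D \<otimes> V\<close>, which sits in
  \<open>V \<otimes> V \<otimes> V\<close> through \<open>\<iota>\<close>. Whatever acts on the
  first two strands therefore acts through its composite with \<open>\<iota>\<close>.\<close>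

lemma hook_embedding:
  assumes "hook \<in> labels T" "D \<in> labels T" "hook \<in> neighbours T D"
    and \<iota>: "\<iota> \<in> Hom C (X D) (V \<otimes> V)" and \<pi>: "\<pi> \<in> Hom C (V \<otimes> V) (X D)" and \<pi>\<iota>: "\<pi> \<cdot> \<iota> = idn C (X D)"
  obtains h where "h \<in> Hom C (X hook) (V \<otimes> (V \<otimes> V))" "h \<noteq> 0"
    and "\<And>f b. f \<in> Hom C (V \<otimes> V) b \<Longrightarrow> f \<cdot> \<iota> = 0 \<Longrightarrow> lay (tunit C) f V \<cdot> h = 0"
    and "\<And>f. f \<in> Hom C (V \<otimes> V) (V \<otimes> V) \<Longrightarrow> f \<cdot> \<iota> = \<iota> \<Longrightarrow> lay (tunit C) f V \<cdot> h = h"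
proof -
  obtain j k where j: "j \<in> Hom C (X hook) (X D \<otimes> V)" and k: "k \<in> Hom C (X D \<otimes> V) (X hook)"
    and kj: "k \<cdot> j = idn C (X hook)"
  proof -
    obtain \<iota>' \<pi>' where dec: "is_sum (neighbours T D) (X D \<otimes> V) \<iota>' \<pi>'" using fusion[OF assms(2)] .
    show ?thesis
      using that[OF is_sum_inclusion[OF dec assms(3)] is_sum_projection[OF dec assms(3)]]
        is_sum_orthogonal[OF dec assms(3,3)] by simp
  qed
  have j0: "j \<noteq> 0" using kj X_simple[OF assms(1)] comp_zero_right[OF k] unfolding simple_obj_def by auto
  have l: "lay (tunit C) f V \<in> Hom C (a \<otimes> V) (b \<otimes> V)" if "f \<in> Hom C a b" for f a b
    using lay_in_Hom[OF that, of "tunit C" V] by (simp add: tunit_tobj)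
  define h where "h = lay (tunit C) \<iota> V \<cdot> j"
  have fh: "lay (tunit C) f V \<cdot> h = lay (tunit C) (f \<cdot> \<iota>) V \<cdot> j" if "f \<in> Hom C (V \<otimes> V) b" for f b
    unfolding h_def lay_comp[OF \<iota> that] by (rule comp_assoc[OF j l[OF \<iota>] l[OF that], symmetric])
  have "lay (tunit C) \<pi> V \<cdot> h = j"
    unfolding fh[OF \<pi>] \<pi>\<iota> lay_idn using idn_comp[OF j] by (simp add: tunit_tobj)
  then have "h \<noteq> 0" using j0 comp_zero_right[OF l[OF \<pi>]] by auto
  moreover have "h \<in> Hom C (X hook) (V \<otimes> (V \<otimes> V))"
    unfolding h_def using comp_in_Hom[OF j l[OF \<iota>]] by (simp add: tobj_assoc)
  moreover have "lay (tunit C) f V \<cdot> h = 0" if "f \<in> Hom C (V \<otimes> V) b" "f \<cdot> \<iota> = 0" for f b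
    unfolding fh[OF that(1)] that(2) lay_zero by (rule comp_zero_left[OF j])
  moreover have "lay (tunit C) f V \<cdot> h = h" if "f \<in> Hom C (V \<otimes> V) (V \<otimes> V)" "f \<cdot> \<iota> = \<iota>" for f
    unfolding fh[OF that(1)] that(2) by (simp add: h_def)
  ultimately show ?thesis using that by blast
qed

end

section \<open>Weights on the fusion graph\<close>

locale bcd_self_dual = bcd_category C T X + self_dual_object C "X (row_diagram 1)" u v
  for C :: "('o, 'm::ab_group_add) tensor_cat" (structure) and T :: bcd_type and X :: "diagram \<Rightarrow> 'o"
    and u v :: 'm
begin

lemma weight_unique:
  assumes D: "D \<in> labels T" and D': "D' \<in> neighbours T D"
    and n: "weight (X D) (X D') n" and m: "weight (X D) (X D') m"
  shows "n = m"
proof -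
  have "n \<odot> idn C (X D) = m \<odot> idn C (X D)"
    using n m projection_unique[OF D D'] unfolding weight_def by metis
  then show ?thesis unfolding simple_scalar_eq[OF X_simple[OF D]] .
qed

text \<open>The partial trace of the identity is the loop value, and it is additive over the
  summands of \<open>X D \<otimes> V\<close>.\<close>

lemma weight_sum:
  assumes D: "D \<in> labels T" and vu: "v \<cdot> u = \<delta> \<odot> idn C (tunit C)"
  obtains N where "\<And>D'. D' \<in> neighbours T D \<Longrightarrow> weight (X D) (X D') (N D')" "sum N (neighbours T D) = \<delta>"
proof -
  obtain \<iota> \<pi> where dec: "is_sum (neighbours T D) (X D \<otimes> V) \<iota> \<pi>" using fusion[OF D] .
  note fin = is_sum_finite[OF dec] and i = is_sum_inclusion[OF dec] and p = is_sum_projection[OF dec]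
    and orth = is_sum_orthogonal[OF dec] and sum = is_sum_complete[OF dec]
  have "\<exists>n. partial_trace (X D) (\<iota> i \<cdot> \<pi> i) = n \<odot> idn C (X D)" if "i \<in> neighbours T D" for i
    using hom_scalar[OF D partial_trace_in_Hom[OF comp_in_Hom[OF p[OF that] i[OF that]]]] by blast
  then obtain N where N: "\<And>i. i \<in> neighbours T D \<Longrightarrow> partial_trace (X D) (\<iota> i \<cdot> \<pi> i) = N i \<odot> idn C (X D)"
    by metis
  have "\<delta> \<odot> idn C (X D) = partial_trace (X D) (\<Sum>i\<in>neighbours T D. \<iota> i \<cdot> \<pi> i)"
    unfolding sum by (rule partial_trace_idn[OF vu, symmetric])
  also have "\<dots> = (\<Sum>i\<in>neighbours T D. partial_trace (X D) (\<iota> i \<cdot> \<pi> i))"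
    by (rule partial_trace_sum[OF fin]) (rule comp_in_Hom[OF p i])
  also have "\<dots> = (\<Sum>i\<in>neighbours T D. N i \<odot> idn C (X D))" by (rule sum.cong[OF refl]) (rule N)
  also have "\<dots> = sum N (neighbours T D) \<odot> idn C (X D)" by (rule scale_sum_left[symmetric])
  finally have "sum N (neighbours T D) = \<delta>" unfolding simple_scalar_eq[OF X_simple[OF D]] by simp
  moreover have "weight (X D) (X D') (N D')" if "D' \<in> neighbours T D" for D'
    unfolding weight_def using i[OF that] p[OF that] orth[OF that that] N[OF that] by auto
  ultimately show ?thesis using that by blast
qed

text \<open>The fusion graph of \<open>V\<close> is the Dynkin diagram \<open>D\<^sub>n\<close> with the unit at a short leg. Starting with the
  short legs, the weights along the long leg are all \<open>\<epsilon>\<close>; at its end the weight must be \<open>2 \<epsilon>\<close>.\<close>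

lemma no_finite_chain:
  assumes vu: "v \<cdot> u = (2 * \<epsilon>) \<odot> idn C (tunit C)" and \<epsilon>: "\<epsilon> * \<epsilon> = 1"
    and Z: "\<And>k. 1 \<le> k \<Longrightarrow> k \<le> M \<Longrightarrow> Z k \<in> labels T" and Y: "Y \<in> labels T" and M: "2 \<le> M"
    and Z1: "Z 1 = row_diagram 1" and N1: "neighbours T (Z 1) = {{}, Y, Z 2}"
    and dist: "Y \<noteq> {}" "Z 2 \<noteq> {}" "Y \<noteq> Z 2" and NY: "neighbours T Y = {Z 1}"
    and NZ: "\<And>k. 2 \<le> k \<Longrightarrow> k < M \<Longrightarrow> neighbours T (Z k) = {Z (k - 1), Z (Suc k)} \<and> Z (k - 1) \<noteq> Z (Suc k)"
    and NM: "neighbours T (Z M) = {Z (M - 1)}"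
  shows False
proof -
  have \<epsilon>0: "\<epsilon> \<noteq> 0" using \<epsilon> by (metis mult_zero_left zero_neq_one)
  have inv: "inverse \<epsilon> = \<epsilon>" using \<epsilon> by (metis inverse_unique)
  have inv2: "inverse (2 * \<epsilon>) = \<epsilon> / 2" using inv by (simp add: field_simps)
  have 1: "Z 1 \<in> labels T" using Z M by simp
  have N0: "neighbours T {} = {Z 1}" using neighbours_empty[OF row_1_label] Z1 by simp
  \<comment> \<open>A label with a single neighbour passes the whole loop value to it.\<close>
  have leg: "weight (X D) (X (Z 1)) (2 * \<epsilon>)" if D: "D \<in> labels T" "neighbours T D = {Z 1}" for D
    using weight_sum[OF D(1) vu] D(2) by auto
  have step: "weight (X (Z (Suc k))) (X (Z k)) \<epsilon>" if "1 \<le> k" "k < M" for k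
    using that
  proof (induction k rule: dec_induct)
    case base
    obtain N where N: "\<And>D. D \<in> {{}, Y, Z 2} \<Longrightarrow> weight (X (Z 1)) (X D) (N D)" "sum N {{}, Y, Z 2} = 2 * \<epsilon>"
      using weight_sum[OF 1 vu] N1 by metis
    \<comment> \<open>As \<epsilon>\<epsilon> = 1, the inverse of 2\<epsilon> is \<epsilon>/2. The
      two short legs thus use up \<epsilon> of the total 2\<epsilon> at the branch point, and
      \<epsilon> is left for \<open>Z 2\<close>.\<close>
    have "weight (X (Z 1)) (X {}) (\<epsilon> / 2)" "weight (X (Z 1)) (X Y) (\<epsilon> / 2)"
      using weight_inverse[OF leg[OF empty_label N0]] weight_inverse[OF leg[OF Y NY]] \<epsilon>0 inv2 by simp_all
    then have "N {} = \<epsilon> / 2" "N Y = \<epsilon> / 2"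
      using weight_unique[OF 1 _ N(1)] N1 by auto
    moreover have "N {} + (N Y + N (Z 2)) = \<epsilon> + \<epsilon>" using N(2) dist by simp
    ultimately have "(\<epsilon> / 2 + \<epsilon> / 2) + N (Z 2) = \<epsilon> + \<epsilon>" by (simp only: add.assoc)
    then have "N (Z 2) = \<epsilon>" by simp
    then have "weight (X (Z 1)) (X (Z 2)) \<epsilon>" using N(1)[of "Z 2"] by simp
    then show ?case using weight_inverse[of _ _ \<epsilon>] \<epsilon>0 inv by (metis One_nat_def Suc_1)
  next
    case (step k)
    then have k: "2 \<le> Suc k" "Suc k < M" by simp_all
    have L: "Z (Suc k) \<in> labels T" using Z k by simp
    have nb: "neighbours T (Z (Suc k)) = {Z k, Z (Suc (Suc k))}" "Z k \<noteq> Z (Suc (Suc k))" using NZ[OF k] by simp_all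
    obtain N where N: "\<And>D. D \<in> {Z k, Z (Suc (Suc k))} \<Longrightarrow> weight (X (Z (Suc k))) (X D) (N D)"
      "sum N {Z k, Z (Suc (Suc k))} = 2 * \<epsilon>"
      using weight_sum[OF L vu] nb(1) by metis
    have "weight (X (Z (Suc k))) (X (Z k)) \<epsilon>" using step by simp
    then have "N (Z k) = \<epsilon>" using weight_unique[OF L _ N(1)] nb by auto
    then have "N (Z (Suc (Suc k))) = \<epsilon>" using N(2) nb(2) by simp
    then have "weight (X (Z (Suc k))) (X (Z (Suc (Suc k)))) \<epsilon>" using N(1)[of "Z (Suc (Suc k))"] by simp
    then show ?case using weight_inverse[of _ _ \<epsilon>] \<epsilon>0 inv by metis
  qed
  obtain m where m: "M = Suc m" "1 \<le> m" using M by (cases M) auto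
  have L: "Z M \<in> labels T" using Z M by simp
  obtain N where N: "\<And>D. D \<in> {Z m} \<Longrightarrow> weight (X (Z M)) (X D) (N D)" "sum N {Z m} = 2 * \<epsilon>"
    using weight_sum[OF L vu] NM m(1) by (metis diff_Suc_1)
  \<comment> \<open>At the last label the weight carried along the chain is \<epsilon>, while the
    sum over its only neighbour is 2\<epsilon>.\<close>
  have "weight (X (Z M)) (X (Z m)) \<epsilon>" using step[of m] m by simp
  then have "N (Z m) = \<epsilon>" using weight_unique[OF L _ N(1)] NM m(1) by auto
  then show False using N(2) \<epsilon>0 by simp
qed

text \<open>Without the hook, rows and columns form the two legs beyond [1]. The one that stops at
  two boxes becomes the short leg \<open>Y\<close> of \<open>no_finite_chain\<close>, and the other,
  also finite, becomes the chain \<open>Z\<close>.\<close>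

lemma hook_label:
  assumes vu: "v \<cdot> u = (2 * \<epsilon>) \<odot> idn C (tunit C)" and \<epsilon>: "\<epsilon> * \<epsilon> = 1" and T: "T \<noteq> O_type 2"
  shows "hook \<in> labels T"
proof (rule ccontr)
  assume hook: "hook \<notin> labels T"
  have bound: "\<exists>M\<ge>2. (\<forall>k\<le>M. Z k \<in> labels T) \<and> Z (Suc M) \<notin> labels T"
    if Z2: "Z 2 \<in> labels T" and k: "Z k \<notin> labels T"
      and mono: "\<And>i j. Z j \<in> labels T \<Longrightarrow> i \<le> j \<Longrightarrow> Z i \<in> labels T" for Z :: "nat \<Rightarrow> diagram" and k
  proof -
    define m where "m = (LEAST k. Z k \<notin> labels T)"
    have m: "Z m \<notin> labels T" unfolding m_def using k by (rule LeastI)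
    have lt: "Z i \<in> labels T" if "i < m" for i using not_less_Least[of i "\<lambda>k. Z k \<notin> labels T"] that m_def by auto
    have "2 < m" using mono[of 2 m] Z2 m by (meson not_le)
    then have "2 \<le> m - 1" "Suc (m - 1) = m" by simp_all
    then show ?thesis using m lt by (intro exI[of _ "m - 1"]) auto
  qed
  have inj: "row_diagram i = row_diagram j \<longleftrightarrow> i = j" "column_diagram i = column_diagram j \<longleftrightarrow> i = j" for i j
    using card_row_diagram card_column_diagram by metis+
  have rc: "column_diagram 2 \<noteq> row_diagram 2" "row_diagram 2 \<noteq> {}" "column_diagram 2 \<noteq> {}"
    using diagrams_2_distinct by simp_all
  have n1: "neighbours T (row_diagram 1) = {{}, column_diagram 2, row_diagram 2}"
    using neighbours_row_1[OF two_boxes] by (simp add: insert_commute)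
  have nrow: "neighbours T (row_diagram k) = insert (row_diagram (k - 1)) ({row_diagram (Suc k)} \<inter> labels T)"
    if "row_diagram k \<in> labels T" "2 \<le> k" for k
  proof -
    have "{row_diagram (Suc k), insert (1, 0) (row_diagram k)} \<inter> labels T = {row_diagram (Suc k)} \<inter> labels T"
      using wide_not_label(1)[OF hook that(2)] by blast
    then show ?thesis using neighbours_row[OF that(1)] that(2) by simp
  qed
  have ncol: "neighbours T (column_diagram k) = insert (column_diagram (k - 1)) ({column_diagram (Suc k)} \<inter> labels T)"
    if "column_diagram k \<in> labels T" "2 \<le> k" for k
  proof -
    have "{column_diagram (Suc k), insert (0, 1) (column_diagram k)} \<inter> labels T = {column_diagram (Suc k)} \<inter> labels T"
      using wide_not_label(2)[OF hook that(2)] by blast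
    then show ?thesis using neighbours_column[OF that(1)] that(2) by simp
  qed
  show False
    using labels_without_hook[OF two_boxes hook T]
  proof (elim disjE conjE exE)
    fix k assume c3: "column_diagram 3 \<notin> labels T" and k: "row_diagram k \<notin> labels T"
    obtain M where M: "M \<ge> 2" "\<And>k. k \<le> M \<Longrightarrow> row_diagram k \<in> labels T" "row_diagram (Suc M) \<notin> labels T"
      using bound[of row_diagram, OF two_boxes(1) k] row_label_mono[of _ T] by blast
    show False
    proof (rule no_finite_chain[OF vu \<epsilon> _ two_boxes(2) M(1), of row_diagram])
      show "neighbours T (column_diagram 2) = {row_diagram 1}"
        using ncol[OF two_boxes(2)] c3 column_diagram_1 by (simp add: numeral_3_eq_3 numeral_2_eq_2)
      show "neighbours T (row_diagram k) = {row_diagram (k - 1), row_diagram (Suc k)} \<and>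
        row_diagram (k - 1) \<noteq> row_diagram (Suc k)" if "2 \<le> k" "k < M" for k
        using nrow[of k] M(2)[of k] M(2)[of "Suc k"] that inj by simp
      show "neighbours T (row_diagram M) = {row_diagram (M - 1)}" using nrow[of M] M by simp
    qed (use M(2) n1 rc in auto)
  next
    fix k assume r3: "row_diagram 3 \<notin> labels T" and k: "column_diagram k \<notin> labels T"
    obtain M where M: "M \<ge> 2" "\<And>k. k \<le> M \<Longrightarrow> column_diagram k \<in> labels T" "column_diagram (Suc M) \<notin> labels T"
      using bound[of column_diagram, OF two_boxes(2) k] column_label_mono[of _ T] by blast
    show False
    proof (rule no_finite_chain[OF vu \<epsilon> _ two_boxes(1) M(1), of column_diagram])
      show "neighbours T (row_diagram 2) = {column_diagram 1}"
        using nrow[OF two_boxes(1)] r3 column_diagram_1 by (simp add: numeral_3_eq_3 numeral_2_eq_2)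
      show "neighbours T (column_diagram k) = {column_diagram (k - 1), column_diagram (Suc k)} \<and>
        column_diagram (k - 1) \<noteq> column_diagram (Suc k)" if "2 \<le> k" "k < M" for k
        using ncol[of k] M(2)[of k] M(2)[of "Suc k"] that inj by simp
      show "neighbours T (column_diagram M) = {column_diagram (M - 1)}" using ncol[of M] M by simp
      show "neighbours T (column_diagram 1) = {{}, row_diagram 2, column_diagram 2}"
        using n1 column_diagram_1 by auto
      show "column_diagram 1 = row_diagram 1" by (rule column_diagram_1)
    qed (use M(2) rc in auto)
  qed
qed

end

section \<open>The eigenvalues\<close>

context bcd_category
begin

lemma braiding_eigenvalues:
  assumes q0: "q \<noteq> 0" and \<gamma>: "\<gamma> ^ 4 = 1"
    and t_def: "t = \<gamma> \<odot> braid C V V"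
    and a2: "acts_by C (V \<otimes> V) t (X (row_diagram 2)) q"
    and a11: "acts_by C (V \<otimes> V) t (X (column_diagram 2)) (- inverse q)"
    and a0: "acts_by C (V \<otimes> V) t (tunit C) (inverse r)"
    and T: "T = O_type 2 \<Longrightarrow> q \<noteq> - inverse q"
  shows "eigenvalues C (V \<otimes> V) t = {q, - inverse q, inverse r}"
    and "card {q, - inverse q, inverse r} < 3 \<Longrightarrow> {q, - inverse q, inverse r} = {1, -1}"
proof -
  define R where "R = row_diagram 2"
  define S where "S = column_diagram 2"
  have R: "R \<in> labels T" and S: "S \<in> labels T" using two_boxes by (simp_all add: R_def S_def)
  have dist: "R \<noteq> {}" "S \<noteq> {}" "R \<noteq> S"
    using diagrams_2_distinct by (simp_all add: R_def S_def)
  have nb: "neighbours T (row_diagram 1) = {{}, R, S}"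
    using neighbours_row_1[OF two_boxes] by (simp add: R_def S_def)
  obtain \<iota> \<pi> where dec: "is_sum {{}, R, S} (V \<otimes> V) \<iota> \<pi>" using fusion[OF row_1_label] unfolding nb .
  note i = is_sum_inclusion[OF dec] and p = is_sum_projection[OF dec] and orth = is_sum_orthogonal[OF dec]
    and sum = is_sum_complete[OF dec]
  define u v \<iota>2 \<pi>2 \<iota>11 \<pi>11 where "u = \<iota> {}" and "v = \<pi> {}" and "\<iota>2 = \<iota> R" and "\<pi>2 = \<pi> R"
    and "\<iota>11 = \<iota> S" and "\<pi>11 = \<pi> S"
  note defs = u_def v_def \<iota>2_def \<pi>2_def \<iota>11_def \<pi>11_def
  have u: "u \<in> Hom C (tunit C) (V \<otimes> V)" and v: "v \<in> Hom C (V \<otimes> V) (tunit C)"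
    and i2: "\<iota>2 \<in> Hom C (X R) (V \<otimes> V)" and p2: "\<pi>2 \<in> Hom C (V \<otimes> V) (X R)"
    and i11: "\<iota>11 \<in> Hom C (X S) (V \<otimes> V)" and p11: "\<pi>11 \<in> Hom C (V \<otimes> V) (X S)"
    using i p X_empty unfolding defs by (metis insertI1 insertI2)+
  have o: "v \<cdot> u = idn C (tunit C)" "v \<cdot> \<iota>2 = 0" "v \<cdot> \<iota>11 = 0" "\<pi>2 \<cdot> u = 0" "\<pi>2 \<cdot> \<iota>2 = idn C (X R)" "\<pi>2 \<cdot> \<iota>11 = 0"
    "\<pi>11 \<cdot> u = 0" "\<pi>11 \<cdot> \<iota>2 = 0" "\<pi>11 \<cdot> \<iota>11 = idn C (X S)"
    using orth dist X_empty unfolding defs by auto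
  have one: "u \<cdot> v + (\<iota>2 \<cdot> \<pi>2 + \<iota>11 \<cdot> \<pi>11) = idn C (V \<otimes> V)"
    using sum dist unfolding defs by simp
  have t: "t \<in> Hom C (V \<otimes> V) (V \<otimes> V)" unfolding t_def by (rule smult_in_Hom[OF braid_in_Hom])
  have tu: "t \<cdot> u = inverse r \<odot> u" and t2: "t \<cdot> \<iota>2 = q \<odot> \<iota>2" and t11: "t \<cdot> \<iota>11 = (- inverse q) \<odot> \<iota>11"
    using a0 a2 a11 u i2 i11 unfolding acts_by_def R_def S_def by blast+
  define c where "c i = (if i = {} then inverse r else if i = R then q else - inverse q)" for i
  have "eigenvalues C (V \<otimes> V) t = c ` {{}, R, S}"
  proof (rule eigenvalues_of_sum[OF dec t])
    fix j assume "j \<in> {{}, R, S}"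
    then show "t \<cdot> \<iota> j = c j \<odot> \<iota> j"
      using tu t2 t11 dist unfolding defs c_def by auto
  qed
  then show "eigenvalues C (V \<otimes> V) t = {q, - inverse q, inverse r}"
    using dist by (auto simp: c_def)
  \<comment> \<open>The spectral projections of \<open>t\<close>; with them a polynomial identity
    for \<open>t\<close> reduces to the same identity for its eigenvalues.\<close>
  define e0 e2 e11 where "e0 = u \<cdot> v" and "e2 = \<iota>2 \<cdot> \<pi>2" and "e11 = \<iota>11 \<cdot> \<pi>11"
  have e0: "e0 \<in> Hom C (V \<otimes> V) (V \<otimes> V)" and e2: "e2 \<in> Hom C (V \<otimes> V) (V \<otimes> V)"
    and e11: "e11 \<in> Hom C (V \<otimes> V) (V \<otimes> V)"
    unfolding e0_def e2_def e11_def using comp_in_Hom[OF v u] comp_in_Hom[OF p2 i2] comp_in_Hom[OF p11 i11] .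
  have one': "idn C (V \<otimes> V) = e0 + (e2 + e11)" using one by (simp add: e0_def e2_def e11_def)
  have te: "t \<cdot> e0 = inverse r \<odot> e0" "t \<cdot> e2 = q \<odot> e2" "t \<cdot> e11 = (- inverse q) \<odot> e11"
    unfolding e0_def e2_def e11_def
    using comp_assoc[OF v u t] comp_assoc[OF p2 i2 t] comp_assoc[OF p11 i11 t] tu t2 t11
      comp_smult_left[OF v u] comp_smult_left[OF p2 i2] comp_smult_left[OF p11 i11]
    by (simp_all del: scale_minus_left)
  have t_add: "t \<cdot> (x \<odot> e0 + (y \<odot> e2 + z \<odot> e11)) = (x * inverse r) \<odot> e0 + ((y * q) \<odot> e2 + (z * - inverse q) \<odot> e11)" for x y z
    using comp_add_right[OF smult_in_Hom[OF e0] add_in_Hom[OF smult_in_Hom[OF e2] smult_in_Hom[OF e11]] t]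
      comp_add_right[OF smult_in_Hom[OF e2] smult_in_Hom[OF e11] t] comp_smult_right[OF e0 t]
      comp_smult_right[OF e2 t] comp_smult_right[OF e11 t] te by simp
  have t_eq: "t = inverse r \<odot> e0 + (q \<odot> e2 + (- inverse q) \<odot> e11)"
    using t_add[of 1 1 1] comp_idn[OF t] one' by simp
  have e2u: "e2 \<cdot> u = 0" unfolding e2_def comp_assoc[OF u p2 i2] o by (rule comp_zero_right[OF i2])
  have e2i: "e2 \<cdot> \<iota>2 = \<iota>2" unfolding e2_def comp_assoc[OF i2 p2 i2] o by (rule comp_idn[OF i2])
  have e2i11: "e2 \<cdot> \<iota>11 = 0" unfolding e2_def comp_assoc[OF i11 p2 i2] o by (rule comp_zero_right[OF i2])
  have simple2: "simple_obj C (X R)" "simple_obj C (X S)" using X_simple R S by blast+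
  have i2_0: "\<iota>2 \<noteq> 0" "\<iota>11 \<noteq> 0"
    using o simple2 comp_zero_right[OF p2] comp_zero_right[OF p11] unfolding simple_obj_def by auto
  then have e2_0: "e2 \<noteq> 0" using e2i comp_zero_left[OF i2] by auto
  \<comment> \<open>The projection \<open>e2\<close> onto [2] takes the place of \<open>p\<close>,
    and \<open>inverse r\<close> that of \<rho>.\<close>
  interpret n: normalized_braiding C V u v e2 t \<gamma> "inverse r"
    using X_simple[OF row_1_label] X_simple[OF empty_label] u v o(1) e2 e2_0 e2u t_def \<gamma> tu X_empty
    by unfold_locales simp_all
  have hecke: "q * q = 1" if r: "inverse r = q \<or> inverse r = - inverse q"
  proof -
    \<comment> \<open>The roots of x x = z x + 1 are \<open>q\<close> and
      \<open>- inverse q\<close>, and by \<open>r\<close> the third eigenvalue is one of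
      them.\<close>
    define z where "z = q - inverse q"
    have sq: "x * x = z * x + 1" if "x \<in> {q, - inverse q, inverse r}" for x
    proof -
      have "x = q \<or> x = - inverse q" using that r by auto
      then show ?thesis using q0 by (elim disjE) (simp_all add: z_def algebra_simps)
    qed
    have "t \<cdot> t = (inverse r * inverse r) \<odot> e0 + ((q * q) \<odot> e2 + (- inverse q * - inverse q) \<odot> e11)"
      using t_add[of "inverse r" q "- inverse q"] t_eq by simp
    also have "\<dots> = (z * inverse r + 1) \<odot> e0 + ((z * q + 1) \<odot> e2 + (z * - inverse q + 1) \<odot> e11)"
      using sq[of "inverse r"] sq[of q] sq[of "- inverse q"] by simp
    also have "\<dots> = z \<odot> (inverse r \<odot> e0 + (q \<odot> e2 + (- inverse q) \<odot> e11)) + idn C (V \<otimes> V)"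
      unfolding one'
      by (simp add: scale_left_distrib scale_right_distrib scale_left_diff_distrib scale_right_diff_distrib)
    finally have "t \<cdot> t = z \<odot> t + idn C (V \<otimes> V)" unfolding t_eq[symmetric] .
    then have "z = 0" by (rule n.hecke_unit)
    then have "q * q = inverse q * q" by (simp add: z_def)
    then show ?thesis using q0 by simp
  qed
  have kauffman: False if q: "q = - inverse q" and r: "inverse r \<noteq> q"
  proof -
    have qq: "q * q = -1"
    proof -
      have "q * q = q * (- inverse q)" using q by simp
      then show ?thesis using q0 by simp
    qed
    have v_e2: "v \<cdot> e2 = 0" unfolding e2_def comp_assoc[OF p2 i2 v, symmetric] o by (rule comp_zero_left[OF p2])
    have e22: "e2 \<cdot> e2 = e2"
      using comp_assoc[OF p2 i2 e2] e2i unfolding e2_def by simp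
    have "t = inverse r \<odot> e0 + (q \<odot> e2 + q \<odot> e11)" using t_eq unfolding q[symmetric] .
    also have "\<dots> = q \<odot> idn C (V \<otimes> V) + (inverse r - q) \<odot> e0"
      unfolding one' by (simp add: scale_left_diff_distrib scale_right_distrib)
    finally have t': "t = q \<odot> idn C (V \<otimes> V) + (inverse r - q) \<odot> (u \<cdot> v)" unfolding e0_def .
    interpret k: kauffman_braiding C V u v e2 t \<gamma> "inverse r" q "inverse r - q"
      using qq t' r e22 v_e2 by unfold_locales simp_all
    interpret b: bcd_self_dual C T X u n.w ..
    have hook: "hook \<in> labels T"
    proof (rule b.hook_label[OF n.wu n.\<epsilon>])
      show "T \<noteq> O_type 2"
      proof
        assume "T = O_type 2"
        then have "q \<noteq> - inverse q" by (rule T)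
        with q show False by contradiction
      qed
    qed
    have adj: "hook \<in> neighbours T R" "hook \<in> neighbours T S"
      using hook_neighbour[OF hook] by (simp_all add: R_def S_def)
    \<comment> \<open>Two embeddings of the hook: \<open>h\<close> through [2], where
      \<open>e2\<close> acts by 1, and below \<open>g\<close> through [1,1], where \<open>e2\<close>
      acts by 0.\<close>
    obtain h where h: "h \<in> Hom C (X hook) (V \<otimes> (V \<otimes> V))" "h \<noteq> 0"
      and h0: "\<And>f b. f \<in> Hom C (V \<otimes> V) b \<Longrightarrow> f \<cdot> \<iota>2 = 0 \<Longrightarrow> lay (tunit C) f V \<cdot> h = 0"
      and h1: "\<And>f. f \<in> Hom C (V \<otimes> V) (V \<otimes> V) \<Longrightarrow> f \<cdot> \<iota>2 = \<iota>2 \<Longrightarrow> lay (tunit C) f V \<cdot> h = h"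
      using hook_embedding[OF hook R adj(1) i2 p2 o(5)] by metis
    obtain g where g: "g \<in> Hom C (X hook) (V \<otimes> (V \<otimes> V))" "g \<noteq> 0"
      and g0: "\<And>f b. f \<in> Hom C (V \<otimes> V) b \<Longrightarrow> f \<cdot> \<iota>11 = 0 \<Longrightarrow> lay (tunit C) f V \<cdot> g = 0"
      using hook_embedding[OF hook S adj(2) i11 p11 o(9)] by metis
    \<comment> \<open>The contraction of the right pair lands in \<open>V\<close>, whose label
      differs from the hook, so it vanishes by the Schur lemma.\<close>
    have v2: "lay V v (tunit C) \<cdot> f = 0" if "f \<in> Hom C (X hook) (V \<otimes> (V \<otimes> V))" for f
      by (rule hom_distinct[OF hook row_1_label hook_not_row comp_in_Hom[OF that n.v2_in]])
    have span: "\<exists>a b c. f = a \<odot> idn C (V \<otimes> V) + b \<odot> (u \<cdot> v) + c \<odot> e2" if f: "f \<in> Hom C (V \<otimes> V) (V \<otimes> V)" for f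
    proof -
      have uX: "u \<in> Hom C (X {}) (V \<otimes> V)" using u X_empty by simp
      note into = hom_into_sum[OF dec]
      obtain x where "f \<cdot> u = x \<odot> u"
        using into[of "{}" "f \<cdot> u"] comp_in_Hom[OF uX f] unfolding u_def by auto
      then have x: "(f \<cdot> u) \<cdot> v = x \<odot> e0" using comp_smult_left[OF v u] by (simp add: e0_def)
      obtain y where "f \<cdot> \<iota>2 = y \<odot> \<iota>2"
        using into[of R "f \<cdot> \<iota>2"] comp_in_Hom[OF i2 f] unfolding \<iota>2_def by auto
      then have y: "(f \<cdot> \<iota>2) \<cdot> \<pi>2 = y \<odot> e2" using comp_smult_left[OF p2 i2] by (simp add: e2_def)
      obtain z where "f \<cdot> \<iota>11 = z \<odot> \<iota>11"
        using into[of S "f \<cdot> \<iota>11"] comp_in_Hom[OF i11 f] unfolding \<iota>11_def by auto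
      then have z: "(f \<cdot> \<iota>11) \<cdot> \<pi>11 = z \<odot> e11" using comp_smult_left[OF p11 i11] by (simp add: e11_def)
      have "f = f \<cdot> (e0 + (e2 + e11))" using comp_idn[OF f] one' by simp
      also have "\<dots> = f \<cdot> e0 + (f \<cdot> e2 + f \<cdot> e11)"
        using comp_add_right[OF e0 add_in_Hom[OF e2 e11] f] comp_add_right[OF e2 e11 f] by simp
      also have "\<dots> = x \<odot> e0 + (y \<odot> e2 + z \<odot> e11)"
        using x y z comp_assoc[OF v u f] comp_assoc[OF p2 i2 f] comp_assoc[OF p11 i11 f]
        by (simp add: e0_def e2_def e11_def)
      also have "\<dots> = z \<odot> idn C (V \<otimes> V) + (x - z) \<odot> (u \<cdot> v) + (y - z) \<odot> e2"
        unfolding one' e0_def[symmetric] by (simp add: scale_left_diff_distrib scale_right_distrib)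
      finally show ?thesis by blast
    qed
    \<comment> \<open>Evaluation on the summand [1,1] isolates \<open>a\<close>; evaluation on [2]
      then gives \<open>a + c\<close>.\<close>
    have indep: "c = 0" if eq: "a \<odot> idn C (V \<otimes> V) + b \<odot> (u \<cdot> v) + c \<odot> e2 = 0" for a b c
    proof -
      have act: "(a \<odot> idn C (V \<otimes> V) + b \<odot> (u \<cdot> v) + c \<odot> e2) \<cdot> j = a \<odot> j + c \<odot> (e2 \<cdot> j)"
        if j: "j \<in> Hom C y (V \<otimes> V)" "v \<cdot> j = 0" for j y
        using comp_add_left[OF j(1) add_in_Hom[OF smult_in_Hom[OF idn_in_Hom] smult_in_Hom[OF e0]] smult_in_Hom[OF e2]]
          comp_add_left[OF j(1) smult_in_Hom[OF idn_in_Hom] smult_in_Hom[OF e0]]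
          comp_smult_left[OF j(1) idn_in_Hom] comp_smult_left[OF j(1) e0] comp_smult_left[OF j(1) e2]
          idn_comp[OF j(1)] comp_assoc[OF j(1) v u] j(2) comp_zero_right[OF u]
        by (simp add: e0_def)
      have "a \<odot> \<iota>11 = 0" using act[OF i11 o(3)] eq comp_zero_left[OF i11] e2i11 by simp
      then have "a = 0" using i2_0 by simp
      moreover have "(a + c) \<odot> \<iota>2 = 0" using act[OF i2 o(2)] eq comp_zero_left[OF i2] e2i by (simp add: scale_left_distrib)
      ultimately show ?thesis using i2_0 by simp
    qed
    show False
      by (rule k.no_hook[OF span indep h h0[OF v o(2)] v2[OF h(1)] h1[OF e2 e2i]
            g g0[OF v o(3)] v2[OF g(1)] g0[OF e2 e2i11]])
  qed
  assume card: "card {q, - inverse q, inverse r} < 3"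
  then have "q = - inverse q \<or> inverse r = q \<or> inverse r = - inverse q"
    by (auto simp: card_insert_if split: if_splits)
  \<comment> \<open>A coincidence of \<open>q\<close> with \<open>- inverse q\<close> alone is
    refuted by \<open>kauffman\<close>; every other coincidence leads to the Hecke case.\<close>
  then have r: "inverse r = q \<or> inverse r = - inverse q" using kauffman by blast
  then have "q * q = 1" by (rule hecke)
  then have "q = 1 \<or> q = -1" by (simp add: square_eq_1_iff)
  then show "{q, - inverse q, inverse r} = {1, -1}" using r by auto
qed

end

theorem lemma6p4:
  fixes C :: "('o, 'm::ab_group_add) tensor_cat" (structure)
    and T :: bcd_type
    and X :: "diagram \<Rightarrow> 'o"
    and V :: 'o
    and t :: 'm
    and q r \<gamma> :: complex
  assumes "bcd_category C T X"
    and "V = X (row_diagram 1)"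
    and "q \<noteq> 0" and "r \<noteq> 0" and "\<gamma> ^ 4 = 1"
    and "t = \<gamma> \<odot> braid C V V"
    and "acts_by C (V \<otimes> V) t (X (row_diagram 2)) q"
    and "acts_by C (V \<otimes> V) t (X (column_diagram 2)) (- inverse q)"
    and "acts_by C (V \<otimes> V) t (tunit C) (inverse r)"
    and "T = O_type 2 \<Longrightarrow> q \<noteq> - inverse q"
    and "card (eigenvalues C (V \<otimes> V) t) < 3"
  shows "eigenvalues C (V \<otimes> V) t = {1, -1}"
proof -
  interpret bcd_category C T X by fact
  show ?thesis
    using braiding_eigenvalues[OF assms(3,5) assms(6-9)[unfolded assms(2)] assms(10)] assms(11)
    unfolding assms(2) by simp
qed

end
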